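(* Let $E$ be an arbitrary graph and $K$ any field. Let $P$ be a proper ideal of $L_K(E)$ with $H=P\cap E^0$. Then $P$ is right (equivalently, left) primitive if and only if $P$ satisfies one of the following: (i) $P$ is a non-graded prime ideal; (ii) $P$ is a graded prime ideal of the form $I_{(H,B_H\setminus\{u\})}$ for some $u\in B_H$; (iii) $P$ is a graded ideal of the form $I_{(H,B_H)}$ (where $B_H$ may be empty) and $E^0\setminus H$ satisfies the MT-3 condition, Condition (L) and the Countable Separation Property.
   Context: A graph $E=(E^0,E^1,r,s)$ consists of a set $E^0$ of vertices, a set $E^1$ of edges and maps $r,s:E^1\to E^0$ (range and source); no cardinality restrictions are imposed. A vertex $v$ is regular if $0<|s^{-1}(v)|<\infty$, an infinite emitter if $|s^{-1}(v)|=\infty$. The Leavitt path algebra $L_K(E)$ is the (not necessarily unital) $K$-algebra generated by pairwise orthogonal idempotents $v\in E^0$ and elements $e,e^*$ ($e\in E^1$) subject to: $s(e)e=e=er(e)$; $r(e)e^*=e^*=e^*s(e)$; $e^*e=r(e)$ and $e^*f=0$ for edges $e\ne f$; $v=\sum_{s(e)=v}ee^*$ for every regular vertex $v$. It is $\mathbb{Z}$-graded by $\deg v=0$, $\deg e=1$, $\deg e^*=-1$; a graded ideal is a homogeneous two-sided ideal. Ideals are two-sided. A proper ideal $P$ is prime if, for ideals $A,B$, $AB\subseteq P$ implies $A\subseteq P$ or $B\subseteq P$. An ideal is left (right) primitive if it is the left (right) annihilator of a simple left (right) module. A path is a finite sequence of edges $e_1\cdots e_n$ with $r(e_i)=s(e_{i+1})$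 (vertices are paths of length $0$). Write $u\ge v$ if there is a path from $u$ to $v$. A cycle is a path $e_1\cdots e_n$ ($n\ge1$) with $s(e_1)=r(e_n)$ and $s(e_i)\ne s(e_j)$ for $i\neq j$; an exit for it is an edge $f$ with $s(f)=s(e_i)$, $f\ne e_i$ for some $i$. A graph satisfies Condition (L) if every cycle in it has an exit. For $X\subseteq E^0$, $E_X$ is the graph with vertex set $X$ and edges those $e\in E^1$ with $s(e),r(e)\in X$; $X$ satisfies Condition (L) if $E_X$ does. $X$ satisfies MT-3 if for all $u,v\in X$ there is $w\in X$ with $u\ge w$, $v\ge w$. A subset $X\subseteq E^0$ has the Countable Separation Property if there is a countable set $C$ of vertices in $E$ such that for each $u\in X$ there is $v\in C$ with $u\ge v$. The set $H=P\cap E^0$ is hereditary ($u\in H$, $u\ge v$ imply $v\in H$) and saturated ($v$ regular and $r(s^{-1}(v))\subseteq H$ imply $v\in H$). $B_H$ is the set of breaking vertices of $H$: infinite emitters $w\in E^0\setminus H$ for which the number of edges $e$ with $s(e)=w$, $r(e)\notin H$ is finite and at least $1$. For $v\in B_H$, $v^H=v-\sum_{s(e)=v,\,r(e)\notin H}ee^*$. For $S\subseteq B_H$, $I_{(H,S)}$ is the ideal generated by $H\cup\{v^H:v\in S\}$.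
   Formalization: In the Countable Separation Property of E^0∖H the countable set C is required to lie inside E^0∖H (with C allowed to meet H, condition (iii) does not imply primitivity); simple modules are taken, up to isomorphism, on sets of elements of L_K(E). *)

theory Defs
  imports
    "HOL-Library.Countable_Set"
    "Graph_Theory.Digraph_Component"
    "Graph_Theory.Arc_Walk"
    "HOL-Algebra.Ideal_Product"
    "HOL-Algebra.Module"
begin

section \<open>Rings without unit, ideals and modules\<close>

text \<open>
  Leavitt path algebras need not be unital, whereas the locales \<^locale>\<open>ring\<close>,
  \<^locale>\<open>ideal\<close> and \<^locale>\<open>primeideal\<close> of HOL-Algebra require a unit. We
  reuse the records of HOL-Algebra, but none of the notions below refers to the unit field.
\<close>

definition rng_ideal :: "('a, 'm) ring_scheme \<Rightarrow> 'a set \<Rightarrow> bool" where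
  "rng_ideal R I \<longleftrightarrow>
     additive_subgroup I R \<and>
     (\<forall>a\<in>I. \<forall>x\<in>carrier R. x \<otimes>\<^bsub>R\<^esub> a \<in> I \<and> a \<otimes>\<^bsub>R\<^esub> x \<in> I)"

definition proper_ideal :: "('a, 'm) ring_scheme \<Rightarrow> 'a set \<Rightarrow> bool" where
  "proper_ideal R I \<longleftrightarrow> rng_ideal R I \<and> I \<noteq> carrier R"

definition ideal_generated :: "('a, 'm) ring_scheme \<Rightarrow> 'a set \<Rightarrow> 'a set" where
  "ideal_generated R X = \<Inter>{I. rng_ideal R I \<and> X \<subseteq> I}"

definition prime_ideal :: "('a, 'm) ring_scheme \<Rightarrow> 'a set \<Rightarrow> bool" where
  "prime_ideal R P \<longleftrightarrow>
     proper_ideal R P \<and>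
     (\<forall>A B. rng_ideal R A \<longrightarrow> rng_ideal R B \<longrightarrow> ideal_prod R A B \<subseteq> P \<longrightarrow> A \<subseteq> P \<or> B \<subseteq> P)"

definition additive_action :: "('a, 'm) ring_scheme \<Rightarrow> ('a, 'b) module \<Rightarrow> bool" where
  "additive_action R M \<longleftrightarrow>
     abelian_group M \<and>
     (\<forall>a\<in>carrier R. \<forall>x\<in>carrier M. a \<odot>\<^bsub>M\<^esub> x \<in> carrier M) \<and>
     (\<forall>a\<in>carrier R. \<forall>b\<in>carrier R. \<forall>x\<in>carrier M.
        (a \<oplus>\<^bsub>R\<^esub> b) \<odot>\<^bsub>M\<^esub> x = a \<odot>\<^bsub>M\<^esub> x \<oplus>\<^bsub>M\<^esub> b \<odot>\<^bsub>M\<^esub> x) \<and>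
     (\<forall>a\<in>carrier R. \<forall>x\<in>carrier M. \<forall>y\<in>carrier M.
        a \<odot>\<^bsub>M\<^esub> (x \<oplus>\<^bsub>M\<^esub> y) = a \<odot>\<^bsub>M\<^esub> x \<oplus>\<^bsub>M\<^esub> a \<odot>\<^bsub>M\<^esub> y)"

definition left_module :: "('a, 'm) ring_scheme \<Rightarrow> ('a, 'b) module \<Rightarrow> bool" where
  "left_module R M \<longleftrightarrow>
     additive_action R M \<and>
     (\<forall>a\<in>carrier R. \<forall>b\<in>carrier R. \<forall>x\<in>carrier M.
        (a \<otimes>\<^bsub>R\<^esub> b) \<odot>\<^bsub>M\<^esub> x = a \<odot>\<^bsub>M\<^esub> (b \<odot>\<^bsub>M\<^esub> x))"

text \<open>For a right module, \<open>a \<odot>\<^bsub>M\<^esub> x\<close> stands for the product of \<open>x\<close> by \<open>a\<close> on the right.\<close>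

definition right_module :: "('a, 'm) ring_scheme \<Rightarrow> ('a, 'b) module \<Rightarrow> bool" where
  "right_module R M \<longleftrightarrow>
     additive_action R M \<and>
     (\<forall>a\<in>carrier R. \<forall>b\<in>carrier R. \<forall>x\<in>carrier M.
        (a \<otimes>\<^bsub>R\<^esub> b) \<odot>\<^bsub>M\<^esub> x = b \<odot>\<^bsub>M\<^esub> (a \<odot>\<^bsub>M\<^esub> x))"

definition module_sub :: "('a, 'm) ring_scheme \<Rightarrow> ('a, 'b) module \<Rightarrow> 'b set \<Rightarrow> bool" where
  "module_sub R M N \<longleftrightarrow>
     additive_subgroup N M \<and> (\<forall>a\<in>carrier R. \<forall>x\<in>N. a \<odot>\<^bsub>M\<^esub> x \<in> N)"

text \<open>
  In the absence of a unit, simplicity includes the usual requirement that the action is not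
  identically zero; in particular a simple module is nonzero.
\<close>

definition simple_action :: "('a, 'm) ring_scheme \<Rightarrow> ('a, 'b) module \<Rightarrow> bool" where
  "simple_action R M \<longleftrightarrow>
     (\<exists>a\<in>carrier R. \<exists>x\<in>carrier M. a \<odot>\<^bsub>M\<^esub> x \<noteq> \<zero>\<^bsub>M\<^esub>) \<and>
     (\<forall>N. module_sub R M N \<longrightarrow> N = {\<zero>\<^bsub>M\<^esub>} \<or> N = carrier M)"

definition annihilator :: "('a, 'm) ring_scheme \<Rightarrow> ('a, 'b) module \<Rightarrow> 'a set" where
  "annihilator R M = {a \<in> carrier R. \<forall>x\<in>carrier M. a \<odot>\<^bsub>M\<^esub> x = \<zero>\<^bsub>M\<^esub>}"

text \<open>
  HOL cannot quantify over types, so the simple module is sought on the type \<open>'a set\<close>. This is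
  no restriction: a simple left module \<open>M\<close> equals \<open>R m\<close> for some \<open>m\<close>, hence is isomorphic to the
  quotient of \<open>R\<close> by the left ideal of all \<open>a\<close> with \<open>a m = 0\<close>, whose elements are cosets in \<open>R\<close>;
  likewise on the right.
\<close>

definition left_primitive :: "('a, 'm) ring_scheme \<Rightarrow> 'a set \<Rightarrow> bool" where
  "left_primitive R P \<longleftrightarrow>
     rng_ideal R P \<and>
     (\<exists>M :: ('a, 'a set) module. left_module R M \<and> simple_action R M \<and> P = annihilator R M)"

definition right_primitive :: "('a, 'm) ring_scheme \<Rightarrow> 'a set \<Rightarrow> bool" where
  "right_primitive R P \<longleftrightarrow>
     rng_ideal R P \<and>
     (\<exists>M :: ('a, 'a set) module. right_module R M \<and> simple_action R M \<and> P = annihilator R M)"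

section \<open>Graphs\<close>

text \<open>
  A graph is a \<^locale>\<open>wf_digraph\<close>: \<^const>\<open>tail\<close> is the source map \<open>s\<close> and \<^const>\<open>head\<close> the
  range map \<open>r\<close>; \<open>u \<ge> v\<close> is \<^const>\<open>reachable\<close>, \<open>s\<^sup>-\<^sup>1(v)\<close> is \<^const>\<open>out_arcs\<close>, and \<open>E\<^sub>X\<close> is
  \<^const>\<open>induce_subgraph\<close>. Infinitely many vertices, edges, and parallel edges are allowed.
\<close>

definition regular_vertex :: "('v, 'e) pre_digraph \<Rightarrow> 'v \<Rightarrow> bool" where
  "regular_vertex E v \<longleftrightarrow> v \<in> verts E \<and> out_arcs E v \<noteq> {} \<and> finite (out_arcs E v)"

definition graph_condition_L :: "('v, 'e) pre_digraph \<Rightarrow> bool" where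
  "graph_condition_L E \<longleftrightarrow>
     (\<forall>p. pre_digraph.cycle E p \<longrightarrow>
        (\<exists>e\<in>set p. \<exists>f\<in>arcs E. tail E f = tail E e \<and> f \<noteq> e))"

definition condition_L :: "('v, 'e) pre_digraph \<Rightarrow> 'v set \<Rightarrow> bool" where
  "condition_L E X \<longleftrightarrow> graph_condition_L (induce_subgraph E X)"

definition MT3 :: "('v, 'e) pre_digraph \<Rightarrow> 'v set \<Rightarrow> bool" where
  "MT3 E X \<longleftrightarrow> (\<forall>u\<in>X. \<forall>v\<in>X. \<exists>w\<in>X. reachable E u w \<and> reachable E v w)"

text \<open>
  The separating set is taken inside \<open>X\<close>. If it could be any set of vertices of the ambient graph,
  then for \<open>X\<close> the complement of a hereditary set \<open>H\<close> a single vertex of \<open>H\<close> reached from all of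
  \<open>X\<close> would separate \<open>X\<close>, and the property would say nothing about the graph \<open>E\<^sub>X\<close>.
\<close>

definition countable_separation :: "('v, 'e) pre_digraph \<Rightarrow> 'v set \<Rightarrow> bool" where
  "countable_separation E X \<longleftrightarrow>
     (\<exists>C. C \<subseteq> X \<and> countable C \<and> (\<forall>u\<in>X. \<exists>v\<in>C. reachable E u v))"

definition breaking_vertices :: "('v, 'e) pre_digraph \<Rightarrow> 'v set \<Rightarrow> 'v set" where
  "breaking_vertices E H =
     {w \<in> verts E - H. infinite (out_arcs E w) \<and>
        finite {e \<in> out_arcs E w. head E e \<notin> H} \<and> {e \<in> out_arcs E w. head E e \<notin> H} \<noteq> {}}"

section \<open>Leavitt path algebras\<close>

text \<open>
  The algebra is constructed from its presentation: its elements are the expressions formed from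
  the generators by the operations of a (not necessarily unital) algebra over the field \<open>'k\<close>,
  modulo the least congruence that contains the algebra axioms and the defining relations.
\<close>

datatype ('v, 'e, 'k) lpa_term =
    Vertex 'v
  | Edge 'e
  | Ghost 'e
  | Null
  | Add "('v, 'e, 'k) lpa_term" "('v, 'e, 'k) lpa_term"
  | Mul "('v, 'e, 'k) lpa_term" "('v, 'e, 'k) lpa_term"
  | Scl 'k "('v, 'e, 'k) lpa_term"

inductive_set lpa_terms :: "('v, 'e) pre_digraph \<Rightarrow> ('v, 'e, 'k) lpa_term set"
  for E :: "('v, 'e) pre_digraph" where
  "v \<in> verts E \<Longrightarrow> Vertex v \<in> lpa_terms E"
| "e \<in> arcs E \<Longrightarrow> Edge e \<in> lpa_terms E"
| "e \<in> arcs E \<Longrightarrow> Ghost e \<in> lpa_terms E"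
| "Null \<in> lpa_terms E"
| "a \<in> lpa_terms E \<Longrightarrow> b \<in> lpa_terms E \<Longrightarrow> Add a b \<in> lpa_terms E"
| "a \<in> lpa_terms E \<Longrightarrow> b \<in> lpa_terms E \<Longrightarrow> Mul a b \<in> lpa_terms E"
| "a \<in> lpa_terms E \<Longrightarrow> Scl c a \<in> lpa_terms E"

inductive algebra_axiom :: "('v, 'e, 'k::field) lpa_term \<Rightarrow> ('v, 'e, 'k) lpa_term \<Rightarrow> bool" where
  "algebra_axiom (Add (Add a b) c) (Add a (Add b c))"
| "algebra_axiom (Add a b) (Add b a)"
| "algebra_axiom (Add Null a) a"
| "algebra_axiom (Add (Scl (-1) a) a) Null"
| "algebra_axiom (Scl x (Add a b)) (Add (Scl x a) (Scl x b))"
| "algebra_axiom (Scl (x + y) a) (Add (Scl x a) (Scl y a))"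
| "algebra_axiom (Scl (x * y) a) (Scl x (Scl y a))"
| "algebra_axiom (Scl 1 a) a"
| "algebra_axiom (Mul (Mul a b) c) (Mul a (Mul b c))"
| "algebra_axiom (Mul a (Add b c)) (Add (Mul a b) (Mul a c))"
| "algebra_axiom (Mul (Add a b) c) (Add (Mul a c) (Mul b c))"
| "algebra_axiom (Mul (Scl x a) b) (Scl x (Mul a b))"
| "algebra_axiom (Mul a (Scl x b)) (Scl x (Mul a b))"

text \<open>
  In the last relation the finite set of edges leaving the regular vertex \<open>v\<close> is enumerated by
  \<open>es\<close>; by commutativity of addition the order is irrelevant.
\<close>

inductive lpa_relation ::
    "('v, 'e) pre_digraph \<Rightarrow> ('v, 'e, 'k) lpa_term \<Rightarrow> ('v, 'e, 'k) lpa_term \<Rightarrow> bool"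
  for E :: "('v, 'e) pre_digraph" where
  "v \<in> verts E \<Longrightarrow> lpa_relation E (Mul (Vertex v) (Vertex v)) (Vertex v)"
| "v \<in> verts E \<Longrightarrow> w \<in> verts E \<Longrightarrow> v \<noteq> w \<Longrightarrow> lpa_relation E (Mul (Vertex v) (Vertex w)) Null"
| "e \<in> arcs E \<Longrightarrow> lpa_relation E (Mul (Vertex (tail E e)) (Edge e)) (Edge e)"
| "e \<in> arcs E \<Longrightarrow> lpa_relation E (Mul (Edge e) (Vertex (head E e))) (Edge e)"
| "e \<in> arcs E \<Longrightarrow> lpa_relation E (Mul (Vertex (head E e)) (Ghost e)) (Ghost e)"
| "e \<in> arcs E \<Longrightarrow> lpa_relation E (Mul (Ghost e) (Vertex (tail E e))) (Ghost e)"
| "e \<in> arcs E \<Longrightarrow> lpa_relation E (Mul (Ghost e) (Edge e)) (Vertex (head E e))"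
| "e \<in> arcs E \<Longrightarrow> f \<in> arcs E \<Longrightarrow> e \<noteq> f \<Longrightarrow> lpa_relation E (Mul (Ghost e) (Edge f)) Null"
| "regular_vertex E v \<Longrightarrow> distinct es \<Longrightarrow> set es = out_arcs E v \<Longrightarrow>
     lpa_relation E (Vertex v) (foldr (\<lambda>e. Add (Mul (Edge e) (Ghost e))) es Null)"

inductive lpa_eq ::
    "('v, 'e) pre_digraph \<Rightarrow> ('v, 'e, 'k::field) lpa_term \<Rightarrow> ('v, 'e, 'k) lpa_term \<Rightarrow> bool"
  for E :: "('v, 'e) pre_digraph" where
  lpa_eq_axiom:
    "algebra_axiom a b \<Longrightarrow> a \<in> lpa_terms E \<Longrightarrow> b \<in> lpa_terms E \<Longrightarrow> lpa_eq E a b"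
| lpa_eq_relation:
    "lpa_relation E a b \<Longrightarrow> a \<in> lpa_terms E \<Longrightarrow> b \<in> lpa_terms E \<Longrightarrow> lpa_eq E a b"
| lpa_eq_refl: "a \<in> lpa_terms E \<Longrightarrow> lpa_eq E a a"
| lpa_eq_sym: "lpa_eq E a b \<Longrightarrow> lpa_eq E b a"
| lpa_eq_trans: "lpa_eq E a b \<Longrightarrow> lpa_eq E b c \<Longrightarrow> lpa_eq E a c"
| lpa_eq_Add: "lpa_eq E a a' \<Longrightarrow> lpa_eq E b b' \<Longrightarrow> lpa_eq E (Add a b) (Add a' b')"
| lpa_eq_Mul: "lpa_eq E a a' \<Longrightarrow> lpa_eq E b b' \<Longrightarrow> lpa_eq E (Mul a b) (Mul a' b')"
| lpa_eq_Scl: "lpa_eq E a a' \<Longrightarrow> lpa_eq E (Scl x a) (Scl x a')"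

definition lpa_class ::
    "('v, 'e) pre_digraph \<Rightarrow> ('v, 'e, 'k::field) lpa_term \<Rightarrow> ('v, 'e, 'k) lpa_term set" where
  "lpa_class E a = {b. lpa_eq E a b}"

text \<open>The field \<^const>\<open>one\<close> is left unspecified since the algebra need not have a unit.\<close>

definition leavitt ::
    "('v, 'e) pre_digraph \<Rightarrow> ('k::field, ('v, 'e, 'k) lpa_term set) module" where
  "leavitt E =
    \<lparr> carrier = lpa_class E ` lpa_terms E,
      mult = (\<lambda>A B. \<Union>a\<in>A. \<Union>b\<in>B. lpa_class E (Mul a b)),
      one = undefined,
      zero = lpa_class E Null,
      add = (\<lambda>A B. \<Union>a\<in>A. \<Union>b\<in>B. lpa_class E (Add a b)),
      smult = (\<lambda>x A. \<Union>a\<in>A. lpa_class E (Scl x a)) \<rparr>"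

inductive homogeneous_term :: "('v, 'e) pre_digraph \<Rightarrow> int \<Rightarrow> ('v, 'e, 'k) lpa_term \<Rightarrow> bool"
  for E :: "('v, 'e) pre_digraph" where
  "v \<in> verts E \<Longrightarrow> homogeneous_term E 0 (Vertex v)"
| "e \<in> arcs E \<Longrightarrow> homogeneous_term E 1 (Edge e)"
| "e \<in> arcs E \<Longrightarrow> homogeneous_term E (-1) (Ghost e)"
| "homogeneous_term E n Null"
| "homogeneous_term E n a \<Longrightarrow> homogeneous_term E n b \<Longrightarrow> homogeneous_term E n (Add a b)"
| "homogeneous_term E m a \<Longrightarrow> homogeneous_term E n b \<Longrightarrow> homogeneous_term E (m + n) (Mul a b)"
| "homogeneous_term E n a \<Longrightarrow> homogeneous_term E n (Scl x a)"

definition homogeneous_component ::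
    "('v, 'e) pre_digraph \<Rightarrow> int \<Rightarrow> ('v, 'e, 'k::field) lpa_term set set" where
  "homogeneous_component E n = {lpa_class E a |a. homogeneous_term E n a}"

definition graded_ideal :: "('v, 'e) pre_digraph \<Rightarrow> ('v, 'e, 'k::field) lpa_term set set \<Rightarrow> bool" where
  "graded_ideal E I \<longleftrightarrow>
     rng_ideal (leavitt E) I \<and>
     (\<forall>x\<in>I. \<exists>N f. finite N \<and> (\<forall>n\<in>N. f n \<in> I \<inter> homogeneous_component E n) \<and>
        x = (\<Oplus>\<^bsub>leavitt E\<^esub>n\<in>N. f n))"

definition ideal_vertices :: "('v, 'e) pre_digraph \<Rightarrow> ('v, 'e, 'k::field) lpa_term set set \<Rightarrow> 'v set" where
  "ideal_vertices E P = {v \<in> verts E. lpa_class E (Vertex v) \<in> P}"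

definition breaking_element ::
    "('v, 'e) pre_digraph \<Rightarrow> 'v set \<Rightarrow> 'v \<Rightarrow> ('v, 'e, 'k::field) lpa_term set" where
  "breaking_element E H v =
     lpa_class E (Vertex v) \<ominus>\<^bsub>leavitt E\<^esub>
     (\<Oplus>\<^bsub>leavitt E\<^esub>e\<in>{e \<in> out_arcs E v. head E e \<notin> H}.
        lpa_class E (Edge e) \<otimes>\<^bsub>leavitt E\<^esub> lpa_class E (Ghost e))"

definition ideal_HS ::
    "('v, 'e) pre_digraph \<Rightarrow> 'v set \<Rightarrow> 'v set \<Rightarrow> ('v, 'e, 'k::field) lpa_term set set" where
  "ideal_HS E H S =
     ideal_generated (leavitt E)
       ((\<lambda>v. lpa_class E (Vertex v)) ` H \<union> breaking_element E H ` S)"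

end

theory Submission
  imports Defs "HOL-Library.Poly_Mapping" "HOL-Library.Product_Plus" "HOL-Library.Function_Algebras"
    "HOL-Computational_Algebra.Polynomial"
begin

text \<open>
  Let \<open>J = I\<^bsub>(H,S)\<^esub>\<close>. Multiplying an element of an ideal \<open>Q\<close> strictly above \<open>J\<close> by suitable paths and
  ghost paths yields some \<open>u\<^sup>H\<close> with \<open>u \<in> B\<^sub>H - S\<close>, or a combination of closed walks at a vertex
  \<open>w \<notin> H\<close> in which the trivial walk \<open>w\<close> occurs. If the number of nontrivial walks in it is minimal,
  conjugation by the walks that leave \<open>w\<close> and avoid \<open>H\<close> must not lose any of them; hence either \<open>w \<in> Q\<close>
  or all these walks are initial segments of one periodic walk, that is, \<open>w\<close> lies on a cycle without
  exits. This reduction replaces the classification of ideals.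

  If \<open>P\<close> is graded and annihilates a simple module, the reduction gives \<open>P = I\<^bsub>(H,S)\<^esub>\<close>. Since
  \<open>u\<^sup>H A w\<^sup>H\<close> lies in \<open>P\<close> for distinct breaking vertices, primeness excludes at most one of them
  from \<open>S\<close>. The module yields a countable separating set, and if \<open>S = B\<^sub>H\<close> also Condition (L), because
  the corner at a cycle without exits is \<open>K[x, x\<^sup>-\<^sup>1]\<close> modulo \<open>P\<close>, which is not a field.

  Conversely, a prime ideal \<open>P\<close> is primitive as soon as some idempotent \<open>\<epsilon> \<notin> P\<close> has a division ring as
  its corner modulo \<open>P\<close>, for then \<open>A \<epsilon> / P \<epsilon>\<close> is simple. If \<open>u\<^sup>H \<notin> P\<close> for some breaking vertex, take
  \<open>\<epsilon> = u\<^sup>H\<close>; if \<open>P\<close> is not graded and contains all \<open>u\<^sup>H\<close>, take for \<open>\<epsilon>\<close> a vertex on a cycle without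
  exits, whose corner is a proper prime quotient of \<open>K[x, x\<^sup>-\<^sup>1]\<close>. In case (iii) every ideal
  strictly above \<open>P\<close> contains a vertex outside \<open>H\<close>. A separating sequence and MT-3 provide decreasing
  idempotents \<open>e\<^sub>n\<close> below a vertex \<open>v\<close> such that every such ideal contains some \<open>e\<^sub>n\<close>, and a maximal left
  ideal that contains all \<open>v - e\<^sub>n\<close> but not \<open>v\<close> defines the simple module.
\<close>

section \<open>Leavitt families\<close>

text \<open>The algebra depends on the graph, so it cannot be a type of its own. The argument
  therefore runs inside an arbitrary unital ring that contains a faithful copy \<open>A\<close> of
  it: the unit of the ring provides the empty products, while \<open>A\<close> itself may lack a
  unit and only has finite sums of vertices as local units. Faithfulness lets every assignment on
  terms that respects the relations descend to a map on \<open>A\<close>; the grading, the action on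
  walks and the involution all arise in this way. No basis of the algebra is constructed. Where
  linear independence of monomials might be expected, a homogeneous component (often the one of
  degree zero) or the action on walks decides that an element lies outside an ideal. Modules are
  studied on the left only. The involution that exchanges edges and ghost edges turns right modules
  into left modules and preserves each of the three conditions, which settles the equivalence of
  left and right primitivity.\<close>

inductive_set sumset :: "'a::monoid_add set \<Rightarrow> 'a set" for X where
  sumset_0: "0 \<in> sumset X"
| sumset_add: "x \<in> X \<Longrightarrow> y \<in> sumset X \<Longrightarrow> x + y \<in> sumset X"

lemma sumset_incl: "x \<in> X \<Longrightarrow> x \<in> sumset X"
  using sumset_add[of x X 0] sumset_0[of X] by simp

lemma sumset_plus: "x \<in> sumset X \<Longrightarrow> y \<in> sumset X \<Longrightarrow> x + y \<in> sumset X"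
  by (induction rule: sumset.induct) (auto simp: add.assoc intro: sumset.intros)

lemma sumset_mono: "X \<subseteq> Y \<Longrightarrow> sumset X \<subseteq> sumset Y"
proof
  fix x assume "X \<subseteq> Y" "x \<in> sumset X"
  from this(2,1) show "x \<in> sumset Y" by (induction) (auto intro: sumset.intros)
qed

lemma sumset_image:
  assumes "x \<in> sumset X" "f 0 = 0" "\<And>x y. f (x + y) = f x + f y" "\<And>x. x \<in> X \<Longrightarrow> f x \<in> sumset Y"
  shows "f x \<in> sumset Y"
  using assms(1) by induction (auto simp: assms intro: sumset_0 sumset_plus)

text \<open>Scalars are ring elements that commute with the generators. This is required of all
  generators, also those outside \<open>E\<close>, because \<open>eval\<close> is analysed by
  induction on arbitrary terms.\<close>

locale leavitt_family = wf_digraph E for E :: "('v, 'e) pre_digraph" +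
  fixes sc :: "'k::field \<Rightarrow> 'a::ring_1"
    and V :: "'v \<Rightarrow> 'a" and s :: "'e \<Rightarrow> 'a" and g :: "'e \<Rightarrow> 'a"
  assumes sc_add: "sc (x + y) = sc x + sc y"
    and sc_mult: "sc (x * y) = sc x * sc y"
    and sc_1: "sc 1 = 1"
    and sc_V: "V v * sc x = sc x * V v"
    and sc_s: "s e * sc x = sc x * s e"
    and sc_g: "g e * sc x = sc x * g e"
    and V_idem: "v \<in> verts E \<Longrightarrow> V v * V v = V v"
    and V_orth: "v \<in> verts E \<Longrightarrow> w \<in> verts E \<Longrightarrow> v \<noteq> w \<Longrightarrow> V v * V w = 0"
    and tail_s: "e \<in> arcs E \<Longrightarrow> V (tail E e) * s e = s e"
    and s_head: "e \<in> arcs E \<Longrightarrow> s e * V (head E e) = s e"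
    and head_g: "e \<in> arcs E \<Longrightarrow> V (head E e) * g e = g e"
    and g_tail: "e \<in> arcs E \<Longrightarrow> g e * V (tail E e) = g e"
    and g_s: "e \<in> arcs E \<Longrightarrow> g e * s e = V (head E e)"
    and g_s_orth: "e \<in> arcs E \<Longrightarrow> f \<in> arcs E \<Longrightarrow> e \<noteq> f \<Longrightarrow> g e * s f = 0"
    and CK: "regular_vertex E v \<Longrightarrow> V v = (\<Sum>e\<in>out_arcs E v. s e * g e)"
begin

primrec eval :: "('v, 'e, 'k) lpa_term \<Rightarrow> 'a" where
  "eval (Vertex v) = V v"
| "eval (Edge e) = s e"
| "eval (Ghost e) = g e"
| "eval Null = 0"
| "eval (Add a b) = eval a + eval b"
| "eval (Mul a b) = eval a * eval b"
| "eval (Scl x a) = sc x * eval a"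

lemma sc_0: "sc 0 = 0"
  using sc_add[of 0 0] by simp

lemma sc_minus: "sc (- x) = - sc x"
  using sc_add[of x "- x"] by (simp add: sc_0 eq_neg_iff_add_eq_0 add.commute)

lemma eval_sc: "eval a * sc x = sc x * eval a"
proof (induction a)
  case (Mul a b)
  have "eval a * eval b * sc x = eval a * sc x * eval b" using Mul.IH(2) by (simp add: mult.assoc)
  then show ?case using Mul.IH(1) by (simp add: mult.assoc)
next
  case (Scl y a)
  have "sc y * eval a * sc x = sc y * sc x * eval a" using Scl.IH by (simp add: mult.assoc)
  moreover have "sc y * sc x = sc x * sc y" by (simp add: mult.commute flip: sc_mult)
  ultimately show ?case by (simp add: mult.assoc)
qed (auto simp: sc_V sc_s sc_g algebra_simps)

lemma eval_algebra_axiom: "algebra_axiom a b \<Longrightarrow> eval a = eval b"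
proof (induction rule: algebra_axiom.induct)
  case (13 a x b)
  have "eval a * sc x * eval b = sc x * eval a * eval b" by (simp only: eval_sc)
  then show ?case by (simp add: mult.assoc)
qed (simp_all add: distrib_left distrib_right add.assoc mult.assoc sc_add sc_mult sc_1 sc_minus add.commute)

lemma eval_foldr:
  "distinct es \<Longrightarrow> eval (foldr (\<lambda>e. Add (Mul (Edge e) (Ghost e))) es Null) = (\<Sum>e\<in>set es. s e * g e)"
  by (induction es) auto

lemma eval_relation: "lpa_relation E a b \<Longrightarrow> eval a = eval b"
proof (induction rule: lpa_relation.induct)
  case (9 v es)
  then show ?case using CK[of v] by (simp add: eval_foldr)
qed (auto simp: V_idem V_orth tail_s s_head head_g g_tail g_s g_s_orth)

lemma eval_cong: "lpa_eq E a b \<Longrightarrow> eval a = eval b"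
  by (induction rule: lpa_eq.induct) (auto simp: eval_algebra_axiom eval_relation)

definition A :: "'a set" where "A = eval ` lpa_terms E"

lemma A_V: "v \<in> verts E \<Longrightarrow> V v \<in> A"
  unfolding A_def by (rule image_eqI[of _ _ "Vertex v"]) (auto intro: lpa_terms.intros)

lemma A_s: "e \<in> arcs E \<Longrightarrow> s e \<in> A"
  unfolding A_def by (rule image_eqI[of _ _ "Edge e"]) (auto intro: lpa_terms.intros)

lemma A_g: "e \<in> arcs E \<Longrightarrow> g e \<in> A"
  unfolding A_def by (rule image_eqI[of _ _ "Ghost e"]) (auto intro: lpa_terms.intros)

lemma A_0: "0 \<in> A"
  unfolding A_def by (rule image_eqI[of _ _ "Null"]) (auto intro: lpa_terms.intros)

lemma A_add: "x \<in> A \<Longrightarrow> y \<in> A \<Longrightarrow> x + y \<in> A"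
proof -
  assume "x \<in> A" "y \<in> A"
  then obtain a b where "a \<in> lpa_terms E" "b \<in> lpa_terms E" "x = eval a" "y = eval b"
    by (auto simp: A_def)
  then show ?thesis unfolding A_def
    by (intro image_eqI[of _ _ "Add a b"]) (auto intro: lpa_terms.intros)
qed

lemma A_mult: "x \<in> A \<Longrightarrow> y \<in> A \<Longrightarrow> x * y \<in> A"
proof -
  assume "x \<in> A" "y \<in> A"
  then obtain a b where "a \<in> lpa_terms E" "b \<in> lpa_terms E" "x = eval a" "y = eval b"
    by (auto simp: A_def)
  then show ?thesis unfolding A_def
    by (intro image_eqI[of _ _ "Mul a b"]) (auto intro: lpa_terms.intros)
qed

lemma A_sc: "x \<in> A \<Longrightarrow> sc k * x \<in> A"
proof -
  assume "x \<in> A"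
  then obtain a where "a \<in> lpa_terms E" "x = eval a"
    by (auto simp: A_def)
  then show ?thesis unfolding A_def
    by (intro image_eqI[of _ _ "Scl k a"]) (auto intro: lpa_terms.intros)
qed

lemma A_uminus: "x \<in> A \<Longrightarrow> - x \<in> A"
  using A_sc[of x "-1"] by (simp add: sc_minus sc_1)

lemma A_diff: "x \<in> A \<Longrightarrow> y \<in> A \<Longrightarrow> x - y \<in> A"
  using A_add[of x "- y"] A_uminus by simp

lemma A_sum: "(\<And>i. i \<in> I \<Longrightarrow> f i \<in> A) \<Longrightarrow> sum f I \<in> A"
  by (induction I rule: infinite_finite_induct) (auto intro: A_0 A_add)

lemmas A_closed = A_V A_s A_g A_0 A_add A_mult A_sc A_uminus A_diff A_sum

lemma sc_comm: "x \<in> A \<Longrightarrow> x * sc k = sc k * x"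
  unfolding A_def using eval_sc by auto

lemma A_induct [consumes 1, case_names V s g 0 add mult sc]:
  assumes "x \<in> A"
    and "\<And>v. v \<in> verts E \<Longrightarrow> Q (V v)"
    and "\<And>e. e \<in> arcs E \<Longrightarrow> Q (s e)"
    and "\<And>e. e \<in> arcs E \<Longrightarrow> Q (g e)"
    and "Q 0"
    and "\<And>x y. x \<in> A \<Longrightarrow> y \<in> A \<Longrightarrow> Q x \<Longrightarrow> Q y \<Longrightarrow> Q (x + y)"
    and "\<And>x y. x \<in> A \<Longrightarrow> y \<in> A \<Longrightarrow> Q x \<Longrightarrow> Q y \<Longrightarrow> Q (x * y)"
    and "\<And>x k. x \<in> A \<Longrightarrow> Q x \<Longrightarrow> Q (sc k * x)"
  shows "Q x"
proof -
  have "Q (eval t)" if "t \<in> lpa_terms E" for t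
    using that by induction (auto simp: A_def intro!: assms)
  then show ?thesis using assms(1) by (auto simp: A_def)
qed

end

text \<open>Two terms with the same value are related by the presentation, so every other Leavitt
  family of \<open>E\<close> takes the same value on them. A map out of \<open>A\<close> can thus be
  defined by choosing any representing term.\<close>

locale leavitt_model = leavitt_family E sc V s g
  for E :: "('v, 'e) pre_digraph" and sc :: "'k::field \<Rightarrow> 'a::ring_1" and V s g +
  assumes faithful: "a \<in> lpa_terms E \<Longrightarrow> b \<in> lpa_terms E \<Longrightarrow> eval a = eval b \<Longrightarrow> lpa_eq E a b"

section \<open>Existence of a faithful family\<close>

text \<open>Only the algebra axioms are imposed, on terms over arbitrary generators, so that the
  quotient is a type that mentions no graph.\<close>

inductive alg_eq :: "('v, 'e, 'k::field) lpa_term \<Rightarrow> ('v, 'e, 'k) lpa_term \<Rightarrow> bool" where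
  alg_eq_axiom: "algebra_axiom a b \<Longrightarrow> alg_eq a b"
| alg_eq_refl: "alg_eq a a"
| alg_eq_sym: "alg_eq a b \<Longrightarrow> alg_eq b a"
| alg_eq_trans: "alg_eq a b \<Longrightarrow> alg_eq b c \<Longrightarrow> alg_eq a c"
| alg_eq_Add: "alg_eq a a' \<Longrightarrow> alg_eq b b' \<Longrightarrow> alg_eq (Add a b) (Add a' b')"
| alg_eq_Mul: "alg_eq a a' \<Longrightarrow> alg_eq b b' \<Longrightarrow> alg_eq (Mul a b) (Mul a' b')"
| alg_eq_Scl: "alg_eq a a' \<Longrightarrow> alg_eq (Scl x a) (Scl x a')"

quotient_type (overloaded) ('v, 'e, 'k) free_alg = "('v, 'e, 'k::field) lpa_term" / alg_eq
  by (intro equivpI reflpI sympI transpI) (blast intro: alg_eq.intros)+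

instantiation free_alg :: (type, type, field) ring
begin

lift_definition zero_free_alg :: "('a, 'b, 'c) free_alg" is Null .
lift_definition plus_free_alg :: "('a, 'b, 'c) free_alg \<Rightarrow> ('a, 'b, 'c) free_alg \<Rightarrow> ('a, 'b, 'c) free_alg"
  is Add by (rule alg_eq_Add)
lift_definition uminus_free_alg :: "('a, 'b, 'c) free_alg \<Rightarrow> ('a, 'b, 'c) free_alg"
  is "Scl (- 1)" by (rule alg_eq_Scl)
lift_definition minus_free_alg :: "('a, 'b, 'c) free_alg \<Rightarrow> ('a, 'b, 'c) free_alg \<Rightarrow> ('a, 'b, 'c) free_alg"
  is "\<lambda>a b. Add a (Scl (- 1) b)" by (intro alg_eq_Add alg_eq_Scl)
lift_definition times_free_alg :: "('a, 'b, 'c) free_alg \<Rightarrow> ('a, 'b, 'c) free_alg \<Rightarrow> ('a, 'b, 'c) free_alg"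
  is Mul by (rule alg_eq_Mul)

instance
  by standard (transfer; intro alg_eq_axiom alg_eq_refl algebra_axiom.intros)+

end

lift_definition scl :: "'k::field \<Rightarrow> ('v, 'e, 'k) free_alg \<Rightarrow> ('v, 'e, 'k) free_alg" is Scl
  by (rule alg_eq_Scl)

lemma scl_mult_left: "scl k x * y = scl k (x * y)" and scl_mult_right: "x * scl k y = scl k (x * y)"
  by (transfer; intro alg_eq_axiom algebra_axiom.intros)+

interpretation scl: vector_space scl
  by standard
    (transfer; rule alg_eq_axiom alg_eq_axiom[THEN alg_eq_sym]; rule algebra_axiom.intros)+

interpretation scl_pair: vector_space_pair scl scl ..

text \<open>A derivation of \<^const>\<open>alg_eq\<close> between terms over \<open>E\<close> may pass through generators outside \<open>E\<close>.
  Sending those to zero turns it into a derivation of \<^const>\<open>lpa_eq\<close>.\<close>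

primrec cut :: "('v, 'e) pre_digraph \<Rightarrow> ('v, 'e, 'k) lpa_term \<Rightarrow> ('v, 'e, 'k) lpa_term" where
  "cut E (Vertex v) = (if v \<in> verts E then Vertex v else Null)"
| "cut E (Edge e) = (if e \<in> arcs E then Edge e else Null)"
| "cut E (Ghost e) = (if e \<in> arcs E then Ghost e else Null)"
| "cut E Null = Null"
| "cut E (Add a b) = Add (cut E a) (cut E b)"
| "cut E (Mul a b) = Mul (cut E a) (cut E b)"
| "cut E (Scl x a) = Scl x (cut E a)"

lemma cut_in_terms: "cut E a \<in> lpa_terms E"
  by (induction a) (auto intro: lpa_terms.intros)

lemma cut_id: "a \<in> lpa_terms E \<Longrightarrow> cut E a = a"
  by (induction rule: lpa_terms.induct) auto

lemma cut_algebra_axiom: "algebra_axiom a b \<Longrightarrow> algebra_axiom (cut E a) (cut E b)"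
  by (induction rule: algebra_axiom.induct) (simp_all add: algebra_axiom.intros)

lemma lpa_eq_cut: "alg_eq a b \<Longrightarrow> lpa_eq E (cut E a) (cut E b)"
  by (induction rule: alg_eq.induct)
    (auto intro: lpa_eq.intros cut_in_terms cut_algebra_axiom)

text \<open>This is the kernel of the map from the free algebra onto the Leavitt path algebra of
  \<open>E\<close> that kills the generators outside \<open>E\<close>.\<close>

lift_definition null_in :: "('v, 'e) pre_digraph \<Rightarrow> ('v, 'e, 'k::field) free_alg \<Rightarrow> bool"
  is "\<lambda>E a. lpa_eq E (cut E a) Null"
  using lpa_eq_cut lpa_eq_sym lpa_eq_trans by blast

lemma alg_eq_lpa_eq: "alg_eq a b \<Longrightarrow> a \<in> lpa_terms E \<Longrightarrow> b \<in> lpa_terms E \<Longrightarrow> lpa_eq E a b"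
  using lpa_eq_cut[of a b E] by (simp add: cut_id)

lemma null_in_0: "null_in E 0"
  by transfer (auto intro: lpa_eq.intros lpa_terms.intros)

lemma null_in_add: "null_in E x \<Longrightarrow> null_in E y \<Longrightarrow> null_in E (x + y)"
proof (transfer fixing: E)
  fix a b :: "('a, 'b, 'c) lpa_term"
  assume "lpa_eq E (cut E a) Null" "lpa_eq E (cut E b) Null"
  then have "lpa_eq E (Add (cut E a) (cut E b)) (Add Null Null)" by (rule lpa_eq_Add)
  moreover have "lpa_eq E (Add Null Null :: ('a, 'b, 'c) lpa_term) Null"
    by (intro lpa_eq_axiom algebra_axiom.intros lpa_terms.intros)
  ultimately show "lpa_eq E (cut E (Add a b)) Null" by (simp add: lpa_eq_trans[of E])
qed

lemma null_in_scl: "null_in E x \<Longrightarrow> null_in E (scl k x)"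
proof -
  \<comment> \<open>Consequences of the axioms such as k 0 = 0 hold in the quotient type and are
    transferred back to \<open>alg_eq\<close> instead of being derived by hand.\<close>
  have "scl k (0 :: ('a, 'b, 'c) free_alg) = 0" by simp
  then have "alg_eq (Scl k Null) (Null :: ('a, 'b, 'c) lpa_term)" by transfer
  then have *: "lpa_eq E (Scl k Null) (Null :: ('a, 'b, 'c) lpa_term)"
    by (rule alg_eq_lpa_eq) (intro lpa_terms.intros)+
  show "null_in E x \<Longrightarrow> null_in E (scl k x)"
    by (transfer fixing: E k) (use * in \<open>auto intro: lpa_eq_trans lpa_eq_Scl\<close>)
qed

lemma null_in_mult: "null_in E x \<Longrightarrow> null_in E (y * x)"
proof (transfer fixing: E)
  fix a b :: "('a, 'b, 'c) lpa_term"
  have "abs_free_alg (cut E b) * 0 = 0" by simp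
  then have "alg_eq (Mul (cut E b) Null) Null" by transfer
  then have *: "lpa_eq E (Mul (cut E b) Null) Null"
    by (rule alg_eq_lpa_eq) (intro lpa_terms.intros cut_in_terms)+
  assume "lpa_eq E (cut E a) Null"
  then have "lpa_eq E (Mul (cut E b) (cut E a)) (Mul (cut E b) Null)"
    by (intro lpa_eq_Mul lpa_eq_refl cut_in_terms)
  with * show "lpa_eq E (cut E (Mul b a)) Null" by (auto intro: lpa_eq_trans)
qed

lemma null_in_mult_left: "null_in E x \<Longrightarrow> null_in E (x * y)"
proof (transfer fixing: E)
  fix a b :: "('a, 'b, 'c) lpa_term"
  have "0 * abs_free_alg (cut E b) = 0" by simp
  then have "alg_eq (Mul Null (cut E b)) Null" by transfer
  then have *: "lpa_eq E (Mul Null (cut E b)) Null"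
    by (rule alg_eq_lpa_eq) (intro lpa_terms.intros cut_in_terms)+
  assume "lpa_eq E (cut E a) Null"
  then have "lpa_eq E (Mul (cut E a) (cut E b)) (Mul Null (cut E b))"
    by (intro lpa_eq_Mul lpa_eq_refl cut_in_terms)
  with * show "lpa_eq E (cut E (Mul a b)) Null" by (auto intro: lpa_eq_trans)
qed

lemma lpa_eq_imp_null_in:
  assumes "lpa_eq E (cut E a) (cut E b)"
  shows "null_in E (abs_free_alg a - abs_free_alg b)"
proof -
  have "lpa_eq E (Add (cut E a) (Scl (- 1) (cut E b))) (Add (cut E b) (Scl (- 1) (cut E b)))"
    by (intro lpa_eq_Add lpa_eq_refl assms lpa_terms.intros cut_in_terms)
  moreover have "abs_free_alg (cut E b) - abs_free_alg (cut E b) = 0" by simp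
  then have "alg_eq (Add (cut E b) (Scl (- 1) (cut E b))) Null" by transfer
  then have "lpa_eq E (Add (cut E b) (Scl (- 1) (cut E b))) Null"
    by (rule alg_eq_lpa_eq) (intro lpa_terms.intros cut_in_terms)+
  ultimately have "lpa_eq E (cut E (Add a (Scl (- 1) b))) Null" by (auto intro: lpa_eq_trans)
  then show ?thesis by (simp add: minus_free_alg.abs_eq null_in.abs_eq)
qed

lemma null_in_imp_lpa_eq:
  assumes "null_in E (abs_free_alg a - abs_free_alg b)"
  shows "lpa_eq E (cut E a) (cut E b)"
proof -
  let ?d = "Add (cut E a) (Scl (- 1) (cut E b))"
  have d: "lpa_eq E ?d Null"
    using assms by (simp add: minus_free_alg.abs_eq null_in.abs_eq)
  have "abs_free_alg (cut E a) =
      (abs_free_alg (cut E a) - abs_free_alg (cut E b)) + abs_free_alg (cut E b)" by simp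
  then have "alg_eq (cut E a) (Add ?d (cut E b))" by transfer
  then have "lpa_eq E (cut E a) (Add ?d (cut E b))"
    by (rule alg_eq_lpa_eq) (intro lpa_terms.intros cut_in_terms)+
  moreover have "lpa_eq E (Add ?d (cut E b)) (Add Null (cut E b))"
    by (intro lpa_eq_Add d lpa_eq_refl cut_in_terms)
  moreover have "lpa_eq E (Add Null (cut E b)) (cut E b)"
    by (intro lpa_eq_axiom algebra_axiom.intros lpa_terms.intros cut_in_terms)
  ultimately show ?thesis by (blast intro: lpa_eq_trans)
qed

text \<open>HOL has no quotient types that depend on \<open>E\<close>. Instead, multiplication followed by a linear map \<open>r\<close>
  whose kernel is the ideal of relations lets the Leavitt path algebra act faithfully on the free
  algebra, so that it becomes a subring of an endomorphism ring.\<close>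

lemma ex_retract:
  fixes E :: "('v, 'e) pre_digraph"
  shows "\<exists>r :: ('v, 'e, 'k::field) free_alg \<Rightarrow> ('v, 'e, 'k) free_alg.
     (\<forall>x y. r (x + y) = r x + r y) \<and> (\<forall>k x. r (scl k x) = scl k (r x)) \<and>
     (\<forall>x. null_in E (x - r x)) \<and> (\<forall>x. null_in E x \<longrightarrow> r x = 0)"
proof -
  let ?T = "{x :: ('v, 'e, 'k) free_alg. null_in E x}"
  have "scl.subspace ?T"
    by (intro scl.subspaceI) (auto intro: null_in_0 null_in_add null_in_scl)
  moreover have "Vector_Spaces.linear scl scl id" by (rule scl.linear_id)
  ultimately obtain h where h: "range h \<subseteq> ?T" "Vector_Spaces.linear scl scl h" "\<forall>x\<in>?T. h (id x) = x"
    using scl_pair.linear_exists_left_inverse_on[of id ?T] by auto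
  interpret h: Vector_Spaces.linear scl scl h by fact
  \<comment> \<open>\<open>h\<close> is a linear projection onto the kernel of the relations, hence
    \<open>x - h x\<close> is the projection along that kernel.\<close>
  show ?thesis
    by (rule exI[of _ "\<lambda>x. x - h x"])
      (use h(1,3) in \<open>auto simp: h.add h.scale scl.scale_right_diff_distrib\<close>)
qed

definition retract :: "('v, 'e) pre_digraph \<Rightarrow> ('v, 'e, 'k::field) free_alg \<Rightarrow> ('v, 'e, 'k) free_alg" where
  "retract E = (SOME r. (\<forall>x y. r (x + y) = r x + r y) \<and> (\<forall>k x. r (scl k x) = scl k (r x)) \<and>
     (\<forall>x. null_in E (x - r x)) \<and> (\<forall>x. null_in E x \<longrightarrow> r x = 0))"

lemma retract_add: "retract E (x + y) = retract E x + retract E y"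
  and retract_scl: "retract E (scl k x) = scl k (retract E x)"
  and null_in_retract: "null_in E (x - retract E x)"
  and retract_null_in: "null_in E x \<Longrightarrow> retract E x = 0"
  using someI_ex[OF ex_retract[of E], folded retract_def] by auto

lemma retract_0: "retract E 0 = 0"
  by (simp add: retract_null_in null_in_0)

lemma retract_diff: "retract E (x - y) = retract E x - retract E y"
  using retract_add[of E "x - y" y] by simp

lemma retract_eq_iff: "retract E x = retract E y \<longleftrightarrow> null_in E (x - y)"
  using null_in_retract[of E "x - y"] retract_null_in[of E "x - y"] retract_diff[of E x y] by auto

lemma retract_mult: "retract E (x * retract E y) = retract E (x * y)"
proof -
  have "null_in E (x * (y - retract E y))" by (intro null_in_mult null_in_retract)
  then show ?thesis using retract_eq_iff[of E "x * y" "x * retract E y"]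
    by (simp add: right_diff_distrib)
qed

text \<open>The summand \<open>'k\<close> makes the endomorphism ring nontrivial and adjoins a unit to a ring acting
  on itself.\<close>

typedef (overloaded) ('b, 'k) endo =
  "{f :: 'b::ab_group_add \<times> 'k::field \<Rightarrow> 'b \<times> 'k. \<forall>x y. f (x + y) = f x + f y}"
  morphisms app Endo
  by (rule exI[of _ "\<lambda>x. 0"]) auto

setup_lifting type_definition_endo

lemma endo_zero:
  fixes f :: "'b::ab_group_add \<times> 'k::field \<Rightarrow> 'b \<times> 'k"
  assumes "\<forall>x y. f (x + y) = f x + f y"
  shows "f 0 = 0"
  using assms[rule_format, of 0 0] by simp

instantiation endo :: (ab_group_add, field) ring_1
begin

lift_definition zero_endo :: "('a, 'b) endo" is "\<lambda>x. 0" by auto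
lift_definition one_endo :: "('a, 'b) endo" is "\<lambda>x. x" by auto
lift_definition plus_endo :: "('a, 'b) endo \<Rightarrow> ('a, 'b) endo \<Rightarrow> ('a, 'b) endo"
  is "\<lambda>f g x. f x + g x" by (auto simp: algebra_simps)
lift_definition minus_endo :: "('a, 'b) endo \<Rightarrow> ('a, 'b) endo \<Rightarrow> ('a, 'b) endo"
  is "\<lambda>f g x. f x - g x" by (auto simp: algebra_simps)
lift_definition uminus_endo :: "('a, 'b) endo \<Rightarrow> ('a, 'b) endo"
  is "\<lambda>f x. - f x" by (auto simp: algebra_simps)
lift_definition times_endo :: "('a, 'b) endo \<Rightarrow> ('a, 'b) endo \<Rightarrow> ('a, 'b) endo"
  is "\<lambda>f g x. f (g x)" by auto

instance
proof
  fix a b c :: "('a, 'b) endo"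
  show "(0 :: ('a, 'b) endo) \<noteq> 1"
    by transfer (metis zero_neq_one snd_conv snd_zero)
  show "a + b + c = a + (b + c)" by transfer (simp add: add.assoc)
  show "a + b = b + a" by transfer (simp add: add.commute)
  show "0 + a = a" "- a + a = 0" "a - b = a + - b" by (transfer; simp)+
  show "a * b * c = a * (b * c)" "1 * a = a" "a * 1 = a" by (transfer; simp)+
  show "(a + b) * c = a * c + b * c" by transfer (rule refl)
  show "a * (b + c) = a * b + a * c" by transfer (rule ext, blast)
qed

end

lemma endo_eqI: "(\<And>x k. app f (x, k) = app h (x, k)) \<Longrightarrow> f = h"
  by transfer (auto simp: fun_eq_iff)

lemma app_simps [simp]:
  "app 0 z = 0" "app 1 z = z" "app (f + h) z = app f z + app h z" "app (f * h) z = app f (app h z)"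
  by (transfer; simp)+

text \<open>The pair \<open>(z, k)\<close> stands for z + k 1 in the algebra with a unit adjoined,
  and a (z + k 1) = a z + k a has no unit part.\<close>

lift_definition lmul :: "('v, 'e) pre_digraph \<Rightarrow> ('v, 'e, 'k::field) free_alg \<Rightarrow> (('v, 'e, 'k) free_alg, 'k) endo"
  is "\<lambda>E a z. (retract E (a * fst z + scl (snd z) a), 0)"
  by (auto simp: retract_add distrib_left scl.scale_left_distrib)

lift_definition lscl :: "'k::field \<Rightarrow> (('v, 'e, 'k) free_alg, 'k) endo"
  is "\<lambda>k z. (scl k (fst z), k * snd z)"
  by (auto simp: scl.scale_right_distrib algebra_simps)

lemma lmul_app: "app (lmul E a) z = (retract E (a * fst z + scl (snd z) a), 0)"
  by transfer simp

lemma lscl_app: "app (lscl k) z = (scl k (fst z), k * snd z)"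
  by transfer simp

lemma lmul_add: "lmul E (a + b) = lmul E a + lmul E b"
  by (rule endo_eqI)
    (simp add: lmul_app distrib_right scl.scale_right_distrib retract_add)

lemma lmul_0: "lmul E 0 = 0"
  by (rule endo_eqI) (simp add: lmul_app retract_0 zero_prod_def)

lemma lmul_mult: "lmul E (a * b) = lmul E a * lmul E b"
  by (rule endo_eqI)
    (simp add: lmul_app retract_mult distrib_left mult.assoc scl_mult_right)

lemma lmul_scl: "lmul E (scl k a) = lscl k * lmul E a" and lmul_lscl: "lmul E a * lscl k = lscl k * lmul E a"
  by (rule endo_eqI; simp add: lmul_app lscl_app scl_mult_left scl_mult_right scl.scale_right_distrib
      mult.commute flip: retract_scl)+

text \<open>The adjoined unit \<open>(0, 1)\<close> is sent to \<open>retract E x\<close>, so the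
  operator determines \<open>x\<close> modulo the relations.\<close>

lemma lmul_eq_iff: "lmul E x = lmul E y \<longleftrightarrow> null_in E (x - y)"
proof
  assume "lmul E x = lmul E y"
  then have "app (lmul E x) (0, 1) = app (lmul E y) (0, 1)" by simp
  then show "null_in E (x - y)" by (simp add: lmul_app retract_eq_iff)
next
  assume *: "null_in E (x - y)"
  show "lmul E x = lmul E y"
  proof (rule endo_eqI)
    fix z k
    have "null_in E ((x - y) * z + scl k (x - y))"
      by (intro null_in_add null_in_mult_left null_in_scl *)
    moreover have "(x - y) * z + scl k (x - y) = (x * z + scl k x) - (y * z + scl k y)"
      by (simp add: algebra_simps scl.scale_right_diff_distrib)
    ultimately show "app (lmul E x) (z, k) = app (lmul E y) (z, k)"
      by (simp add: lmul_app retract_eq_iff)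
  qed
qed

abbreviation lmul_term :: "('v, 'e) pre_digraph \<Rightarrow> ('v, 'e, 'k::field) lpa_term \<Rightarrow> (('v, 'e, 'k) free_alg, 'k) endo" where
  "lmul_term E a \<equiv> lmul E (abs_free_alg a)"

lemma lmul_term_eq_iff: "lmul_term E a = lmul_term E b \<longleftrightarrow> lpa_eq E (cut E a) (cut E b)"
  using lmul_eq_iff lpa_eq_imp_null_in null_in_imp_lpa_eq by blast

lemma lmul_term_simps:
  "lmul_term E Null = 0"
  "lmul_term E (Add a b) = lmul_term E a + lmul_term E b"
  "lmul_term E (Mul a b) = lmul_term E a * lmul_term E b"
  "lmul_term E (Scl k a) = lscl k * lmul_term E a"
  using lmul_0[of E] lmul_add[of E "abs_free_alg a" "abs_free_alg b"]
    lmul_mult[of E "abs_free_alg a" "abs_free_alg b"] lmul_scl[of E k "abs_free_alg a"]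
  by (simp_all add: zero_free_alg.abs_eq plus_free_alg.abs_eq times_free_alg.abs_eq scl.abs_eq)

lemma lmul_term_relation:
  assumes "lpa_relation E a b" "a \<in> lpa_terms E" "b \<in> lpa_terms E"
  shows "lmul_term E a = lmul_term E b"
  unfolding lmul_term_eq_iff by (simp add: assms cut_id lpa_eq_relation)

lemma leavitt_model_lmul:
  assumes "wf_digraph (E :: ('v, 'e) pre_digraph)"
  shows "leavitt_model E (lscl :: 'k::field \<Rightarrow> _) (\<lambda>v. lmul_term E (Vertex v))
    (\<lambda>e. lmul_term E (Edge e)) (\<lambda>e. lmul_term E (Ghost e))"
proof -
  interpret wf_digraph E by fact
  interpret leavitt_family E "lscl :: 'k \<Rightarrow> _" "\<lambda>v. lmul_term E (Vertex v)"
    "\<lambda>e. lmul_term E (Edge e)" "\<lambda>e. lmul_term E (Ghost e)"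
  proof
    have rel: "lmul_term E a = lmul_term E b"
      if "lpa_relation E a b" "a \<in> lpa_terms E" "b \<in> lpa_terms E" for a b :: "('v, 'e, 'k) lpa_term"
      using that by (rule lmul_term_relation)
    note simps = lmul_term_simps(1,3) lpa_terms.intros lpa_relation.intros
    let ?m = "lmul_term E :: ('v, 'e, 'k) lpa_term \<Rightarrow> _"
    fix v w :: 'v and e f :: 'e
    show "v \<in> verts E \<Longrightarrow> ?m (Vertex v) * ?m (Vertex v) = ?m (Vertex v)"
      using rel[of "Mul (Vertex v) (Vertex v)" "Vertex v"] by (simp add: simps)
    show "v \<in> verts E \<Longrightarrow> w \<in> verts E \<Longrightarrow> v \<noteq> w \<Longrightarrow> ?m (Vertex v) * ?m (Vertex w) = 0"
      using rel[of "Mul (Vertex v) (Vertex w)" Null] by (simp add: simps)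
    show "e \<in> arcs E \<Longrightarrow> ?m (Vertex (tail E e)) * ?m (Edge e) = ?m (Edge e)"
      using rel[of "Mul (Vertex (tail E e)) (Edge e)" "Edge e"] by (simp add: simps)
    show "e \<in> arcs E \<Longrightarrow> ?m (Edge e) * ?m (Vertex (head E e)) = ?m (Edge e)"
      using rel[of "Mul (Edge e) (Vertex (head E e))" "Edge e"] by (simp add: simps)
    show "e \<in> arcs E \<Longrightarrow> ?m (Vertex (head E e)) * ?m (Ghost e) = ?m (Ghost e)"
      using rel[of "Mul (Vertex (head E e)) (Ghost e)" "Ghost e"] by (simp add: simps)
    show "e \<in> arcs E \<Longrightarrow> ?m (Ghost e) * ?m (Vertex (tail E e)) = ?m (Ghost e)"
      using rel[of "Mul (Ghost e) (Vertex (tail E e))" "Ghost e"] by (simp add: simps)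
    show "e \<in> arcs E \<Longrightarrow> ?m (Ghost e) * ?m (Edge e) = ?m (Vertex (head E e))"
      using rel[of "Mul (Ghost e) (Edge e)" "Vertex (head E e)"] by (simp add: simps)
    show "e \<in> arcs E \<Longrightarrow> f \<in> arcs E \<Longrightarrow> e \<noteq> f \<Longrightarrow> ?m (Ghost e) * ?m (Edge f) = 0"
      using rel[of "Mul (Ghost e) (Edge f)" Null] by (simp add: simps)
  next
    fix v :: 'v assume v: "regular_vertex E v"
    then obtain es where es: "distinct es" "set es = out_arcs E v"
      unfolding regular_vertex_def by (metis finite_distinct_list)
    let ?t = "foldr (\<lambda>e. Add (Mul (Edge e) (Ghost e))) es Null :: ('v, 'e, 'k) lpa_term"
    have "lmul_term E ?t = (\<Sum>e\<in>set es. lmul_term E (Edge e) * lmul_term E (Ghost e))"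
      using es(1) by (induction es) (auto simp: lmul_term_simps)
    moreover have "set es \<subseteq> arcs E" using es by auto
    then have "?t \<in> lpa_terms E"
      by (induction es) (auto intro: lpa_terms.intros)
    then have "lmul_term E ?t = lmul_term E (Vertex v)"
      using v es
      by (intro lmul_term_relation[symmetric] lpa_relation.intros)
        (auto intro!: lpa_terms.intros simp: regular_vertex_def)
    ultimately show "(lmul_term E (Vertex v) :: (('v, 'e, 'k) free_alg, 'k) endo) =
        (\<Sum>e\<in>out_arcs E v. lmul_term E (Edge e) * lmul_term E (Ghost e))"
      using es by simp
  next
    fix x y :: 'k
    show "(lscl (x + y) :: (('v, 'e, 'k) free_alg, 'k) endo) = lscl x + lscl y"
      by (rule endo_eqI) (simp add: lscl_app scl.scale_left_distrib algebra_simps)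
    show "(lscl (x * y) :: (('v, 'e, 'k) free_alg, 'k) endo) = lscl x * lscl y"
      by (rule endo_eqI) (simp add: lscl_app mult.assoc)
    show "(lscl 1 :: (('v, 'e, 'k) free_alg, 'k) endo) = 1"
      by (rule endo_eqI) (simp add: lscl_app)
  qed (simp_all add: lmul_lscl)
  have eval: "eval a = lmul_term E a" for a
    by (induction a) (simp_all add: lmul_term_simps)
  show ?thesis
    by unfold_locales (simp add: eval lmul_term_eq_iff cut_id)
qed

section \<open>Monomials, ideals and the grading\<close>

context leavitt_family
begin

text \<open>The empty path gives the unit of the ambient ring, which may lie outside
  \<open>A\<close>. The element of the algebra that belongs to a path \<alpha> ending in w is
  therefore \<open>pe \<alpha> * V w\<close>, and \<open>V w * ge \<alpha>\<close> for the ghost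
  path.\<close>

definition pe :: "'e list \<Rightarrow> 'a" where "pe \<alpha> = prod_list (map s \<alpha>)"
definition ge :: "'e list \<Rightarrow> 'a" where "ge \<alpha> = prod_list (map g (rev \<alpha>))"

lemma pe_simps [simp]: "pe [] = 1" "pe (e # \<alpha>) = s e * pe \<alpha>" "pe (\<alpha> @ \<beta>) = pe \<alpha> * pe \<beta>"
  by (simp_all add: pe_def)

lemma ge_simps [simp]: "ge [] = 1" "ge (e # \<alpha>) = ge \<alpha> * g e" "ge (\<alpha> @ \<beta>) = ge \<beta> * ge \<alpha>"
  by (simp_all add: ge_def)

lemma V_V: "v \<in> verts E \<Longrightarrow> w \<in> verts E \<Longrightarrow> V v * V w = (if v = w then V v else 0)"
  using V_idem V_orth by auto

lemma V_s: "v \<in> verts E \<Longrightarrow> e \<in> arcs E \<Longrightarrow> V v * s e = (if v = tail E e then s e else 0)"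
  by (metis V_V mult.assoc mult_zero_left tail_in_verts tail_s)

lemma s_V: "v \<in> verts E \<Longrightarrow> e \<in> arcs E \<Longrightarrow> s e * V v = (if v = head E e then s e else 0)"
  by (metis V_V mult.assoc mult_zero_right head_in_verts s_head)

lemma g_V: "v \<in> verts E \<Longrightarrow> e \<in> arcs E \<Longrightarrow> g e * V v = (if v = tail E e then g e else 0)"
  by (metis V_V mult.assoc mult_zero_right tail_in_verts g_tail)

lemma V_pe:
  assumes "awalk u \<alpha> w" "x \<in> verts E"
  shows "V x * (pe \<alpha> * V w) = (if x = u then pe \<alpha> * V w else 0)"
proof (cases \<alpha>)
  case Nil then show ?thesis using assms by (auto simp: awalk_Nil_iff V_V)
next
  case (Cons e \<alpha>')
  then have "e \<in> arcs E" "tail E e = u" using assms by (auto simp: awalk_Cons_iff)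
  then show ?thesis using Cons assms by (auto simp: V_s simp flip: mult.assoc)
qed

lemma ge_V:
  assumes "awalk u \<alpha> w" "x \<in> verts E"
  shows "V w * ge \<alpha> * V x = (if x = u then V w * ge \<alpha> else 0)"
proof (cases \<alpha>)
  case Nil then show ?thesis using assms by (auto simp: awalk_Nil_iff V_V)
next
  case (Cons e \<alpha>')
  then have "e \<in> arcs E" "tail E e = u" using assms by (auto simp: awalk_Cons_iff)
  then show ?thesis using Cons assms by (auto simp: g_V mult.assoc)
qed

lemma V_pe_same: "awalk u \<alpha> w \<Longrightarrow> V u * (pe \<alpha> * V w) = pe \<alpha> * V w"
  by (subst V_pe) auto

lemma ge_V_same: "awalk u \<alpha> w \<Longrightarrow> V w * ge \<alpha> * V u = V w * ge \<alpha>"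
  by (subst ge_V) auto

lemma V_pe_left: "awalk u \<alpha> w \<Longrightarrow> \<alpha> \<noteq> [] \<Longrightarrow> V u * pe \<alpha> = pe \<alpha>"
  by (cases \<alpha>) (auto simp: awalk_Cons_iff V_s simp flip: mult.assoc)

lemma ge_pe:
  assumes "awalk u \<alpha> w"
  shows "V w * ge \<alpha> * (pe \<alpha> * V w) = V w"
  using assms
proof (induction \<alpha> arbitrary: u)
  case Nil then show ?case by (auto simp: awalk_Nil_iff V_V)
next
  case (Cons e \<alpha>)
  then have e: "e \<in> arcs E" and \<alpha>: "awalk (head E e) \<alpha> w" by (auto simp: awalk_Cons_iff)
  have "V w * ge (e # \<alpha>) * (pe (e # \<alpha>) * V w) = V w * ge \<alpha> * ((g e * s e) * (pe \<alpha> * V w))"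
    by (simp add: mult.assoc)
  also have "\<dots> = V w * ge \<alpha> * (pe \<alpha> * V w)" using e \<alpha> by (simp add: g_s V_pe_same)
  also have "\<dots> = V w" by (rule Cons.IH[OF \<alpha>])
  finally show ?case .
qed

lemma ge_pe_append:
  assumes "awalk u \<alpha> w" "awalk w \<gamma> x"
  shows "V w * ge \<alpha> * (pe (\<alpha> @ \<gamma>) * V x) = pe \<gamma> * V x"
    and "V x * ge (\<alpha> @ \<gamma>) * (pe \<alpha> * V w) = V x * ge \<gamma>"
proof -
  have "pe (\<alpha> @ \<gamma>) * V x = pe \<alpha> * V w * (pe \<gamma> * V x)"
    using V_pe_same[OF assms(2)] by (simp add: mult.assoc)
  then show "V w * ge \<alpha> * (pe (\<alpha> @ \<gamma>) * V x) = pe \<gamma> * V x"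
    using ge_pe[OF assms(1)] V_pe_same[OF assms(2)] by (simp flip: mult.assoc)
  have "V x * ge (\<alpha> @ \<gamma>) = V x * ge \<gamma> * (V w * ge \<alpha>)"
    using ge_V_same[OF assms(2)] by (simp flip: mult.assoc)
  then show "V x * ge (\<alpha> @ \<gamma>) * (pe \<alpha> * V w) = V x * ge \<gamma>"
    using ge_pe[OF assms(1)] ge_V_same[OF assms(2)] by (simp add: mult.assoc)
qed

text \<open>After cancelling the common initial segment, the first edges e and f that differ meet in
  \<open>g e * s f = 0\<close>.\<close>

lemma ge_pe_incomparable:
  assumes "awalk u \<alpha> w" "awalk u \<beta> x" "\<nexists>\<gamma>. \<beta> = \<alpha> @ \<gamma>" "\<nexists>\<gamma>. \<alpha> = \<beta> @ \<gamma>"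
  shows "ge \<alpha> * pe \<beta> = 0"
  using assms
proof (induction \<alpha> arbitrary: u \<beta>)
  case (Cons e \<alpha>)
  obtain f \<beta>' where \<beta>: "\<beta> = f # \<beta>'" using Cons.prems(4) by (cases \<beta>) auto
  have ef: "e \<in> arcs E" "f \<in> arcs E" using Cons.prems \<beta> by (auto simp: awalk_Cons_iff)
  show ?case
  proof (cases "e = f")
    case True
    have w: "awalk (head E e) \<alpha> w" "awalk (head E e) \<beta>' x"
      using Cons.prems True \<beta> by (auto simp: awalk_Cons_iff)
    have "\<beta>' \<noteq> []" using Cons.prems(4) True \<beta> by auto
    then have "ge (e # \<alpha>) * pe \<beta> = ge \<alpha> * pe \<beta>'"
      using ef True \<beta> w V_pe_left[OF w(2)] by (simp add: mult.assoc) (simp add: g_s flip: mult.assoc)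
    also have "\<dots> = 0" by (rule Cons.IH[OF w]) (use Cons.prems True \<beta> in auto)
    finally show ?thesis .
  next
    case False
    have "ge (e # \<alpha>) * pe \<beta> = ge \<alpha> * (g e * s f) * pe \<beta>'" using \<beta> by (simp add: mult.assoc)
    then show ?thesis using False ef by (simp add: g_s_orth)
  qed
qed simp

lemma A_pe: "awalk u \<alpha> w \<Longrightarrow> pe \<alpha> * V w \<in> A"
proof (induction \<alpha> arbitrary: u)
  case (Cons e \<alpha>)
  then show ?case by (auto simp: awalk_Cons_iff mult.assoc intro!: A_mult[OF A_s])
qed (auto simp: awalk_Nil_iff A_V)

lemma A_ge: "awalk u \<alpha> w \<Longrightarrow> V w * ge \<alpha> \<in> A"
proof (induction \<alpha> arbitrary: u)
  case (Cons e \<alpha>)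
  then show ?case by (auto simp: awalk_Cons_iff simp flip: mult.assoc intro!: A_mult[OF _ A_g])
qed (auto simp: awalk_Nil_iff A_V)

lemma pe_V_ge: "w \<in> verts E \<Longrightarrow> pe \<alpha> * V w * ge \<beta> = (pe \<alpha> * V w) * (V w * ge \<beta>)"
  by (simp add: V_idem mult.assoc) (simp add: V_idem flip: mult.assoc)

lemma A_mon: "awalk u \<alpha> w \<Longrightarrow> awalk u' \<beta> w \<Longrightarrow> pe \<alpha> * V w * ge \<beta> \<in> A"
  by (subst pe_V_ge) (auto intro: A_mult A_pe A_ge)

text \<open>\<open>N\<close> bounds the ghost part only. It is the parameter of the induction in the
  reduction; for \<open>N = 0\<close> no ghost edges occur.\<close>

definition Mon :: "nat \<Rightarrow> 'a set" where
  "Mon N = {sc k * (pe \<alpha> * V w * ge \<beta>) | k \<alpha> w \<beta>.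
     (\<exists>u. awalk u \<alpha> w) \<and> (\<exists>u. awalk u \<beta> w) \<and> length \<beta> \<le> N}"

lemma MonI: "awalk u \<alpha> w \<Longrightarrow> awalk u' \<beta> w \<Longrightarrow> length \<beta> \<le> N \<Longrightarrow> sc k * (pe \<alpha> * V w * ge \<beta>) \<in> Mon N"
  unfolding Mon_def by blast

lemma MonI': "awalk u \<alpha> w \<Longrightarrow> awalk u' \<beta> w \<Longrightarrow> length \<beta> \<le> N \<Longrightarrow> pe \<alpha> * V w * ge \<beta> \<in> Mon N"
  using MonI[of u \<alpha> w u' \<beta> N 1] by (simp add: sc_1)

lemma MonE:
  assumes "x \<in> Mon N"
  obtains k \<alpha> w \<beta> u u' where "x = sc k * (pe \<alpha> * V w * ge \<beta>)" "awalk u \<alpha> w" "awalk u' \<beta> w" "length \<beta> \<le> N"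
  using assms unfolding Mon_def by blast

definition Span :: "nat \<Rightarrow> 'a set" where "Span N = sumset (Mon N)"

lemma Span_mono: "M \<le> N \<Longrightarrow> Span M \<subseteq> Span N"
  unfolding Span_def by (intro sumset_mono) (force simp: Mon_def)

lemma Span_0: "0 \<in> Span N" and Span_add: "x \<in> Span N \<Longrightarrow> y \<in> Span N \<Longrightarrow> x + y \<in> Span N"
  unfolding Span_def by (auto intro: sumset_0 sumset_plus)

lemma Mon_Span: "x \<in> Mon N \<Longrightarrow> x \<in> Span N"
  unfolding Span_def by (rule sumset_incl)

lemma Span_image:
  assumes "x \<in> Span N" "f 0 = 0" "\<And>x y. f (x + y) = f x + f y" "\<And>x. x \<in> Mon N \<Longrightarrow> f x \<in> Span M"
  shows "f x \<in> Span M"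
  using assms unfolding Span_def by (rule sumset_image)

lemma Span_sc: "x \<in> Span N \<Longrightarrow> sc k * x \<in> Span N"
proof (rule Span_image[of x N "\<lambda>x. sc k * x"], auto simp: distrib_left elim!: MonE intro!: Mon_Span)
  fix k' \<alpha> w \<beta> u u'
  assume "awalk u \<alpha> w" "awalk u' \<beta> w" "length \<beta> \<le> N"
  then show "sc k * (sc k' * (pe \<alpha> * V w * ge \<beta>)) \<in> Mon N"
    using MonI[of u \<alpha> w u' \<beta> N "k * k'"] by (simp add: sc_mult mult.assoc)
qed

lemma Span_V: "v \<in> verts E \<Longrightarrow> x \<in> Span N \<Longrightarrow> V v * x \<in> Span N"
proof (rule Span_image[of x N "\<lambda>x. V v * x"], auto simp: distrib_left elim!: MonE)
  fix k \<alpha> w \<beta> u u'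
  assume *: "v \<in> verts E" "awalk u \<alpha> w" "awalk u' \<beta> w" "length \<beta> \<le> N"
  have "V v * (sc k * (pe \<alpha> * V w * ge \<beta>)) = sc k * (V v * (pe \<alpha> * V w)) * ge \<beta>"
    by (simp add: mult.assoc) (simp add: sc_V flip: mult.assoc)
  also have "\<dots> \<in> Span N"
    using * MonI[OF *(2-4), THEN Mon_Span] by (auto simp: V_pe Span_0 mult.assoc)
  finally show "V v * (sc k * (pe \<alpha> * V w * ge \<beta>)) \<in> Span N" .
qed

lemma Span_s: "e \<in> arcs E \<Longrightarrow> x \<in> Span N \<Longrightarrow> s e * x \<in> Span N"
proof (rule Span_image[of x N "\<lambda>x. s e * x"], auto simp: distrib_left elim!: MonE)
  fix k \<alpha> w \<beta> u u'
  assume *: "e \<in> arcs E" "awalk u \<alpha> w" "awalk u' \<beta> w" "length \<beta> \<le> N"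
  have "s e * (sc k * (pe \<alpha> * V w * ge \<beta>)) = sc k * (s e * (pe \<alpha> * V w)) * ge \<beta>"
    by (simp add: mult.assoc) (simp add: sc_s flip: mult.assoc)
  also have "s e * (pe \<alpha> * V w) = (if u = head E e then pe (e # \<alpha>) * V w else 0)"
    using * V_pe[OF *(2), of "head E e"] s_head[OF *(1)]
    by (metis head_in_verts mult.assoc mult_zero_right pe_simps(2))
  also have "sc k * \<dots> * ge \<beta> \<in> Span N"
    using * MonI[of "tail E e" "e # \<alpha>" w u' \<beta> N k, THEN Mon_Span]
    by (auto simp: Span_0 mult.assoc awalk_Cons_iff)
  finally show "s e * (sc k * (pe \<alpha> * V w * ge \<beta>)) \<in> Span N" .
qed

lemma Span_g: "e \<in> arcs E \<Longrightarrow> x \<in> Span N \<Longrightarrow> g e * x \<in> Span (Suc N)"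
proof (rule Span_image[of x N "\<lambda>x. g e * x"], auto simp: distrib_left elim!: MonE)
  fix k \<alpha> w \<beta> u u'
  assume *: "e \<in> arcs E" "awalk u \<alpha> w" "awalk u' \<beta> w" "length \<beta> \<le> N"
  have eq: "g e * (sc k * (pe \<alpha> * V w * ge \<beta>)) = sc k * (g e * (pe \<alpha> * V w) * ge \<beta>)"
    by (simp add: mult.assoc) (simp add: sc_g flip: mult.assoc)
  show "g e * (sc k * (pe \<alpha> * V w * ge \<beta>)) \<in> Span (Suc N)"
  proof (cases \<alpha>)
    case Nil
    have "g e * (pe \<alpha> * V w) = (if w = tail E e then V (head E e) * g e else 0)"
      using Nil * by (auto simp: awalk_Nil_iff g_V head_g)
    moreover have "sc k * (pe [] * V (head E e) * ge (\<beta> @ [e])) \<in> Span (Suc N)" if "w = tail E e"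
      using * that by (intro Mon_Span MonI[of "head E e" _ _ u']) (auto simp: awalk_simps)
    ultimately show ?thesis unfolding eq by (auto simp: Span_0 mult.assoc)
  next
    case (Cons f \<alpha>')
    have f: "f \<in> arcs E" "awalk (head E f) \<alpha>' w" using Cons * by (auto simp: awalk_Cons_iff)
    have "g e * (pe \<alpha> * V w) = (g e * s f) * (pe \<alpha>' * V w)"
      using Cons by (simp add: mult.assoc)
    then have "g e * (pe \<alpha> * V w) = (if e = f then pe \<alpha>' * V w else 0)"
      using *(1) f V_pe_same[OF f(2)] by (auto simp: g_s g_s_orth)
    moreover have "sc k * (pe \<alpha>' * V w * ge \<beta>) \<in> Span (Suc N)"
      using * f by (intro Mon_Span MonI[of "head E f" _ _ u']) (auto simp: awalk_simps)
    ultimately show ?thesis unfolding eq by (auto simp: Span_0)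
  qed
qed

lemma Span_mult: "x \<in> A \<Longrightarrow> y \<in> Span N \<Longrightarrow> \<exists>M. x * y \<in> Span M"
proof (induction x arbitrary: y N rule: A_induct)
  case (add x z)
  then obtain M1 M2 where "x * y \<in> Span M1" "z * y \<in> Span M2" by meson
  then have "x * y \<in> Span (max M1 M2)" "z * y \<in> Span (max M1 M2)"
    using Span_mono[of M1 "max M1 M2"] Span_mono[of M2 "max M1 M2"] by auto
  then show ?case by (auto simp: distrib_right intro: Span_add)
next
  case (mult x z) then show ?case by (metis mult.assoc)
next
  case (sc x k) then show ?case by (metis mult.assoc Span_sc)
qed (auto intro: Span_V Span_s Span_g Span_0)

lemma A_Span: "x \<in> A \<Longrightarrow> \<exists>N. x \<in> Span N"
proof (induction x rule: A_induct)
  case (V v)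
  have "pe [] * V v * ge [] \<in> Mon 0" using V by (intro MonI'[of v _ _ v]) (auto simp: awalk_simps)
  then show ?case using Mon_Span by auto
next
  case (s e)
  have "pe [e] * V (head E e) * ge [] \<in> Mon 0"
    using s by (intro MonI'[of "tail E e" _ _ "head E e"]) (auto simp: awalk_simps)
  then show ?case using Mon_Span s by (auto simp: s_head)
next
  case (g e)
  have "pe [] * V (head E e) * ge [e] \<in> Mon 1"
    using g by (intro MonI'[of "head E e" _ _ "tail E e"]) (auto simp: awalk_simps)
  then show ?case using Mon_Span g by (auto simp: head_g)
next
  case (add x z)
  then obtain M1 M2 where "x \<in> Span M1" "z \<in> Span M2" by meson
  then have "x \<in> Span (max M1 M2)" "z \<in> Span (max M1 M2)"
    using Span_mono[of M1 "max M1 M2"] Span_mono[of M2 "max M1 M2"] by auto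
  then show ?case by (auto intro: Span_add)
next
  case (mult x y) then show ?case using Span_mult by blast
qed (auto intro: Span_sc Span_0)

lemma Mon_A: "x \<in> Mon N \<Longrightarrow> x \<in> A"
  by (elim MonE) (auto intro: A_sc A_mon)

lemma Span_A: "x \<in> Span N \<Longrightarrow> x \<in> A"
  unfolding Span_def by (induction rule: sumset.induct) (auto intro: A_0 A_add Mon_A)

lemma A_mon_induct [consumes 1, case_names 0 mon add]:
  assumes "x \<in> A" "Q 0"
    and "\<And>k \<alpha> w \<beta> u u'. awalk u \<alpha> w \<Longrightarrow> awalk u' \<beta> w \<Longrightarrow> Q (sc k * (pe \<alpha> * V w * ge \<beta>))"
    and "\<And>x y. x \<in> A \<Longrightarrow> y \<in> A \<Longrightarrow> Q x \<Longrightarrow> Q y \<Longrightarrow> Q (x + y)"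
  shows "Q x"
proof -
  obtain N where "x \<in> sumset (Mon N)" using A_Span[OF assms(1)] by (auto simp: Span_def)
  then have "x \<in> A \<and> Q x"
  proof induction
    case (sumset_add x y)
    have "Q x" using sumset_add(1) by (elim MonE) (auto intro: assms(3))
    then show ?case using sumset_add assms(4) Mon_A A_add by blast
  qed (auto simp: assms A_0)
  then show ?thesis ..
qed

text \<open>The claim for all finite supersets allows the local units of two summands to be
  merged.\<close>

lemma local_unit_sum:
  assumes "x \<in> A"
  shows "\<exists>W. finite W \<and> W \<subseteq> verts E \<and> (\<forall>W'. finite W' \<longrightarrow> W \<subseteq> W' \<longrightarrow> W' \<subseteq> verts E \<longrightarrow>
    (\<Sum>v\<in>W'. V v) * x = x \<and> x * (\<Sum>v\<in>W'. V v) = x)"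
  using assms
proof (induction x rule: A_mon_induct)
  case (mon k \<alpha> w \<beta> u u')
  have uu: "u \<in> verts E" "u' \<in> verts E" using mon by auto
  have L: "(\<Sum>v\<in>W'. V v) * (sc k * (pe \<alpha> * V w * ge \<beta>)) = sc k * (pe \<alpha> * V w * ge \<beta>)"
    if W: "finite W'" "u \<in> W'" "W' \<subseteq> verts E" for W'
  proof -
    have "V v * (sc k * (pe \<alpha> * V w * ge \<beta>)) = (if v = u then sc k * (pe \<alpha> * V w * ge \<beta>) else 0)"
      if "v \<in> W'" for v
    proof -
      have "V v * (sc k * (pe \<alpha> * V w * ge \<beta>)) = sc k * ((V v * (pe \<alpha> * V w)) * ge \<beta>)"
        by (simp add: mult.assoc) (simp add: sc_V flip: mult.assoc)
      then show ?thesis using V_pe[OF mon(1)] that W by auto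
    qed
    then show ?thesis using W by (simp add: sum_distrib_right)
  qed
  have R: "(sc k * (pe \<alpha> * V w * ge \<beta>)) * (\<Sum>v\<in>W'. V v) = sc k * (pe \<alpha> * V w * ge \<beta>)"
    if W: "finite W'" "u' \<in> W'" "W' \<subseteq> verts E" for W'
  proof -
    have "(sc k * (pe \<alpha> * V w * ge \<beta>)) * V v = (if v = u' then sc k * (pe \<alpha> * V w * ge \<beta>) else 0)"
      if "v \<in> W'" for v
      using ge_V[OF mon(2), of v] that W by (auto simp: mult.assoc)
    then show ?thesis using W by (simp add: sum_distrib_left)
  qed
  show ?case
  proof (intro exI[of _ "{u, u'}"] conjI allI impI)
    fix W' assume W': "finite W'" "{u, u'} \<subseteq> W'" "W' \<subseteq> verts E"
    show "(\<Sum>v\<in>W'. V v) * (sc k * (pe \<alpha> * V w * ge \<beta>)) = sc k * (pe \<alpha> * V w * ge \<beta>)"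
      by (rule L) (use W' in auto)
    show "(sc k * (pe \<alpha> * V w * ge \<beta>)) * (\<Sum>v\<in>W'. V v) = sc k * (pe \<alpha> * V w * ge \<beta>)"
      by (rule R) (use W' in auto)
  qed (use uu in auto)
next
  case (add x y)
  then obtain W1 W2 where
    W1: "finite W1" "W1 \<subseteq> verts E" "\<forall>W'. finite W' \<longrightarrow> W1 \<subseteq> W' \<longrightarrow> W' \<subseteq> verts E \<longrightarrow>
      (\<Sum>v\<in>W'. V v) * x = x \<and> x * (\<Sum>v\<in>W'. V v) = x" and
    W2: "finite W2" "W2 \<subseteq> verts E" "\<forall>W'. finite W' \<longrightarrow> W2 \<subseteq> W' \<longrightarrow> W' \<subseteq> verts E \<longrightarrow>
      (\<Sum>v\<in>W'. V v) * y = y \<and> y * (\<Sum>v\<in>W'. V v) = y"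
    by blast
  show ?case
  proof (intro exI[of _ "W1 \<union> W2"] conjI allI impI)
    fix W' assume "finite W'" "W1 \<union> W2 \<subseteq> W'" "W' \<subseteq> verts E"
    then have "(\<Sum>v\<in>W'. V v) * x = x \<and> x * (\<Sum>v\<in>W'. V v) = x"
      "(\<Sum>v\<in>W'. V v) * y = y \<and> y * (\<Sum>v\<in>W'. V v) = y"
      using W1(3) W2(3) by simp_all
    then show "(\<Sum>v\<in>W'. V v) * (x + y) = x + y" "(x + y) * (\<Sum>v\<in>W'. V v) = x + y"
      by (simp_all add: distrib_left distrib_right)
  qed (use W1 W2 in auto)
qed auto

lemma local_unit: "x \<in> A \<Longrightarrow> \<exists>\<epsilon>\<in>A. \<epsilon> * x = x \<and> x * \<epsilon> = x"
proof -
  assume "x \<in> A"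
  then obtain W where "finite W" "W \<subseteq> verts E" "(\<Sum>v\<in>W. V v) * x = x \<and> x * (\<Sum>v\<in>W. V v) = x"
    using local_unit_sum by blast
  then show ?thesis by (intro bexI[of _ "\<Sum>v\<in>W. V v"]) (auto intro!: A_sum A_V)
qed

lemma local_unit_expand:
  assumes "x \<in> A"
  obtains W where "finite W" "W \<subseteq> verts E" "x = (\<Sum>v\<in>W. V v * x)" "x = (\<Sum>v\<in>W. x * V v)"
proof -
  obtain W where W: "finite W" "W \<subseteq> verts E" "(\<Sum>v\<in>W. V v) * x = x" "x * (\<Sum>v\<in>W. V v) = x"
    using local_unit_sum[OF assms] by blast
  show ?thesis
    by (rule that[OF W(1,2)]) (use W(3,4) in \<open>simp_all add: sum_distrib_left sum_distrib_right\<close>)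
qed

text \<open>Closure under scalars and negatives follows from local units: k x = (k \<epsilon>) x
  whenever \<epsilon> x = x.\<close>

definition lideal :: "'a set \<Rightarrow> bool" where
  "lideal N \<longleftrightarrow> N \<subseteq> A \<and> 0 \<in> N \<and> (\<forall>x\<in>N. \<forall>y\<in>N. x + y \<in> N) \<and> (\<forall>a\<in>A. \<forall>x\<in>N. a * x \<in> N)"

definition ideal :: "'a set \<Rightarrow> bool" where
  "ideal P \<longleftrightarrow> lideal P \<and> (\<forall>a\<in>A. \<forall>x\<in>P. x * a \<in> P)"

lemma lidealD:
  assumes "lideal N"
  shows "N \<subseteq> A" "x \<in> N \<Longrightarrow> x \<in> A" "0 \<in> N" "x \<in> N \<Longrightarrow> y \<in> N \<Longrightarrow> x + y \<in> N"
    "a \<in> A \<Longrightarrow> x \<in> N \<Longrightarrow> a * x \<in> N" "x \<in> N \<Longrightarrow> sc k * x \<in> N" "x \<in> N \<Longrightarrow> - x \<in> N"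
    "x \<in> N \<Longrightarrow> y \<in> N \<Longrightarrow> x - y \<in> N"
proof -
  show 1: "N \<subseteq> A" "x \<in> N \<Longrightarrow> x \<in> A" "0 \<in> N" "\<And>x y. x \<in> N \<Longrightarrow> y \<in> N \<Longrightarrow> x + y \<in> N"
    "a \<in> A \<Longrightarrow> x \<in> N \<Longrightarrow> a * x \<in> N"
    using assms by (auto simp: lideal_def)
  show 2: "sc k * x \<in> N" if "x \<in> N" for x k
  proof -
    have "x \<in> A" using that assms by (auto simp: lideal_def)
    then obtain \<epsilon> where \<epsilon>: "\<epsilon> \<in> A" "\<epsilon> * x = x" using local_unit by blast
    have "sc k * \<epsilon> * x \<in> N"
      using assms that A_sc[OF \<epsilon>(1)] unfolding lideal_def by blast
    then show ?thesis using \<epsilon>(2) by (simp add: mult.assoc)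
  qed
  show 3: "- x \<in> N" if "x \<in> N" for x using 2[OF that, of "-1"] by (simp add: sc_minus sc_1)
  show "x \<in> N \<Longrightarrow> y \<in> N \<Longrightarrow> x - y \<in> N" using 1(4)[OF _ 3, of x y] by simp
qed

lemma ideal_lideal: "ideal P \<Longrightarrow> lideal P"
  by (simp add: ideal_def)

lemma idealD:
  assumes "ideal P"
  shows "P \<subseteq> A" "x \<in> P \<Longrightarrow> x \<in> A" "0 \<in> P" "x \<in> P \<Longrightarrow> y \<in> P \<Longrightarrow> x + y \<in> P"
    "a \<in> A \<Longrightarrow> x \<in> P \<Longrightarrow> a * x \<in> P" "x \<in> P \<Longrightarrow> sc k * x \<in> P" "x \<in> P \<Longrightarrow> - x \<in> P"
    "x \<in> P \<Longrightarrow> y \<in> P \<Longrightarrow> x - y \<in> P" "a \<in> A \<Longrightarrow> x \<in> P \<Longrightarrow> x * a \<in> P"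
  using lidealD[OF ideal_lideal[OF assms]] assms by (auto simp: ideal_def)

lemma lideal_sum: "lideal P \<Longrightarrow> (\<And>i. i \<in> I \<Longrightarrow> f i \<in> P) \<Longrightarrow> sum f I \<in> P"
  by (induction I rule: infinite_finite_induct) (auto simp: lidealD)

lemmas ideal_sum = ideal_lideal[THEN lideal_sum]

lemma ideal_sandwich: "ideal P \<Longrightarrow> a \<in> A \<Longrightarrow> b \<in> A \<Longrightarrow> x \<in> P \<Longrightarrow> a * x * b \<in> P"
  by (simp add: idealD)

lemma ideal_cong: "ideal P \<Longrightarrow> x - y \<in> P \<Longrightarrow> x \<in> P \<longleftrightarrow> y \<in> P"
  using idealD(4)[of P "x - y" y] idealD(8)[of P x "x - y"] by auto

lemma lideal_cong: "lideal P \<Longrightarrow> x - y \<in> P \<Longrightarrow> x \<in> P \<longleftrightarrow> y \<in> P"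
  using lidealD(4)[of P "x - y" y] lidealD(8)[of P x "x - y"] by auto

lemma ideal_trans: "lideal P \<Longrightarrow> x - y \<in> P \<Longrightarrow> y - z \<in> P \<Longrightarrow> x - z \<in> P"
  using lidealD(4)[of P "x - y" "y - z"] by simp

lemma ideal_mult_cong:
  "ideal P \<Longrightarrow> x - x' \<in> P \<Longrightarrow> y - y' \<in> P \<Longrightarrow> x' \<in> A \<Longrightarrow> y \<in> A \<Longrightarrow> x * y - x' * y' \<in> P"
  using idealD(4)[of P "(x - x') * y" "x' * (y - y')"] idealD(5)[of P x' "y - y'"] idealD(9)[of P y "x - x'"]
  by (simp add: algebra_simps)

definition gen :: "'a set \<Rightarrow> 'a set" where
  "gen X = \<Inter> {I. ideal I \<and> X \<subseteq> I}"

lemma ideal_A: "ideal A"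
  by (auto simp: ideal_def lideal_def A_0 A_add A_mult)

lemma ideal_gen: "X \<subseteq> A \<Longrightarrow> ideal (gen X)"
  unfolding gen_def using ideal_A by (auto simp: ideal_def lideal_def)

lemma gen_incl: "X \<subseteq> gen X"
  by (auto simp: gen_def)

lemma gen_least: "ideal I \<Longrightarrow> X \<subseteq> I \<Longrightarrow> gen X \<subseteq> I"
  by (auto simp: gen_def)

lemma ideal_vertices_all:
  assumes "ideal P" "\<And>v. v \<in> verts E \<Longrightarrow> V v \<in> P"
  shows "P = A"
proof -
  have "x \<in> P" if "x \<in> A" for x
  proof -
    obtain W where W: "finite W" "W \<subseteq> verts E" "x = (\<Sum>v\<in>W. V v * x)"
      by (rule local_unit_expand[OF \<open>x \<in> A\<close>])
    then have "(\<Sum>v\<in>W. V v * x) \<in> P"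
      using assms that by (intro ideal_sum) (auto intro: idealD)
    then show ?thesis using W by simp
  qed
  then show ?thesis using assms idealD by auto
qed

end

section \<open>The grading by the integers\<close>

context leavitt_model
begin

text \<open>The grading is encoded as a homomorphism into Laurent polynomials over the ring: edges
  are multiplied by t, ghost edges by the inverse of t, and homogeneous components become
  coefficients. Finitely supported functions on the integers play the part of Laurent
  polynomials.\<close>

lemma laurent_family: "leavitt_family E (\<lambda>k. Poly_Mapping.single (0::int) (sc k))
   (\<lambda>v. Poly_Mapping.single 0 (V v)) (\<lambda>e. Poly_Mapping.single 1 (s e)) (\<lambda>e. Poly_Mapping.single (- 1) (g e))"
proof
  fix v assume v: "regular_vertex E v"
  have "Poly_Mapping.single (0::int) (sum f I) = (\<Sum>i\<in>I. Poly_Mapping.single 0 (f i))" for f :: "'e \<Rightarrow> 'a" and I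
    by (induction I rule: infinite_finite_induct) (auto simp: single_add)
  then show "Poly_Mapping.single (0::int) (V v) =
    (\<Sum>e\<in>out_arcs E v. Poly_Mapping.single 1 (s e) * Poly_Mapping.single (- 1) (g e))"
    by (subst CK[OF v]) (simp add: mult_single)
qed (simp_all add: mult_single sc_add sc_mult sc_1 sc_V sc_s sc_g V_idem V_orth tail_s s_head head_g g_tail g_s
    g_s_orth single_add)

interpretation laurent: leavitt_family E "\<lambda>k. Poly_Mapping.single (0::int) (sc k)"
   "\<lambda>v. Poly_Mapping.single 0 (V v)" "\<lambda>e. Poly_Mapping.single 1 (s e)" "\<lambda>e. Poly_Mapping.single (- 1) (g e)"
  by (rule laurent_family)

definition tm :: "'a \<Rightarrow> ('v, 'e, 'k) lpa_term" where
  "tm x = (SOME t. t \<in> lpa_terms E \<and> eval t = x)"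

lemma tm: "x \<in> A \<Longrightarrow> tm x \<in> lpa_terms E \<and> eval (tm x) = x"
  unfolding tm_def A_def by (rule someI_ex) auto

lemma tm_eval: "t \<in> lpa_terms E \<Longrightarrow> lpa_eq E (tm (eval t)) t"
  using tm[of "eval t"] faithful[of "tm (eval t)" t] by (auto simp: A_def)

definition lau :: "'a \<Rightarrow> int \<Rightarrow>\<^sub>0 'a" where "lau x = laurent.eval (tm x)"

lemma lau_eval: "t \<in> lpa_terms E \<Longrightarrow> lau (eval t) = laurent.eval t"
  unfolding lau_def using tm_eval laurent.eval_cong by blast

lemma lau_V: "v \<in> verts E \<Longrightarrow> lau (V v) = Poly_Mapping.single 0 (V v)"
  using lau_eval[of "Vertex v"] by (auto intro: lpa_terms.intros)

lemma lau_s: "e \<in> arcs E \<Longrightarrow> lau (s e) = Poly_Mapping.single 1 (s e)"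
  using lau_eval[of "Edge e"] by (auto intro: lpa_terms.intros)

lemma lau_g: "e \<in> arcs E \<Longrightarrow> lau (g e) = Poly_Mapping.single (- 1) (g e)"
  using lau_eval[of "Ghost e"] by (auto intro: lpa_terms.intros)

lemma lau_0: "lau 0 = 0"
  using lau_eval[of "Null"] by (auto intro: lpa_terms.intros)

lemma lau_add: "x \<in> A \<Longrightarrow> y \<in> A \<Longrightarrow> lau (x + y) = lau x + lau y"
  using lau_eval[of "Add (tm x) (tm y)"] tm[of x] tm[of y] by (auto simp: lau_def intro: lpa_terms.intros)

lemma lau_mult: "x \<in> A \<Longrightarrow> y \<in> A \<Longrightarrow> lau (x * y) = lau x * lau y"
  using lau_eval[of "Mul (tm x) (tm y)"] tm[of x] tm[of y] by (auto simp: lau_def intro: lpa_terms.intros)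

lemma lau_sc: "x \<in> A \<Longrightarrow> lau (sc k * x) = Poly_Mapping.single 0 (sc k) * lau x"
  using lau_eval[of "Scl k (tm x)"] tm[of x] by (auto simp: lau_def intro: lpa_terms.intros)

definition homog :: "int \<Rightarrow> 'a \<Rightarrow> bool" where
  "homog d x \<longleftrightarrow> x \<in> A \<and> lau x = Poly_Mapping.single d x"

lemma homog_V: "v \<in> verts E \<Longrightarrow> homog 0 (V v)"
  and homog_s: "e \<in> arcs E \<Longrightarrow> homog 1 (s e)"
  and homog_g: "e \<in> arcs E \<Longrightarrow> homog (- 1) (g e)"
  and homog_0: "homog d 0"
  and homog_add: "homog d x \<Longrightarrow> homog d y \<Longrightarrow> homog d (x + y)"
  and homog_mult: "homog d x \<Longrightarrow> homog d' y \<Longrightarrow> homog (d + d') (x * y)"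
  and homog_sc: "homog d x \<Longrightarrow> homog d (sc k * x)"
  by (auto simp: homog_def lau_V lau_s lau_g lau_0 lau_add lau_mult lau_sc mult_single single_add A_closed)

lemma homog_sum: "(\<And>i. i \<in> I \<Longrightarrow> homog d (f i)) \<Longrightarrow> homog d (sum f I)"
  by (induction I rule: infinite_finite_induct) (auto intro: homog_0 homog_add)

lemma homog_uminus: "homog d x \<Longrightarrow> homog d (- x)"
  using homog_sc[of d x "-1"] by (simp add: sc_minus sc_1)

lemma homog_diff: "homog d x \<Longrightarrow> homog d y \<Longrightarrow> homog d (x - y)"
  using homog_add[of d x "- y"] homog_uminus by simp

lemma homog_pe: "awalk u \<alpha> w \<Longrightarrow> homog (int (length \<alpha>)) (pe \<alpha> * V w)"
proof (induction \<alpha> arbitrary: u)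
  case (Cons e \<alpha>)
  then show ?case using homog_mult[of 1 "s e" "int (length \<alpha>)" "pe \<alpha> * V w"]
    by (auto simp: awalk_Cons_iff mult.assoc homog_s)
qed (auto simp: awalk_Nil_iff homog_V)

lemma homog_ge: "awalk u \<alpha> w \<Longrightarrow> homog (- int (length \<alpha>)) (V w * ge \<alpha>)"
proof (induction \<alpha> arbitrary: u)
  case (Cons e \<alpha>)
  have "- int (length (e # \<alpha>)) = - int (length \<alpha>) + - 1" by simp
  then show ?case using Cons homog_mult[of "- int (length \<alpha>)" "V w * ge \<alpha>" "- 1" "g e"]
    unfolding \<open>- int (length (e # \<alpha>)) = _\<close>
    by (auto simp: awalk_Cons_iff mult.assoc homog_g)
qed (auto simp: awalk_Nil_iff homog_V)

lemma homog_mon: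
  assumes "awalk u \<alpha> w" "awalk u' \<beta> w"
  shows "homog (int (length \<alpha>) - int (length \<beta>)) (pe \<alpha> * V w * ge \<beta>)"
  using homog_mult[OF homog_pe[OF assms(1)] homog_ge[OF assms(2)]] assms(1) by (subst pe_V_ge) auto

definition gr :: "int \<Rightarrow> 'a \<Rightarrow> 'a" where "gr n x = Poly_Mapping.lookup (lau x) n"

lemma gr_homog: "homog d x \<Longrightarrow> gr n x = (if n = d then x else 0)"
  by (auto simp: homog_def gr_def lookup_single when_def)

lemma gr_0 [simp]: "gr n 0 = 0"
  by (simp add: gr_def lau_0)

lemma gr_add: "x \<in> A \<Longrightarrow> y \<in> A \<Longrightarrow> gr n (x + y) = gr n x + gr n y"
  by (simp add: gr_def lau_add lookup_add)

lemma gr_sum: "(\<And>i. i \<in> I \<Longrightarrow> f i \<in> A) \<Longrightarrow> gr n (sum f I) = (\<Sum>i\<in>I. gr n (f i))"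
  by (induction I rule: infinite_finite_induct) (auto simp: gr_add A_sum)

lemma gr_A: "x \<in> A \<Longrightarrow> gr n x \<in> A \<and> homog n (gr n x)"
proof (induction rule: A_mon_induct)
  case (mon k \<alpha> w \<beta> u u')
  then show ?case using homog_mon[OF mon, THEN homog_sc] by (auto simp: gr_homog A_0 homog_0 homog_def lau_0)
qed (auto simp: gr_add A_0 homog_0 A_add homog_add)

lemma gr_mult_left: "x \<in> A \<Longrightarrow> homog d a \<Longrightarrow> gr n (a * x) = a * gr (n - d) x"
proof (induction rule: A_mon_induct)
  case (mon k \<alpha> w \<beta> u u')
  note h = homog_mon[OF this(1,2), THEN homog_sc]
  show ?case using gr_homog[OF h] gr_homog[OF homog_mult[OF \<open>homog d a\<close> h]] by auto
next
  case (add x y)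
  then have "a \<in> A" by (simp add: homog_def)
  then show ?case using add by (simp add: distrib_left gr_add A_mult)
qed auto

lemma gr_mult_right: "x \<in> A \<Longrightarrow> homog d a \<Longrightarrow> gr n (x * a) = gr (n - d) x * a"
proof (induction rule: A_mon_induct)
  case (mon k \<alpha> w \<beta> u u')
  note h = homog_mon[OF this(1,2), THEN homog_sc]
  show ?case using gr_homog[OF h] gr_homog[OF homog_mult[OF h \<open>homog d a\<close>]] by auto
next
  case (add x y)
  then have "a \<in> A" by (simp add: homog_def)
  then show ?case using add by (simp add: distrib_right gr_add A_mult)
qed auto

lemma gr_sc: "x \<in> A \<Longrightarrow> gr n (sc k * x) = sc k * gr n x"
proof (induction rule: A_mon_induct)
  case (mon k' \<alpha> w \<beta> u u')
  note h = homog_mon[OF this(1,2), THEN homog_sc]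
  show ?case using gr_homog[OF h] gr_homog[OF h[THEN homog_sc]] by auto
qed (auto simp: distrib_left gr_add A_sc)

lemma gr_decomp:
  "x \<in> A \<Longrightarrow> \<exists>M. finite M \<and> (\<forall>M'. finite M' \<longrightarrow> M \<subseteq> M' \<longrightarrow> x = (\<Sum>n\<in>M'. gr n x))"
proof (induction rule: A_mon_induct)
  case (mon k \<alpha> w \<beta> u u')
  note h = homog_mon[OF this(1,2), THEN homog_sc]
  show ?case by (rule exI[of _ "{int (length \<alpha>) - int (length \<beta>)}"]) (auto simp: gr_homog[OF h])
next
  case (add x y)
  then obtain M1 M2 where "finite M1" "\<forall>M'. finite M' \<longrightarrow> M1 \<subseteq> M' \<longrightarrow> x = (\<Sum>n\<in>M'. gr n x)"
    "finite M2" "\<forall>M'. finite M' \<longrightarrow> M2 \<subseteq> M' \<longrightarrow> y = (\<Sum>n\<in>M'. gr n y)"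
    by auto
  then show ?case using add(1,2)
    by (intro exI[of _ "M1 \<union> M2"]) (simp add: gr_add sum.distrib)
qed auto

definition graded :: "'a set \<Rightarrow> bool" where "graded I \<longleftrightarrow> (\<forall>x\<in>I. \<forall>n. gr n x \<in> I)"

text \<open>The elements of the generated ideal all of whose components stay in it form an ideal
  again. It contains the homogeneous generators, so it is everything.\<close>

lemma graded_gen:
  assumes X: "\<And>x. x \<in> X \<Longrightarrow> \<exists>d. homog d x"
  shows "graded (gen X)"
proof -
  have XA: "X \<subseteq> A" using X by (auto simp: homog_def)
  note I = idealD[OF ideal_gen[OF XA]]
  let ?J = "{x \<in> gen X. \<forall>n. gr n x \<in> gen X}"
  have mult: "a * x \<in> ?J \<and> x * a \<in> ?J" if "a \<in> A" "x \<in> ?J" for a x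
    using that
  proof (induction a arbitrary: x rule: A_induct)
    case (add a b) then show ?case using I by (auto simp: distrib_left distrib_right gr_add A_mult)
  next
    case (mult a b)
    have "a * (b * x) \<in> ?J" "x * a * b \<in> ?J" using mult by blast+
    then show ?case by (simp add: mult.assoc)
  next
    case (sc a k)
    have "a * x \<in> ?J" "x * a \<in> ?J" using sc.IH[OF sc.prems] by blast+
    then have 1: "sc k * (a * x) \<in> ?J" "sc k * (x * a) \<in> ?J"
      using I by (auto simp: gr_sc A_mult sc.hyps)
    have "sc k * (x * a) = x * (sc k * a)" using sc.prems I by (simp add: sc_comm flip: mult.assoc)
    with 1 show ?case by (simp add: mult.assoc)
  qed (use I in \<open>auto simp: gr_mult_left[OF _ homog_V] gr_mult_left[OF _ homog_s] gr_mult_left[OF _ homog_g]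
      gr_mult_right[OF _ homog_V] gr_mult_right[OF _ homog_s] gr_mult_right[OF _ homog_g] A_closed\<close>)
  have "ideal ?J" unfolding ideal_def lideal_def
    using mult I by (auto simp: gr_add)
  moreover have "X \<subseteq> ?J"
    using X gen_incl[of X] I(3) by (force simp: gr_homog)
  ultimately have "gen X \<subseteq> ?J" by (rule gen_least)
  then show ?thesis by (auto simp: graded_def)
qed

end

section \<open>The reduction theorem\<close>

lemma sum_insert_coeff:
  fixes c :: "'b \<Rightarrow> 'k::zero" and f :: "'b \<Rightarrow> 'k \<Rightarrow> 'a::comm_monoid_add"
  assumes "finite D" "\<And>x. f x 0 = 0"
  shows "(\<Sum>x\<in>insert a D. f x (if x \<in> D then c x else 0)) = (\<Sum>x\<in>D. f x (c x))"
proof -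
  have "(\<Sum>x\<in>D. f x (if x \<in> D then c x else 0)) = (\<Sum>x\<in>insert a D. f x (if x \<in> D then c x else 0))"
    using assms by (intro sum.mono_neutral_left) auto
  then show ?thesis by simp
qed

text \<open>The equation \<gamma>\<delta> = \<delta>\<eta> says that \<delta> is an initial segment
  of \<gamma>\<delta>. Each letter of \<delta> is then a letter of \<gamma> or repeats the letter
  that stands |\<gamma>| places earlier.\<close>

lemma periodic_list_unique:
  assumes "\<gamma> \<noteq> []" "\<gamma> @ \<delta> = \<delta> @ \<eta>" "\<gamma> @ \<delta>' = \<delta>' @ \<eta>'" "length \<delta> = length \<delta>'"
  shows "\<delta> = \<delta>'"
proof (rule nth_equalityI[OF assms(4)])
  fix i assume "i < length \<delta>"
  then show "\<delta> ! i = \<delta>' ! i"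
  proof (induction i rule: less_induct)
    case (less i)
    have 1: "\<delta> ! i = (\<gamma> @ \<delta>) ! i" using less.prems by (simp add: assms(2) nth_append)
    have 2: "\<delta>' ! i = (\<gamma> @ \<delta>') ! i" using less.prems assms(4) by (simp add: assms(3) nth_append)
    show ?case
    proof (cases "i < length \<gamma>")
      case True then show ?thesis using 1 2 by (simp add: nth_append)
    next
      case False
      then have "\<delta> ! (i - length \<gamma>) = \<delta>' ! (i - length \<gamma>)"
        using less assms(1) by (intro less.IH) (cases \<gamma>; auto)+
      then show ?thesis using 1 2 False by (simp add: nth_append)
    qed
  qed
qed

context leavitt_model
begin

definition hereditary :: "'v set \<Rightarrow> bool" where
  "hereditary H \<longleftrightarrow> H \<subseteq> verts E \<and> (\<forall>e\<in>arcs E. tail E e \<in> H \<longrightarrow> head E e \<in> H)"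

definition out :: "'v set \<Rightarrow> 'v \<Rightarrow> 'e set" where "out H w = {e \<in> out_arcs E w. head E e \<notin> H}"

text \<open>\<open>brk H w\<close> is the element \<open>w\<^sup>H\<close>, \<open>IHS H S\<close> is \<open>I\<^bsub>(H,S)\<^esub>\<close>, and \<open>vts P\<close> is \<open>P \<inter> E\<^sup>0\<close>.\<close>

definition brk :: "'v set \<Rightarrow> 'v \<Rightarrow> 'a" where "brk H w = V w - (\<Sum>e\<in>out H w. s e * g e)"

definition IHS :: "'v set \<Rightarrow> 'v set \<Rightarrow> 'a set" where "IHS H S = gen (V ` H \<union> brk H ` S)"

definition vts :: "'a set \<Rightarrow> 'v set" where "vts P = {v \<in> verts E. V v \<in> P}"

text \<open>This encodes a cycle without exits in the complement of a hereditary \<open>H\<close>: a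
  walk that ends outside \<open>H\<close> never enters \<open>H\<close>, and if w also carries a
  nontrivial closed walk, there is no choice at any of its vertices.\<close>

definition unique_walks :: "'v set \<Rightarrow> 'v \<Rightarrow> bool" where
  "unique_walks H w \<longleftrightarrow> (\<forall>\<delta> \<delta>' x x'. awalk w \<delta> x \<longrightarrow> awalk w \<delta>' x' \<longrightarrow> x \<notin> H \<longrightarrow> x' \<notin> H \<longrightarrow>
     length \<delta> = length \<delta>' \<longrightarrow> \<delta> = \<delta>')"

text \<open>An analogue of a polynomial with nonzero constant term. The coefficients
  \<open>c\<close> may vanish on \<open>D\<close>, so \<open>D\<close> is a set chosen for counting
  and not necessarily the support.\<close>

definition comonic :: "'v \<Rightarrow> 'e list set \<Rightarrow> 'a \<Rightarrow> bool" where
  "comonic w D y \<longleftrightarrow> finite D \<and> (\<forall>\<gamma>\<in>D. awalk w \<gamma> w \<and> \<gamma> \<noteq> []) \<and>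
     (\<exists>k c. k \<noteq> 0 \<and> y = sc k * V w + (\<Sum>\<gamma>\<in>D. sc (c \<gamma>) * (pe \<gamma> * V w)))"

lemma breaking_out: "breaking_vertices E H =
    {w \<in> verts E - H. infinite (out_arcs E w) \<and> finite (out H w) \<and> out H w \<noteq> {}}"
  by (simp add: breaking_vertices_def out_def)

lemma outD: "e \<in> out H w \<Longrightarrow> e \<in> arcs E \<and> tail E e = w \<and> head E e \<notin> H"
  by (simp add: out_def)

lemma vts_hereditary: "ideal P \<Longrightarrow> hereditary (vts P)"
proof -
  assume P: "ideal P"
  have "V (head E e) \<in> P" if "e \<in> arcs E" "V (tail E e) \<in> P" for e
    using ideal_sandwich[OF P A_g[OF that(1)] A_s[OF that(1)] that(2)] that(1)
    by (simp add: g_s tail_s mult.assoc)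
  then show ?thesis by (auto simp: hereditary_def vts_def)
qed

lemma hereditary_awalk: "hereditary H \<Longrightarrow> awalk u \<alpha> w \<Longrightarrow> u \<in> H \<Longrightarrow> w \<in> H"
  by (induction \<alpha> arbitrary: u) (auto simp: awalk_simps hereditary_def)

lemma s_in: "ideal P \<Longrightarrow> e \<in> arcs E \<Longrightarrow> V (head E e) \<in> P \<Longrightarrow> s e \<in> P"
  using idealD(5)[of P "s e" "V (head E e)"] by (simp add: A_s s_head)

lemma g_in: "ideal P \<Longrightarrow> e \<in> arcs E \<Longrightarrow> V (head E e) \<in> P \<Longrightarrow> g e \<in> P"
  using idealD(9)[of P "g e" "V (head E e)"] by (simp add: A_g head_g)

lemma head_in: "ideal P \<Longrightarrow> e \<in> arcs E \<Longrightarrow> s e \<in> P \<Longrightarrow> V (head E e) \<in> P"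
  using idealD(5)[of P "g e" "s e"] by (simp add: A_g g_s)

lemma sc_cancel: "ideal P \<Longrightarrow> k \<noteq> 0 \<Longrightarrow> sc k * x \<in> P \<longleftrightarrow> x \<in> P"
  using idealD(6)[of P "sc k * x" "inverse k"] idealD(6)[of P x k]
  by (auto simp: sc_1 simp flip: mult.assoc sc_mult)

lemma mon_in:
  assumes "ideal P" "V w \<in> P" "awalk u \<alpha> w" "awalk u' \<beta> w"
  shows "sc k * (pe \<alpha> * V w * ge \<beta>) \<in> P"
proof -
  have w: "w \<in> verts E" using assms by auto
  have "(pe \<alpha> * V w) * V w * (V w * ge \<beta>) \<in> P"
    using assms by (intro ideal_sandwich A_pe A_ge) auto
  also have "(pe \<alpha> * V w) * V w * (V w * ge \<beta>) = pe \<alpha> * V w * ge \<beta>"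
    using pe_V_ge[OF w, of \<alpha> \<beta>] V_idem[OF w] by (simp add: mult.assoc)
  finally show ?thesis by (rule idealD(6)[OF assms(1)])
qed

section \<open>The idempotents \<open>brk H u\<close> at breaking vertices\<close>

context
  fixes H u assumes u: "u \<in> breaking_vertices E H"
begin

lemma brk_u: "u \<in> verts E" "u \<notin> H" "finite (out H u)"
  using u by (auto simp: breaking_out)

lemma g_brk: "e \<in> out H u \<Longrightarrow> g e * brk H u = 0"
proof -
  assume e: "e \<in> out H u"
  have "(\<Sum>f\<in>out H u. g e * (s f * g f)) = (\<Sum>f\<in>out H u. if f = e then g e else 0)"
    using e by (intro sum.cong) (auto dest!: outD simp: g_s g_s_orth head_g simp flip: mult.assoc)
  also have "\<dots> = g e" using e brk_u by simp
  finally show ?thesis using outD[OF e] g_V[OF brk_u(1), of e]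
    by (simp add: brk_def right_diff_distrib sum_distrib_left)
qed

lemma brk_s: "e \<in> out H u \<Longrightarrow> brk H u * s e = 0"
proof -
  assume e: "e \<in> out H u"
  have "(\<Sum>f\<in>out H u. s f * g f * s e) = (\<Sum>f\<in>out H u. if f = e then s e else 0)"
    using e by (intro sum.cong) (auto dest!: outD simp: g_s g_s_orth s_head mult.assoc)
  also have "\<dots> = s e" using e brk_u by simp
  finally show ?thesis using outD[OF e] V_s[OF brk_u(1), of e]
    by (simp add: brk_def left_diff_distrib sum_distrib_right)
qed

lemma V_brk: "v \<in> verts E \<Longrightarrow> V v * brk H u = (if v = u then brk H u else 0)"
proof -
  assume v: "v \<in> verts E"
  have "(\<Sum>f\<in>out H u. V v * (s f * g f)) = (\<Sum>f\<in>out H u. if v = u then s f * g f else 0)"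
    using v by (intro sum.cong) (auto dest!: outD simp: V_s simp flip: mult.assoc)
  then show ?thesis using v brk_u
    by (auto simp: brk_def right_diff_distrib sum_distrib_left V_V)
qed

lemma brk_V: "v \<in> verts E \<Longrightarrow> brk H u * V v = (if v = u then brk H u else 0)"
proof -
  assume v: "v \<in> verts E"
  have "(\<Sum>f\<in>out H u. s f * g f * V v) = (\<Sum>f\<in>out H u. if v = u then s f * g f else 0)"
    using v by (intro sum.cong) (auto dest!: outD simp: g_V mult.assoc)
  then show ?thesis using v brk_u
    by (auto simp: brk_def left_diff_distrib sum_distrib_right V_V)
qed

lemma brk_idem: "brk H u * brk H u = brk H u"
proof -
  have "brk H u * brk H u = V u * brk H u - (\<Sum>e\<in>out H u. s e * (g e * brk H u))"
    by (subst (1) brk_def) (simp add: left_diff_distrib sum_distrib_right mult.assoc)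
  then show ?thesis using g_brk V_brk[OF brk_u(1)] by simp
qed

lemma brk_homog: "homog 0 (brk H u)"
  unfolding brk_def using brk_u homog_mult[OF homog_s homog_g]
  by (intro homog_diff homog_V homog_sum) (auto dest!: outD)

lemma brk_A: "brk H u \<in> A"
  using brk_homog by (simp add: homog_def)

end

lemma IHS_gens:
  assumes "hereditary H" "S \<subseteq> breaking_vertices E H" "x \<in> V ` H \<union> brk H ` S"
  shows "homog 0 x"
  using assms by (auto simp: hereditary_def intro!: homog_V brk_homog)

lemma
  assumes "hereditary H" "S \<subseteq> breaking_vertices E H"
  shows IHS_ideal: "ideal (IHS H S)" and IHS_graded: "graded (IHS H S)"
    and IHS_V: "v \<in> H \<Longrightarrow> V v \<in> IHS H S" and IHS_brk: "u \<in> S \<Longrightarrow> brk H u \<in> IHS H S"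
proof -
  have "V ` H \<union> brk H ` S \<subseteq> A" using IHS_gens[OF assms] by (auto simp: homog_def)
  then show "ideal (IHS H S)" unfolding IHS_def by (rule ideal_gen)
  show "graded (IHS H S)" unfolding IHS_def using IHS_gens[OF assms] by (intro graded_gen) blast
  show "v \<in> H \<Longrightarrow> V v \<in> IHS H S" "u \<in> S \<Longrightarrow> brk H u \<in> IHS H S"
    unfolding IHS_def using gen_incl[of "V ` H \<union> brk H ` S"] by auto
qed

lemma IHS_least: "ideal Q \<Longrightarrow> V ` H \<subseteq> Q \<Longrightarrow> brk H ` S \<subseteq> Q \<Longrightarrow> IHS H S \<subseteq> Q"
  unfolding IHS_def by (rule gen_least) auto

text \<open>Nontrivial closed walks have positive degree. A graded ideal that contains a comonic
  element at w therefore contains w.\<close>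

lemma comonic_gr0:
  assumes "comonic w D y" "w \<in> verts E"
  shows "\<exists>k. k \<noteq> 0 \<and> gr 0 y = sc k * V w"
proof -
  obtain k c where *: "finite D" "\<And>\<gamma>. \<gamma> \<in> D \<Longrightarrow> awalk w \<gamma> w \<and> \<gamma> \<noteq> []" "k \<noteq> 0"
    "y = sc k * V w + (\<Sum>\<gamma>\<in>D. sc (c \<gamma>) * (pe \<gamma> * V w))"
    using assms(1) unfolding comonic_def by blast
  have h: "homog (int (length \<gamma>)) (sc (c \<gamma>) * (pe \<gamma> * V w))" if "\<gamma> \<in> D" for \<gamma>
    using *(2)[OF that] by (intro homog_sc homog_pe) auto
  have "gr 0 (sc (c \<gamma>) * (pe \<gamma> * V w)) = 0" if "\<gamma> \<in> D" for \<gamma>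
    using gr_homog[OF h[OF that]] *(2)[OF that] by auto
  moreover have "sc (c \<gamma>) * (pe \<gamma> * V w) \<in> A" if "\<gamma> \<in> D" for \<gamma>
    using h[OF that] by (simp add: homog_def)
  ultimately have "gr 0 y = gr 0 (sc k * V w)"
    using assms(2) by (simp add: *(4) gr_add gr_sum A_closed)
  also have "\<dots> = sc k * V w" using gr_homog[OF homog_sc[OF homog_V[OF assms(2)]]] by simp
  finally show ?thesis using *(3) by blast
qed

lemma comonic_A: "comonic w D y \<Longrightarrow> w \<in> verts E \<Longrightarrow> y \<in> A"
  unfolding comonic_def by (auto intro!: A_add A_sc A_V A_sum A_pe)

section \<open>Combinations of paths without ghost edges\<close>

lemma real_V: "x \<in> Span 0 \<Longrightarrow> w \<in> verts E \<Longrightarrow> x * V w \<in> Span 0"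
proof (rule Span_image[of x 0 "\<lambda>x. x * V w"])
  fix y assume w: "w \<in> verts E" and y0: "y \<in> Mon 0"
  obtain k \<alpha> w' \<beta> u u' where y: "y = sc k * (pe \<alpha> * V w' * ge \<beta>)" "awalk u \<alpha> w'" "awalk u' \<beta> w'" "length \<beta> \<le> 0"
    using y0 by (rule MonE)
  then have "y * V w = (if w' = w then y else 0)"
    using V_V[of w' w] w by (auto simp: mult.assoc)
  then show "y * V w \<in> Span 0" using y0 by (auto simp: Span_0 Mon_Span)
qed (auto simp: distrib_right)

lemma real_expand:
  assumes "z \<in> Span 0" "w \<in> verts E"
  shows "\<exists>D k. finite D \<and> (\<forall>\<alpha>\<in>D. \<exists>u. awalk u \<alpha> w) \<and> z * V w = (\<Sum>\<alpha>\<in>D. sc (k \<alpha>) * (pe \<alpha> * V w))"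
  using assms(1) unfolding Span_def
proof induction
  case sumset_0
  show ?case by (rule exI[of _ "{}"]) simp
next
  case (sumset_add x y)
  obtain D k where Dk: "finite D" "\<forall>\<alpha>\<in>D. \<exists>u. awalk u \<alpha> w" "y * V w = (\<Sum>\<alpha>\<in>D. sc (k \<alpha>) * (pe \<alpha> * V w))"
    using sumset_add by blast
  obtain j \<alpha> w' \<beta> u u' where x: "x = sc j * (pe \<alpha> * V w' * ge \<beta>)" "awalk u \<alpha> w'" "awalk u' \<beta> w'" "length \<beta> \<le> 0"
    using sumset_add(1) by (rule MonE)
  then have xw: "x * V w = (if w = w' then sc j * (pe \<alpha> * V w) else 0)"
    using assms(2) V_V[of w' w] by (auto simp: mult.assoc)
  show ?case
  proof (cases "w = w'")
    case False
    then show ?thesis using Dk xw by (intro exI[of _ D] exI[of _ k]) (auto simp: distrib_right)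
  next
    case True
    \<comment> \<open>The path \<alpha> may occur in \<open>D\<close> already, so its old
      coefficient is increased by j.\<close>
    let ?k = "\<lambda>\<beta>. (if \<beta> \<in> D then k \<beta> else 0) + (if \<beta> = \<alpha> then j else 0)"
    have "(\<Sum>\<beta>\<in>insert \<alpha> D. sc (?k \<beta>) * (pe \<beta> * V w)) =
      (\<Sum>\<beta>\<in>insert \<alpha> D. sc (if \<beta> \<in> D then k \<beta> else 0) * (pe \<beta> * V w)) +
      (\<Sum>\<beta>\<in>insert \<alpha> D. sc (if \<beta> = \<alpha> then j else 0) * (pe \<beta> * V w))"
      by (simp only: sc_add distrib_right sum.distrib)
    also have "(\<Sum>\<beta>\<in>insert \<alpha> D. sc (if \<beta> \<in> D then k \<beta> else 0) * (pe \<beta> * V w)) = y * V w"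
      unfolding Dk(3) by (rule sum_insert_coeff) (auto simp: Dk sc_0)
    also have "(\<Sum>\<beta>\<in>insert \<alpha> D. sc (if \<beta> = \<alpha> then j else 0) * (pe \<beta> * V w)) =
       (\<Sum>\<beta>\<in>insert \<alpha> D. if \<beta> = \<alpha> then sc j * (pe \<alpha> * V w) else 0)"
      by (intro sum.cong) (auto simp: sc_0)
    also have "\<dots> = x * V w" using xw True Dk(1) by simp
    finally have "(x + y) * V w = (\<Sum>\<beta>\<in>insert \<alpha> D. sc (?k \<beta>) * (pe \<beta> * V w))"
      by (simp add: distrib_right add.commute)
    then show ?thesis using Dk x True by (intro exI[of _ "insert \<alpha> D"] exI[of _ ?k]) auto
  qed
qed

text \<open>Multiplication by the ghost of a shortest occurring path turns that path into w and
  kills all paths that do not extend it. What is left of the others are closed walks at w, since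
  every path ends in w.\<close>

lemma real_comonic:
  assumes "z \<in> Span 0" "w \<in> verts E" "z * V w = z" "z \<noteq> 0"
  shows "\<exists>a\<in>A. \<exists>D. comonic w D (a * z)"
proof -
  obtain D0 k where D0: "finite D0" "\<forall>\<alpha>\<in>D0. \<exists>u. awalk u \<alpha> w" "z * V w = (\<Sum>\<alpha>\<in>D0. sc (k \<alpha>) * (pe \<alpha> * V w))"
    using real_expand[OF assms(1,2)] by blast
  define D where "D = {\<alpha> \<in> D0. k \<alpha> \<noteq> 0}"
  have D: "finite D" "\<And>\<alpha>. \<alpha> \<in> D \<Longrightarrow> \<exists>u. awalk u \<alpha> w" "\<And>\<alpha>. \<alpha> \<in> D \<Longrightarrow> k \<alpha> \<noteq> 0"
    using D0 by (auto simp: D_def)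
  have z: "z = (\<Sum>\<alpha>\<in>D. sc (k \<alpha>) * (pe \<alpha> * V w))"
    using D0(3) assms(3) unfolding D_def
    by (subst sum.mono_neutral_left[of D0]) (auto simp: D0(1) sc_0)
  then have "D \<noteq> {}" using assms(4) by auto
  \<comment> \<open>A shortest path of \<open>D\<close> does not properly extend another path of
    \<open>D\<close>, so its ghost leaves no ghost edges behind.\<close>
  then obtain \<alpha>1 where \<alpha>1: "\<alpha>1 \<in> D" "\<And>\<alpha>. \<alpha> \<in> D \<Longrightarrow> length \<alpha>1 \<le> length \<alpha>"
    using ex_has_least_nat[of "\<lambda>\<alpha>. \<alpha> \<in> D" _ length] by blast
  obtain u1 where u1: "awalk u1 \<alpha>1 w" using D(2)[OF \<alpha>1(1)] by blast
  define a where "a = V w * ge \<alpha>1"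
  have "a \<in> A" unfolding a_def by (rule A_ge[OF u1])
  define D' where "D' = {\<gamma>. \<gamma> \<noteq> [] \<and> \<alpha>1 @ \<gamma> \<in> D \<and> awalk w \<gamma> w}"
  have fin: "finite D'"
    by (rule finite_imageD[of "(@) \<alpha>1"], rule finite_subset[OF _ D(1)]) (auto simp: D'_def inj_on_def)
  define T where "T \<alpha> = a * (pe \<alpha> * V w)" for \<alpha>
  have T1: "T \<alpha>1 = V w" unfolding T_def a_def by (rule ge_pe[OF u1])
  have T2: "T (\<alpha>1 @ \<gamma>) = pe \<gamma> * V w" if "\<gamma> \<in> D'" for \<gamma>
    unfolding T_def a_def by (rule ge_pe_append(1)[OF u1]) (use that in \<open>simp add: D'_def\<close>)
  have T3: "T \<alpha> = 0" if "\<alpha> \<in> D" "\<alpha> \<noteq> \<alpha>1" "\<alpha> \<notin> (@) \<alpha>1 ` D'" for \<alpha>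
  proof -
    from D(2)[OF that(1)] obtain u where u: "awalk u \<alpha> w" by blast
    show ?thesis
    proof (cases "u = u1")
      case False
      have "T \<alpha> = V w * ge \<alpha>1 * (V u1 * (pe \<alpha> * V w))"
        using ge_V_same[OF u1] by (simp add: T_def a_def flip: mult.assoc)
      also have "V u1 * (pe \<alpha> * V w) = 0"
        using V_pe[OF u, of u1] u1 False by auto
      finally show ?thesis by simp
    next
      case True
      have "\<nexists>\<gamma>. \<alpha> = \<alpha>1 @ \<gamma>"
      proof
        assume "\<exists>\<gamma>. \<alpha> = \<alpha>1 @ \<gamma>"
        then obtain \<gamma> where \<gamma>: "\<alpha> = \<alpha>1 @ \<gamma>" by blast
        have "awalk (awlast u1 \<alpha>1) \<gamma> w" using u True \<gamma> by simp
        then have "awalk w \<gamma> w" using u1 by simp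
        then show False using that \<gamma> by (auto simp: D'_def)
      qed
      moreover have "\<nexists>\<gamma>. \<alpha>1 = \<alpha> @ \<gamma>"
        using \<alpha>1(2)[OF that(1)] that(2) by auto
      ultimately have "ge \<alpha>1 * pe \<alpha> = 0"
        using u u1 True by (intro ge_pe_incomparable[of u1 _ w _ w]) auto
      then have "V w * (ge \<alpha>1 * pe \<alpha>) * V w = 0" by simp
      then show ?thesis unfolding T_def a_def by (simp add: mult.assoc)
    qed
  qed
  have "a * z = (\<Sum>\<alpha>\<in>D. sc (k \<alpha>) * T \<alpha>)"
    unfolding z sum_distrib_left T_def using \<open>a \<in> A\<close>
    by (intro sum.cong) (simp_all add: sc_comm flip: mult.assoc)
  also have "\<dots> = (\<Sum>\<alpha>\<in>insert \<alpha>1 ((@) \<alpha>1 ` D'). sc (k \<alpha>) * T \<alpha>)"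
    using D(1) \<alpha>1 T3 by (intro sum.mono_neutral_right) (auto simp: D'_def)
  also have "\<dots> = sc (k \<alpha>1) * V w + (\<Sum>\<alpha>\<in>(@) \<alpha>1 ` D'. sc (k \<alpha>) * T \<alpha>)"
    using fin T1 by (subst sum.insert) (auto simp: D'_def)
  also have "(\<Sum>\<alpha>\<in>(@) \<alpha>1 ` D'. sc (k \<alpha>) * T \<alpha>) = (\<Sum>\<gamma>\<in>D'. sc (k (\<alpha>1 @ \<gamma>)) * (pe \<gamma> * V w))"
    using T2 by (subst sum.reindex) (auto simp: inj_on_def intro!: sum.cong)
  finally have "comonic w D' (a * z)"
    unfolding comonic_def using fin D(3)[OF \<alpha>1(1)]
    by (auto simp: D'_def intro!: exI[of _ "k \<alpha>1"] exI[of _ "\<lambda>\<gamma>. k (\<alpha>1 @ \<gamma>)"])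
  then show ?thesis using \<open>a \<in> A\<close> by blast
qed

text \<open>If z were nonzero, some a z would be comonic, and the component of degree 1 of a z e
  would be a nonzero multiple of e. Then e, and with it its range, would lie in
  \<open>J\<close>.\<close>

lemma real_mult_edge_zero:
  assumes "ideal J" "graded J" "z \<in> Span 0" "z * V (tail E e) = z" "e \<in> arcs E" "z * s e \<in> J" "V (head E e) \<notin> J"
  shows "z = 0"
proof (rule ccontr)
  let ?w = "tail E e"
  have w: "?w \<in> verts E" using assms by simp
  assume "z \<noteq> 0"
  then obtain a D where a: "a \<in> A" "comonic ?w D (a * z)" using real_comonic[OF assms(3) w assms(4)] by blast
  obtain k where k: "k \<noteq> 0" "gr 0 (a * z) = sc k * V ?w" using comonic_gr0[OF a(2) w] by blast
  have "a * (z * s e) \<in> J" by (rule idealD(5)[OF assms(1) a(1) assms(6)])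
  then have "gr 1 (a * z * s e) \<in> J" using assms(2) by (simp add: graded_def mult.assoc)
  also have "gr 1 (a * z * s e) = gr (1 - 1) (a * z) * s e"
    by (rule gr_mult_right) (auto intro: comonic_A[OF a(2) w] homog_s assms)
  also have "\<dots> = sc k * s e" using k(2) assms(5) by (simp add: tail_s mult.assoc)
  finally show False using sc_cancel[OF assms(1) k(1)] head_in assms by blast
qed

text \<open>The monomials are sorted by the first edge e of their ghost path, which contributes the
  rightmost factor \<open>g e\<close>; removing it shortens the ghost path by one.\<close>

lemma Span_Suc_split:
  assumes "x \<in> Span (Suc N)"
  shows "\<exists>z F y. z \<in> Span 0 \<and> finite F \<and> F \<subseteq> arcs E \<and> x = z + (\<Sum>e\<in>F. y e * g e) \<and>
    (\<forall>e\<in>F. y e \<in> Span N \<and> y e * V (head E e) = y e)"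
  using assms unfolding Span_def[of "Suc N"]
proof induction
  case sumset_0
  show ?case by (rule exI[of _ 0], rule exI[of _ "{}"]) (simp add: Span_0)
next
  case (sumset_add x x')
  obtain z F y where IH: "z \<in> Span 0" "finite F" "F \<subseteq> arcs E" "x' = z + (\<Sum>e\<in>F. y e * g e)"
    "\<And>e. e \<in> F \<Longrightarrow> y e \<in> Span N \<and> y e * V (head E e) = y e"
    using sumset_add(3) by blast
  obtain k \<alpha> w \<beta> u u' where x: "x = sc k * (pe \<alpha> * V w * ge \<beta>)" "awalk u \<alpha> w" "awalk u' \<beta> w" "length \<beta> \<le> Suc N"
    using sumset_add(1) by (rule MonE)
  show ?case
  proof (cases \<beta>)
    case Nil
    then have "x \<in> Mon 0" using x MonI[of u \<alpha> w u' \<beta> 0 k] by simp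
    then have "x + z \<in> Span 0" using IH(1) by (intro Span_add[OF Mon_Span])
    then show ?thesis using IH
      by (intro exI[of _ "x + z"] exI[of _ F] exI[of _ y]) (simp add: add.assoc)
  next
    case (Cons f \<beta>')
    have f: "f \<in> arcs E" "awalk (head E f) \<beta>' w" using x(3) Cons by (auto simp: awalk_Cons_iff)
    define m where "m = sc k * (pe \<alpha> * V w * ge \<beta>')"
    have m: "m \<in> Span N" unfolding m_def using x f Cons by (intro Mon_Span MonI) auto
    have mV: "m * V (head E f) = m" unfolding m_def using ge_V_same[OF f(2)] by (simp add: mult.assoc)
    have xm: "x = m * g f" unfolding m_def x(1) Cons by (simp add: mult.assoc)
    let ?y = "\<lambda>e. (if e \<in> F then y e else 0) + (if e = f then m else 0)"
    have "(\<Sum>e\<in>insert f F. ?y e * g e) =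
      (\<Sum>e\<in>insert f F. (if e \<in> F then y e else 0) * g e) + (\<Sum>e\<in>insert f F. (if e = f then m else 0) * g e)"
      by (simp only: distrib_right sum.distrib)
    also have "(\<Sum>e\<in>insert f F. (if e \<in> F then y e else 0) * g e) = (\<Sum>e\<in>F. y e * g e)"
      by (rule sum_insert_coeff[of F "\<lambda>e x. x * g e"]) (auto simp: IH)
    also have "(\<Sum>e\<in>insert f F. (if e = f then m else 0) * g e) = (\<Sum>e\<in>insert f F. if e = f then m * g f else 0)"
      by (intro sum.cong) auto
    also have "\<dots> = x" using IH(2) xm by simp
    finally have eq: "x + x' = z + (\<Sum>e\<in>insert f F. ?y e * g e)" unfolding IH(4) by (simp add: algebra_simps)
    have "?y e \<in> Span N \<and> ?y e * V (head E e) = ?y e" if "e \<in> insert f F" for e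
      using that IH(5) m mV by (auto simp: Span_0 Span_add distrib_right)
    then show ?thesis using IH f
      by (intro exI[of _ z] exI[of _ "insert f F"] exI[of _ ?y] conjI ballI eq) auto
  qed
qed

text \<open>That I_(H,S) contains no vertex outside \<open>H\<close> is assumed here. In each
  application it lies in an ideal whose vertices form exactly \<open>H\<close>.\<close>

context
  fixes H S Q
  assumes H: "hereditary H" and S: "S \<subseteq> breaking_vertices E H"
    and vJ: "vts (IHS H S) \<subseteq> H" and Q: "ideal Q" and JQ: "IHS H S \<subseteq> Q"
begin

lemma J_ideal: "ideal (IHS H S)"
  by (rule IHS_ideal[OF H S])

lemma V_J: "v \<in> verts E \<Longrightarrow> V v \<in> IHS H S \<longleftrightarrow> v \<in> H"
  using vJ IHS_V[OF H S] by (auto simp: vts_def)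

lemma split_vertex:
  assumes "x \<in> A" "x \<notin> IHS H S"
  shows "\<exists>w\<in>verts E - H. x * V w \<notin> IHS H S"
proof (rule ccontr)
  assume *: "\<not> ?thesis"
  obtain W where W: "finite W" "W \<subseteq> verts E" "x = (\<Sum>v\<in>W. x * V v)"
    by (rule local_unit_expand[OF assms(1)])
  have "x * V v \<in> IHS H S" if "v \<in> W" for v
    using * W that V_J idealD(5)[OF J_ideal assms(1)] by (cases "v \<in> H") auto
  then have "(\<Sum>v\<in>W. x * V v) \<in> IHS H S" by (intro ideal_sum[OF J_ideal])
  then show False using W assms by simp
qed

text \<open>Let x' = x w lie outside J = I_(H,S). If some x' e with e leaving w is outside J, its
  ghost parts are shorter and induction applies. If all x' e lie in J, the relations at w force w to
  be a sink or an infinite emitter, and the part z of x' without ghost edges satisfies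
  \<open>z * brk H w \<in> Q\<close>.\<close>

lemma reduce_to_real:
  assumes "x \<in> Span N" "x \<in> Q" "x \<notin> IHS H S"
  shows "(\<exists>w\<in>verts E - H. \<exists>z\<in>Span 0. z \<in> Q \<and> z * V w = z \<and> z \<noteq> 0) \<or>
    (\<exists>u\<in>breaking_vertices E H - S. \<exists>z\<in>Span 0. z * V u = z \<and> z \<noteq> 0 \<and> z * brk H u \<in> Q)"
  using assms
proof (induction N arbitrary: x)
  case 0
  have "x \<in> A" using 0 Span_A by blast
  then obtain w where w: "w \<in> verts E - H" "x * V w \<notin> IHS H S" using split_vertex 0 by blast
  have "x * V w \<in> Span 0" using real_V 0(1) w by blast
  moreover have "x * V w \<in> Q" using w 0 Q by (intro idealD(9)) (auto simp: A_V)
  moreover have "x * V w * V w = x * V w" using w by (simp add: mult.assoc V_idem)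
  moreover have "x * V w \<noteq> 0" using w idealD(3)[OF J_ideal] by auto
  ultimately show ?case using w by blast
next
  case (Suc N)
  note J = idealD[OF J_ideal]
  have xA: "x \<in> A" using Suc Span_A by blast
  then obtain w where w: "w \<in> verts E" "w \<notin> H" "x * V w \<notin> IHS H S" using split_vertex Suc by blast
  define x' where "x' = x * V w"
  have x': "x' \<in> A" "x' \<in> Q" "x' \<notin> IHS H S" "x' * V w = x'"
    unfolding x'_def using w xA Suc Q by (auto intro: A_mult A_V idealD simp: mult.assoc V_idem)
  obtain z0 F0 y where split: "z0 \<in> Span 0" "finite F0" "F0 \<subseteq> arcs E" "x = z0 + (\<Sum>e\<in>F0. y e * g e)"
    "\<And>e. e \<in> F0 \<Longrightarrow> y e \<in> Span N \<and> y e * V (head E e) = y e"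
    using Span_Suc_split[OF Suc(2)] by blast
  define z where "z = z0 * V w"
  define F where "F = {e \<in> F0. tail E e = w}"
  have F: "finite F" "\<And>e. e \<in> F \<Longrightarrow> e \<in> arcs E \<and> tail E e = w \<and> y e \<in> Span N \<and> y e * V (head E e) = y e"
    using split by (auto simp: F_def)
  have "(\<Sum>e\<in>F0. y e * g e * V w) = (\<Sum>e\<in>F. y e * g e)"
    using split(2,3) w g_V[OF w(1)] by (intro sum.mono_neutral_cong_right) (auto simp: F_def mult.assoc split: if_splits)
  then have x'_eq: "x' = z + (\<Sum>e\<in>F. y e * g e)"
    unfolding x'_def z_def split(4) by (simp add: distrib_right sum_distrib_right)
  have zV: "z * V w = z" using w by (simp add: z_def mult.assoc V_idem)
  have z: "z \<in> Span 0" unfolding z_def by (rule real_V[OF split(1) w(1)])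
  have gs: "(\<Sum>f\<in>F. y f * g f) * s e = (if e \<in> F then y e else 0)" if "e \<in> arcs E" for e
  proof -
    have "(\<Sum>f\<in>F. y f * g f) * s e = (\<Sum>f\<in>F. if f = e then y e else 0)"
      unfolding sum_distrib_right using F that
      by (intro sum.cong) (auto simp: mult.assoc g_s g_s_orth)
    then show ?thesis using F(1) by simp
  qed
  show ?case
  proof (cases "\<exists>e\<in>out_arcs E w. x' * s e \<notin> IHS H S")
    case True
    then obtain e where e: "e \<in> arcs E" "tail E e = w" "x' * s e \<notin> IHS H S" by auto
    have zs: "z * s e \<in> Span N"
    proof -
      have "z * s e \<in> Span 0" using z
      proof (rule Span_image[of z 0 "\<lambda>x. x * s e"])
        fix y assume "y \<in> Mon 0"
        then obtain k \<alpha> w' \<beta> u u' where y: "y = sc k * (pe \<alpha> * V w' * ge \<beta>)" "awalk u \<alpha> w'" "awalk u' \<beta> w'" "length \<beta> \<le> 0"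
          by (rule MonE)
        show "y * s e \<in> Span 0"
        proof (cases "w' = w")
          case True
          then have "y * s e = sc k * (pe (\<alpha> @ [e]) * V (head E e) * ge [])"
            using y e by (auto simp: mult.assoc tail_s s_head)
          also have "\<dots> \<in> Span 0"
            using y e True by (intro Mon_Span MonI[of u _ _ "head E e"]) (auto simp: awalk_simps)
          finally show ?thesis .
        next
          case False
          then have "y * s e = 0" using y e V_s[of w' e] by (auto simp: mult.assoc)
          then show ?thesis by (simp add: Span_0)
        qed
      qed (auto simp: distrib_right)
      then show ?thesis using Span_mono[of 0 N] by auto
    qed
    have "x' * s e = z * s e + (if e \<in> F then y e else 0)"
      unfolding x'_eq distrib_right gs[OF e(1)] ..
    also have "\<dots> \<in> Span N" using zs F(2) by (auto intro: Span_add Span_0)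
    finally have "x' * s e \<in> Span N" .
    moreover have "x' * s e \<in> Q" using x' e Q by (intro idealD(9) A_s)
    ultimately show ?thesis using Suc.IH e(3) by blast
  next
    case False
    then have se: "x' * s e \<in> IHS H S" if "e \<in> out_arcs E w" for e using that by blast
    \<comment> \<open>As every x' e lies in I_(H,S), subtracting terms \<open>s e * g e\<close> from
      w does not change x' w modulo that ideal.\<close>
    have cong: "x' - x' * (V w - (\<Sum>e\<in>F'. s e * g e)) \<in> IHS H S" if "F' \<subseteq> out_arcs E w" for F'
    proof -
      have "(\<Sum>e\<in>F'. x' * s e * g e) \<in> IHS H S"
        using that se J by (intro ideal_sum[OF J_ideal]) (auto simp: A_g)
      moreover have "x' - x' * (V w - (\<Sum>e\<in>F'. s e * g e)) = (\<Sum>e\<in>F'. x' * s e * g e)"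
        using x'(4) by (simp add: right_diff_distrib sum_distrib_left mult.assoc)
      ultimately show ?thesis by simp
    qed
    \<comment> \<open>For an edge outside \<open>F\<close> the product x' e is just z e, so
      \<open>real_mult_edge_zero\<close> applies. Since z turns out to be nonzero, all edges from w
      to vertices outside \<open>H\<close> belong to the finite set \<open>F\<close>.\<close>
    have z0: "z = 0" if "e \<in> out H w" "e \<notin> F" for e
    proof -
      have e: "e \<in> arcs E" "tail E e = w" "head E e \<notin> H" using that outD by auto
      have "x' * s e = z * s e" unfolding x'_eq distrib_right gs[OF e(1)] using that by simp
      then have "z * s e \<in> IHS H S" using se[of e] e by simp
      then show ?thesis
        using z zV e V_J[of "head E e"] by (intro real_mult_edge_zero[OF J_ideal IHS_graded[OF H S]]) auto
    qed
    have yJ: "y e \<in> IHS H S" if "e \<in> F" "head E e \<in> H" for e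
    proof -
      have "y e * V (head E e) \<in> IHS H S"
        using F(2)[OF that(1)] that V_J[of "head E e"] Span_A by (intro J(5)) auto
      then show ?thesis using F(2)[OF that(1)] by simp
    qed
    have "x' * (V w - (\<Sum>e\<in>F'. s e * g e)) \<notin> IHS H S" if "F' \<subseteq> out_arcs E w" for F'
      using cong[OF that] ideal_cong[OF J_ideal] x'(3) by blast
    then have not_full: "V w - (\<Sum>e\<in>F'. s e * g e) \<notin> IHS H S" if "F' \<subseteq> out_arcs E w" for F'
      using that x'(1) J(5) by blast
    \<comment> \<open>If z = 0, then x' e = y e on \<open>F\<close>, and subtracting the terms of
      \<open>F\<close> leaves nothing of x', although it leaves x' unchanged modulo I_(H,S).\<close>
    have z_ne: "z \<noteq> 0"
    proof
      assume "z = 0"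
      have "x' * (V w - (\<Sum>e\<in>F. s e * g e)) = x' - (\<Sum>e\<in>F. x' * s e * g e)"
        using x'(4) by (simp add: right_diff_distrib sum_distrib_left mult.assoc)
      also have "(\<Sum>e\<in>F. x' * s e * g e) = (\<Sum>e\<in>F. y e * g e)"
      proof (rule sum.cong[OF refl])
        fix e assume "e \<in> F"
        then show "x' * s e * g e = y e * g e"
          using gs[of e] F(2)[of e] \<open>z = 0\<close> by (simp add: x'_eq)
      qed
      finally have "x' * (V w - (\<Sum>e\<in>F. s e * g e)) = 0" using \<open>z = 0\<close> by (simp add: x'_eq)
      moreover have "x' * (V w - (\<Sum>e\<in>F. s e * g e)) \<notin> IHS H S"
        using cong[of F] ideal_cong[OF J_ideal] x'(3) F(2) by (auto simp: subset_iff)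
      ultimately show False using J(3) by simp
    qed
    then have outF: "out H w \<subseteq> F" using z0 by blast
    then have fin: "finite (out H w)" using F(1) finite_subset by blast
    \<comment> \<open>At a regular vertex w minus the sum over all its edges is zero, which
      \<open>not_full\<close> excludes.\<close>
    have inf: "finite (out_arcs E w) \<longrightarrow> out_arcs E w = {}"
    proof (rule ccontr)
      assume "\<not> ?thesis"
      then have "regular_vertex E w" using w by (simp add: regular_vertex_def)
      then have "V w - (\<Sum>e\<in>out_arcs E w. s e * g e) = 0" using CK by simp
      then show False using not_full[of "out_arcs E w"] J(3) by simp
    qed
    \<comment> \<open>The summands \<open>y e * g e\<close> with range outside \<open>H\<close> are
      annihilated by the factor on the right, and for range in \<open>H\<close> the coefficient
      \<open>y e\<close> lies in the ideal already. Only the contribution of z remains.\<close>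
    have zQ: "z * (V w - (\<Sum>e\<in>out H w. s e * g e)) \<in> Q"
    proof -
      have sub: "out H w \<subseteq> out_arcs E w" by (auto simp: out_def)
      have "x' * (V w - (\<Sum>e\<in>out H w. s e * g e)) \<in> Q"
        using cong[OF sub] JQ ideal_cong[OF Q] x'(2) by blast
      moreover have "y e * g e * (V w - (\<Sum>e\<in>out H w. s e * g e)) \<in> Q" if "e \<in> F" for e
      proof (cases "head E e \<in> H")
        case True
        have "V w - (\<Sum>e\<in>out H w. s e * g e) \<in> A"
          using w by (intro A_diff A_V A_sum A_mult A_s A_g) (auto dest: outD)
        then have "y e * (g e * (V w - (\<Sum>e\<in>out H w. s e * g e))) \<in> IHS H S"
          using yJ[OF that True] F(2)[OF that] by (intro J(9) A_mult A_g) auto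
        then show ?thesis using JQ by (auto simp: mult.assoc)
      next
        case False
        then have e: "e \<in> out H w" using F(2)[OF that] by (auto simp: out_def)
        have "(\<Sum>f\<in>out H w. g e * (s f * g f)) = (\<Sum>f\<in>out H w. if f = e then g e else 0)"
          using e by (intro sum.cong) (auto dest!: outD simp: g_s g_s_orth head_g simp flip: mult.assoc)
        then have "g e * (V w - (\<Sum>e\<in>out H w. s e * g e)) = 0"
          using e fin F(2)[OF that] g_V[OF w(1), of e] by (simp add: right_diff_distrib sum_distrib_left)
        then show ?thesis using idealD(3)[OF Q] by (simp add: mult.assoc)
      qed
      then have "(\<Sum>e\<in>F. y e * g e * (V w - (\<Sum>e\<in>out H w. s e * g e))) \<in> Q"
        by (intro ideal_sum[OF Q])
      ultimately have "x' * (V w - (\<Sum>e\<in>out H w. s e * g e)) -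
          (\<Sum>e\<in>F. y e * g e * (V w - (\<Sum>e\<in>out H w. s e * g e))) \<in> Q"
        by (intro idealD(8)[OF Q])
      then show ?thesis unfolding x'_eq by (simp only: distrib_right sum_distrib_right add_diff_cancel_right')
    qed
    \<comment> \<open>Without edges to vertices outside \<open>H\<close> the factor is w itself and
      z lies in Q. Otherwise w emits infinitely many edges, finitely many of them to vertices
      outside \<open>H\<close>, and is a breaking vertex.\<close>
    show ?thesis
    proof (cases "out H w = {}")
      case True
      then show ?thesis using zQ z zV z_ne w by auto
    next
      case False
      then have B: "w \<in> breaking_vertices E H" using inf fin w by (auto simp: breaking_out out_def)
      have "out H w \<subseteq> out_arcs E w" by (auto simp: out_def)
      from not_full[OF this] have "w \<notin> S" using IHS_brk[OF H S, of w] unfolding brk_def by blast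
      then show ?thesis using zQ z zV z_ne B by (auto simp: brk_def)
    qed
  qed
qed

text \<open>If \<open>z * brk H u\<close> lies in Q and a z is comonic at u, then u^H a z u^H is a
  nonzero multiple of u^H, because u^H annihilates nontrivial closed walks at u from the
  left.\<close>

lemma reduce_to_comonic:
  assumes "IHS H S \<noteq> Q"
  shows "(\<exists>u\<in>breaking_vertices E H - S. brk H u \<in> Q) \<or> (\<exists>w\<in>verts E - H. \<exists>D y. comonic w D y \<and> y \<in> Q)"
proof -
  obtain x where x: "x \<in> Q" "x \<notin> IHS H S" using JQ assms by blast
  then obtain N where "x \<in> Span N" using A_Span idealD(2)[OF Q] by blast
  from reduce_to_real[OF this x] show ?thesis
  proof
    assume "\<exists>w\<in>verts E - H. \<exists>z\<in>Span 0. z \<in> Q \<and> z * V w = z \<and> z \<noteq> 0"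
    then obtain w z where z: "w \<in> verts E - H" "z \<in> Span 0" "z \<in> Q" "z * V w = z" "z \<noteq> 0" by blast
    then obtain a D where "a \<in> A" "comonic w D (a * z)" using real_comonic[of z w] by auto
    then show ?thesis using z idealD(5)[OF Q] by blast
  next
    assume "\<exists>u\<in>breaking_vertices E H - S. \<exists>z\<in>Span 0. z * V u = z \<and> z \<noteq> 0 \<and> z * brk H u \<in> Q"
    then obtain u z where u: "u \<in> breaking_vertices E H" "u \<notin> S" and
      z: "z \<in> Span 0" "z * V u = z" "z \<noteq> 0" "z * brk H u \<in> Q" by blast
    note b = brk_u[OF u(1)]
    obtain a D where a: "a \<in> A" "comonic u D (a * z)" using real_comonic[of z u] z b by blast
    obtain k c where D: "\<And>\<gamma>. \<gamma> \<in> D \<Longrightarrow> awalk u \<gamma> u \<and> \<gamma> \<noteq> []" "k \<noteq> 0"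
      "a * z = sc k * V u + (\<Sum>\<gamma>\<in>D. sc (c \<gamma>) * (pe \<gamma> * V u))"
      using a(2) unfolding comonic_def by blast
    have "brk H u * (sc (c \<gamma>) * (pe \<gamma> * V u)) = 0" if "\<gamma> \<in> D" for \<gamma>
    proof -
      from D(1)[OF that] obtain e \<gamma>' where \<gamma>: "\<gamma> = e # \<gamma>'" by (cases \<gamma>) auto
      then have e: "e \<in> arcs E" "tail E e = u" "awalk (head E e) \<gamma>' u" using D(1)[OF that] by (auto simp: awalk_Cons_iff)
      \<comment> \<open>The rest of the walk returns to u outside \<open>H\<close>, so the range of
        its first edge cannot lie in the hereditary set \<open>H\<close>.\<close>
      then have "e \<in> out H u" using hereditary_awalk[OF H e(3)] b by (auto simp: out_def)
      then have "brk H u * s e = 0" by (rule brk_s[OF u(1)])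
      moreover have "brk H u * (sc (c \<gamma>) * (pe \<gamma> * V u)) = sc (c \<gamma>) * ((brk H u * s e) * (pe \<gamma>' * V u))"
        using sc_comm[OF brk_A[OF u(1)]] \<gamma> by (simp add: mult.assoc) (simp flip: mult.assoc)
      ultimately show ?thesis by simp
    qed
    then have "brk H u * (a * z) = brk H u * (sc k * V u)"
      by (simp add: D(3) distrib_left sum_distrib_left)
    also have "\<dots> = sc k * brk H u"
      using sc_comm[OF brk_A[OF u(1)]] brk_V[OF u(1) b(1)] by (simp add: mult.assoc[symmetric]) (simp add: mult.assoc)
    finally have "brk H u * (a * z) * brk H u = sc k * brk H u"
      using brk_idem[OF u(1)] by (simp add: mult.assoc)
    moreover have "(brk H u * a) * (z * brk H u) \<in> Q"
      using z(4) a brk_A[OF u(1)] by (intro idealD(5)[OF Q A_mult])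
    ultimately have "sc k * brk H u \<in> Q" by (simp add: mult.assoc)
    then show ?thesis using sc_cancel[OF Q D(2)] u by blast
  qed
qed

text \<open>Conjugation by \<delta> turns \<gamma> into \<eta> if \<gamma>\<delta> = \<delta>\<eta>,
  and into 0 otherwise: by length \<delta> cannot extend \<gamma>\<delta>, so the two paths are then
  incomparable.\<close>

lemma comonic_shift:
  assumes "comonic w D y" "y \<in> Q" "awalk w \<delta> x"
  shows "\<exists>D' y'. comonic x D' y' \<and> y' \<in> Q \<and> card D' = card {\<gamma> \<in> D. \<exists>\<eta>. \<gamma> @ \<delta> = \<delta> @ \<eta>}"
proof -
  obtain k c where D: "finite D" "\<And>\<gamma>. \<gamma> \<in> D \<Longrightarrow> awalk w \<gamma> w \<and> \<gamma> \<noteq> []" "k \<noteq> 0"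
    "y = sc k * V w + (\<Sum>\<gamma>\<in>D. sc (c \<gamma>) * (pe \<gamma> * V w))"
    using assms(1) unfolding comonic_def by blast
  define D1 where "D1 = {\<gamma> \<in> D. \<exists>\<eta>. \<gamma> @ \<delta> = \<delta> @ \<eta>}"
  define f where "f \<gamma> = drop (length \<delta>) (\<gamma> @ \<delta>)" for \<gamma>
  have f: "\<gamma> @ \<delta> = \<delta> @ f \<gamma>" if "\<gamma> \<in> D1" for \<gamma>
  proof -
    from that obtain \<eta> where "\<gamma> @ \<delta> = \<delta> @ \<eta>" by (auto simp: D1_def)
    then show ?thesis by (simp add: f_def)
  qed
  have fw: "awalk x (f \<gamma>) x \<and> f \<gamma> \<noteq> []" if "\<gamma> \<in> D1" for \<gamma>
  proof -
    have "awalk w (\<gamma> @ \<delta>) x" using D(2)[of \<gamma>] that assms(3) by (auto simp: D1_def)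
    then have "awalk (awlast w \<delta>) (f \<gamma>) x" using f[OF that] by simp
    moreover have "length (f \<gamma>) = length \<gamma>" by (simp add: f_def)
    ultimately show ?thesis using assms(3) D(2)[of \<gamma>] that by (auto simp: D1_def)
  qed
  have inj: "inj_on f D1"
  proof (rule inj_onI)
    fix \<gamma> \<gamma>' assume "\<gamma> \<in> D1" "\<gamma>' \<in> D1" "f \<gamma> = f \<gamma>'"
    then have "\<gamma> @ \<delta> = \<gamma>' @ \<delta>" using f by simp
    then show "\<gamma> = \<gamma>'" by simp
  qed
  define a where "a = V x * ge \<delta>"
  define b where "b = pe \<delta> * V x"
  have ab: "a \<in> A" "b \<in> A" unfolding a_def b_def using assms(3) by (auto intro: A_ge A_pe)
  have Vb: "V w * b = b" unfolding b_def by (rule V_pe_same[OF assms(3)])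
  have T1: "a * (pe \<gamma> * V w) * b = pe (f \<gamma>) * V x" if "\<gamma> \<in> D1" for \<gamma>
  proof -
    have "a * (pe \<gamma> * V w) * b = a * (pe \<gamma> * (V w * b))" by (simp add: mult.assoc)
    also have "\<dots> = V x * ge \<delta> * (pe (\<gamma> @ \<delta>) * V x)" unfolding Vb by (simp add: a_def b_def mult.assoc)
    also have "\<dots> = pe (f \<gamma>) * V x"
      unfolding f[OF that] by (rule ge_pe_append(1)[OF assms(3)]) (use fw[OF that] in blast)
    finally show ?thesis .
  qed
  have T0: "a * (pe \<gamma> * V w) * b = 0" if "\<gamma> \<in> D - D1" for \<gamma>
  proof -
    have "awalk w (\<gamma> @ \<delta>) x" using D(2)[of \<gamma>] that assms(3) by auto
    then have "ge \<delta> * pe (\<gamma> @ \<delta>) = 0"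
    proof (rule ge_pe_incomparable[OF assms(3)])
      show "\<nexists>\<eta>. \<gamma> @ \<delta> = \<delta> @ \<eta>" using that by (auto simp: D1_def)
      show "\<nexists>\<eta>. \<delta> = (\<gamma> @ \<delta>) @ \<eta>"
      proof
        assume "\<exists>\<eta>. \<delta> = (\<gamma> @ \<delta>) @ \<eta>"
        then obtain \<eta> where "\<delta> = (\<gamma> @ \<delta>) @ \<eta>" by blast
        from arg_cong[OF this, of length] have "\<gamma> = []" by simp
        then show False using D(2)[of \<gamma>] that by simp
      qed
    qed
    moreover have "a * (pe \<gamma> * V w) * b = a * (pe \<gamma> * (V w * b))" by (simp add: mult.assoc)
    ultimately show ?thesis unfolding Vb by (simp add: a_def b_def mult.assoc) (simp flip: mult.assoc)
  qed
  have "a * y * b = sc k * (a * V w * b) + (\<Sum>\<gamma>\<in>D. sc (c \<gamma>) * (a * (pe \<gamma> * V w) * b))"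
    unfolding D(4) using sc_comm[OF ab(1)]
    by (simp add: distrib_left distrib_right sum_distrib_left sum_distrib_right flip: mult.assoc)
  also have "a * V w * b = V x"
    using ge_pe[OF assms(3)] unfolding mult.assoc[of a] Vb by (simp add: a_def b_def)
  also have "(\<Sum>\<gamma>\<in>D. sc (c \<gamma>) * (a * (pe \<gamma> * V w) * b)) = (\<Sum>\<gamma>\<in>D1. sc (c \<gamma>) * (pe (f \<gamma>) * V x))"
    using D(1) T0 T1 by (intro sum.mono_neutral_cong_right) (auto simp: D1_def)
  also have "\<dots> = (\<Sum>\<eta>\<in>f ` D1. sc (c (inv_into D1 f \<eta>)) * (pe \<eta> * V x))"
    using inj by (subst sum.reindex) (auto intro!: sum.cong)
  finally have "comonic x (f ` D1) (a * y * b)"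
    unfolding comonic_def using D fw by (auto simp: D1_def)
  moreover have "a * y * b \<in> Q" using ab assms by (intro ideal_sandwich[OF Q])
  moreover have "card (f ` D1) = card D1" by (rule card_image[OF inj])
  ultimately show ?thesis unfolding D1_def by blast
qed

theorem reduction:
  assumes "IHS H S \<noteq> Q"
  obtains u where "u \<in> breaking_vertices E H - S" "brk H u \<in> Q"
  | w where "w \<in> verts E - H" "V w \<in> Q"
  | w D y where "w \<in> verts E - H" "unique_walks H w" "D \<noteq> {}" "comonic w D y" "y \<in> Q"
proof -
  consider u where "u \<in> breaking_vertices E H - S" "brk H u \<in> Q"
    | w D y where "w \<in> verts E - H" "comonic w D y" "y \<in> Q"
    using reduce_to_comonic[OF assms] by blast
  then show ?thesis
  proof cases
    case (2 w0 D0 y0)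
    \<comment> \<open>Minimality is taken over all vertices outside \<open>H\<close> at once,
      because conjugation by \<delta> moves the base point from w to the end of \<delta>.\<close>
    define R where "R = {(w, D, y). w \<in> verts E - H \<and> comonic w D y \<and> y \<in> Q}"
    have "(w0, D0, y0) \<in> R" using 2 by (simp add: R_def)
    then obtain r where r: "r \<in> R" "\<And>r'. r' \<in> R \<Longrightarrow> card (fst (snd r)) \<le> card (fst (snd r'))"
      using ex_has_least_nat[of "\<lambda>r. r \<in> R" _ "\<lambda>r. card (fst (snd r))"] by blast
    obtain w D y where rw: "r = (w, D, y)" by (cases r) auto
    have w: "w \<in> verts E - H" "comonic w D y" "y \<in> Q" using r(1) rw by (auto simp: R_def)
    have least: "card D \<le> card D'" if "x \<in> verts E - H" "comonic x D' y'" "y' \<in> Q" for x D' y'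
      using r(2)[of "(x, D', y')"] that rw by (simp add: R_def)
    obtain k c where D: "finite D" "\<And>\<gamma>. \<gamma> \<in> D \<Longrightarrow> awalk w \<gamma> w \<and> \<gamma> \<noteq> []" "k \<noteq> 0"
      "y = sc k * V w + (\<Sum>\<gamma>\<in>D. sc (c \<gamma>) * (pe \<gamma> * V w))"
      using w(2) unfolding comonic_def by blast
    show ?thesis
    proof (cases "D = {}")
      case True
      then have "V w \<in> Q" using D w sc_cancel[OF Q D(3)] by simp
      then show ?thesis using that(2) w by blast
    next
      case False
      then obtain \<gamma> where \<gamma>: "\<gamma> \<in> D" by blast
      have pref: "\<exists>\<eta>. \<gamma> @ \<delta> = \<delta> @ \<eta>" if "awalk w \<delta> x" "x \<notin> H" for \<delta> x
      proof -
        from comonic_shift[OF w(2,3) that(1)] obtain D' y' where *: "comonic x D' y'" "y' \<in> Q"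
          "card D' = card {\<gamma> \<in> D. \<exists>\<eta>. \<gamma> @ \<delta> = \<delta> @ \<eta>}" by blast
        have "card D \<le> card {\<gamma> \<in> D. \<exists>\<eta>. \<gamma> @ \<delta> = \<delta> @ \<eta>}"
          using least[OF _ *(1,2)] *(3) that by auto
        then have "{\<gamma> \<in> D. \<exists>\<eta>. \<gamma> @ \<delta> = \<delta> @ \<eta>} = D" using D(1) by (intro card_seteq) auto
        then show ?thesis using \<gamma> by blast
      qed
      have "unique_walks H w"
        unfolding unique_walks_def
      proof (intro allI impI)
        fix \<delta> \<delta>' x x' assume *: "awalk w \<delta> x" "awalk w \<delta>' x'" "x \<notin> H" "x' \<notin> H" "length \<delta> = length \<delta>'"
        obtain \<eta> \<eta>' where \<eta>: "\<gamma> @ \<delta> = \<delta> @ \<eta>" and \<eta>': "\<gamma> @ \<delta>' = \<delta>' @ \<eta>'"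
          using pref[OF *(1,3)] pref[OF *(2,4)] by blast
        show "\<delta> = \<delta>'" by (rule periodic_list_unique[OF conjunct2[OF D(2)[OF \<gamma>]] \<eta> \<eta>' *(5)])
      qed
      then show ?thesis using that(3) w False by blast
    qed
  qed (use that(1) in blast)
qed

end

end

section \<open>Cycles without exits\<close>

lemma cas_cong:
  "tail G = tail G' \<Longrightarrow> head G = head G' \<Longrightarrow> pre_digraph.cas G u p v = pre_digraph.cas G' u p v"
  by (induction p arbitrary: u) (auto simp: pre_digraph.cas.simps)

lemma awalk_verts_cong:
  "tail G = tail G' \<Longrightarrow> head G = head G' \<Longrightarrow> pre_digraph.awalk_verts G u p = pre_digraph.awalk_verts G' u p"
  by (induction p arbitrary: u) (auto simp: pre_digraph.awalk_verts.simps)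

context wf_digraph
begin

lemma awalk_closed_tails:
  assumes "awalk u p u" "e \<in> set p"
  shows "\<exists>f\<in>set p. tail G f = head G e"
proof -
  obtain p1 p2 where p: "p = p1 @ e # p2" using assms(2) by (meson split_list)
  show ?thesis
  proof (cases p2)
    case Nil
    then have "head G e = u" using assms(1) p by (auto simp: awalk_simps)
    moreover have "tail G (hd p) = u" using assms by (cases p) (auto simp: awalk_Cons_iff)
    ultimately show ?thesis using assms(2) by (intro bexI[of _ "hd p"]) (auto intro: hd_in_set)
  next
    case (Cons f p3)
    then show ?thesis using assms(1) p by (intro bexI[of _ f]) (auto simp: awalk_Cons_iff)
  qed
qed

lemma awalk_restrict:
  assumes "X \<subseteq> verts G"
  shows "pre_digraph.awalk (G \<restriction> X) u p v \<longleftrightarrow>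
    awalk u p v \<and> u \<in> X \<and> (\<forall>e\<in>set p. tail G e \<in> X \<and> head G e \<in> X)"
proof -
  have "pre_digraph.cas (G \<restriction> X) u p v = cas u p v" by (rule cas_cong) auto
  then show ?thesis using assms by (auto simp: pre_digraph.awalk_def)
qed

end

context leavitt_model
begin

lemma awalk_avoids:
  assumes "hereditary H" "awalk u p v" "v \<notin> H"
  shows "u \<notin> H" "e \<in> set p \<Longrightarrow> tail E e \<notin> H \<and> head E e \<notin> H"
proof -
  show "u \<notin> H" using hereditary_awalk assms by blast
  assume "e \<in> set p"
  then obtain p1 p2 where "p = p1 @ e # p2" by (meson split_list)
  then have "awalk (tail E e) (e # p2) v" "awalk (head E e) p2 v"
    using assms(2) by (auto simp: awalk_Cons_iff)
  then show "tail E e \<notin> H \<and> head E e \<notin> H" using hereditary_awalk assms by blast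
qed

text \<open>If Condition (L) fails, some cycle has no exit in the complement of \<open>H\<close>. A
  walk that ends outside \<open>H\<close> stays there, so a walk that starts on the cycle is forced
  edge by edge.\<close>

lemma no_exit_cycle:
  assumes "hereditary H" "\<not> condition_L E (verts E - H)"
  shows "\<exists>w\<in>verts E - H. unique_walks H w \<and> (\<exists>\<gamma>. awalk w \<gamma> w \<and> \<gamma> \<noteq> [])"
proof -
  let ?X = "verts E - H"
  obtain p where p: "pre_digraph.cycle (E \<restriction> ?X) p"
    "\<And>e f. e \<in> set p \<Longrightarrow> f \<in> arcs (E \<restriction> ?X) \<Longrightarrow> tail E f = tail E e \<Longrightarrow> f = e"
    using assms(2) unfolding condition_L_def graph_condition_L_def by auto
  obtain w where w: "awalk w p w" "w \<in> ?X" "p \<noteq> []"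
    using p(1) awalk_restrict[of ?X] unfolding pre_digraph.cycle_def by auto
  \<comment> \<open>The starting vertex varies over the cycle, since removing the first edge moves
    it.\<close>
  have uniq: "\<delta> = \<delta>'"
    if "awalk y \<delta> x" "awalk y \<delta>' x'" "x \<notin> H" "x' \<notin> H" "length \<delta> = length \<delta>'" "\<exists>e\<in>set p. tail E e = y"
    for \<delta> \<delta>' x x' y
    using that
  proof (induction \<delta> arbitrary: \<delta>' y)
    case (Cons e \<delta>)
    obtain f \<delta>1 where \<delta>': "\<delta>' = f # \<delta>1" using Cons.prems(5) by (cases \<delta>') auto
    obtain e0 where e0: "e0 \<in> set p" "tail E e0 = y" using Cons.prems(6) by blast
    have e: "e \<in> arcs E" "tail E e = y" "awalk (head E e) \<delta> x"
      and f: "f \<in> arcs E" "tail E f = y" "awalk (head E f) \<delta>1 x'"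
      using Cons.prems \<delta>' by (auto simp: awalk_Cons_iff)
    have "e \<in> arcs (E \<restriction> ?X)" "f \<in> arcs (E \<restriction> ?X)"
      using e f Cons.prems \<delta>' awalk_avoids(2)[OF assms(1) Cons.prems(1,3), of e]
        awalk_avoids(2)[OF assms(1) Cons.prems(2,4), of f] by auto
    then have ef: "e = e0" "f = e0" using p(2)[OF e0(1)] e f e0 by auto
    have "\<exists>e'\<in>set p. tail E e' = head E e0" using awalk_closed_tails[OF w(1) e0(1)] .
    then have "\<delta> = \<delta>1"
      using e f ef Cons.prems \<delta>' by (intro Cons.IH[of "head E e0"]) auto
    then show ?case using ef \<delta>' by simp
  qed simp
  have "\<exists>e\<in>set p. tail E e = w" using w by (cases p) (auto simp: awalk_Cons_iff)
  then have "unique_walks H w" unfolding unique_walks_def using uniq by blast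
  then show ?thesis using w by blast
qed

text \<open>A closed walk contains a cycle, and an exit from it would continue a walk from w in two
  ways with equal lengths.\<close>

lemma unique_walks_not_L:
  assumes "hereditary H" "w \<in> verts E - H" "unique_walks H w" "awalk w \<gamma> w" "\<gamma> \<noteq> []"
  shows "\<not> condition_L E (verts E - H)"
proof
  let ?X = "verts E - H"
  assume L: "condition_L E ?X"
  \<comment> \<open>The cycle is extracted inside the set of vertices reached from w, so that w is
    known to lead to it even though its relation to \<gamma> is lost.\<close>
  define Y where "Y = {y. y \<notin> H \<and> (\<exists>\<delta>. awalk w \<delta> y)}"
  have Y: "Y \<subseteq> ?X" by (auto simp: Y_def)
  then have Yv: "Y \<subseteq> verts E" by blast
  interpret Y: wf_digraph "E \<restriction> Y" by (rule wellformed_induce_subgraph)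
  have "tail E e \<in> Y \<and> head E e \<in> Y" if "e \<in> set \<gamma>" for e
  proof -
    from that obtain p1 p2 where "\<gamma> = p1 @ e # p2" by (meson split_list)
    then have "awalk w p1 (tail E e)" "awalk w (p1 @ [e]) (head E e)"
      using assms(4) by (auto simp: awalk_simps)
    then show ?thesis using awalk_avoids(2)[OF assms(1,4) _ that] assms(2) unfolding Y_def by blast
  qed
  moreover have "w \<in> Y" using assms(2) by (auto simp: Y_def awalk_Nil_iff intro!: exI[of _ "[]"])
  ultimately have "Y.awalk w \<gamma> w" using assms(4) awalk_restrict[OF Yv] by blast
  then have "Y.closed_w \<gamma>" using assms(5) by (auto simp: Y.closed_w_def)
  then obtain p where "Y.cycle p" using Y.closed_w_imp_cycle by blast
  then obtain u where u: "Y.awalk u p u" "distinct (tl (Y.awalk_verts u p))" "p \<noteq> []"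
    unfolding Y.cycle_def by blast
  have "pre_digraph.awalk (E \<restriction> ?X) u p u"
    using u(1) Y awalk_restrict[OF Yv] awalk_restrict[of ?X] by auto
  moreover have "pre_digraph.awalk_verts (E \<restriction> ?X) u p = Y.awalk_verts u p"
    by (rule awalk_verts_cong) auto
  ultimately have "pre_digraph.cycle (E \<restriction> ?X) p" using u unfolding pre_digraph.cycle_def by auto
  with L have "\<exists>e\<in>set p. \<exists>f\<in>arcs (E \<restriction> ?X). tail E f = tail E e \<and> f \<noteq> e"
    unfolding condition_L_def graph_condition_L_def induce_subgraph_tail by blast
  then obtain e f where ef: "e \<in> set p" "f \<in> arcs (E \<restriction> ?X)" "tail E f = tail E e" "f \<noteq> e"
    by blast
  have e: "e \<in> arcs E" "tail E e \<in> Y" "head E e \<in> Y"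
    using u(1) ef(1) awalk_restrict[OF Yv, of u p u] by auto
  then obtain \<delta> where \<delta>: "awalk w \<delta> (tail E e)" by (auto simp: Y_def)
  have "awalk w (\<delta> @ [e]) (head E e)" "awalk w (\<delta> @ [f]) (head E f)"
    using \<delta> e ef by (auto simp: awalk_simps)
  moreover have "head E e \<notin> H" "head E f \<notin> H" using e ef Y by auto
  ultimately have "\<delta> @ [e] = \<delta> @ [f]"
    using assms(3)[unfolded unique_walks_def, rule_format, of "\<delta> @ [e]" "head E e" "\<delta> @ [f]" "head E f"]
    by simp
  then show False using ef(4) by simp
qed

section \<open>Corners at cycles without exits\<close>

context
  fixes P H w \<gamma>
  assumes P: "ideal P" and H: "H = vts P" and B: "\<forall>u\<in>breaking_vertices E H. brk H u \<in> P"
    and w: "w \<in> verts E - H" and uniq: "unique_walks H w"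
    and \<gamma>: "awalk w \<gamma> w" "\<gamma> \<noteq> []"
begin

lemma H_hered: "hereditary H"
  using vts_hereditary[OF P] H by simp

lemma V_P: "v \<in> verts E \<Longrightarrow> V v \<in> P \<longleftrightarrow> v \<in> H"
  by (auto simp: H vts_def)

lemma uniqD:
  "awalk w \<delta> x \<Longrightarrow> awalk w \<delta>' x' \<Longrightarrow> x \<notin> H \<Longrightarrow> x' \<notin> H \<Longrightarrow> length \<delta> = length \<delta>' \<Longrightarrow> \<delta> = \<delta>' \<and> x = x'"
proof -
  assume *: "awalk w \<delta> x" "awalk w \<delta>' x'" "x \<notin> H" "x' \<notin> H" "length \<delta> = length \<delta>'"
  then have "\<delta> = \<delta>'" using uniq unfolding unique_walks_def by blast
  moreover have "awlast w \<delta> = x" "awlast w \<delta>' = x'" using *(1,2) by simp_all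
  ultimately show ?thesis by simp
qed

lemma closed_power: "awalk w (concat (replicate n \<gamma>)) w"
  using \<gamma> w by (induction n) (auto simp: awalk_Nil_iff)

lemma awalk_take:
  assumes "awalk u p v" "v \<notin> H"
  shows "\<exists>x. awalk u (take n p) x \<and> awalk x (drop n p) v \<and> x \<notin> H"
proof -
  have "awalk u (take n p @ drop n p) v" using assms by simp
  then have "awalk u (take n p) (awlast u (take n p))" "awalk (awlast u (take n p)) (drop n p) v"
    unfolding awalk_append_iff by auto
  then show ?thesis using hereditary_awalk[OF H_hered] assms(2) by blast
qed

lemma walk_exists: "\<exists>\<delta> x. awalk w \<delta> x \<and> x \<notin> H \<and> length \<delta> = n"
proof -
  let ?p = "concat (replicate n \<gamma>)"
  have "length ?p = n * length \<gamma>" by (induction n) auto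
  then have "n \<le> length ?p" using \<gamma>(2) by (cases \<gamma>) auto
  then have "length (take n ?p) = n" by simp
  then show ?thesis using awalk_take[OF closed_power[of n], of n] w by blast
qed

text \<open>By uniqueness \<alpha> is the initial segment of any longer walk from w that avoids
  \<open>H\<close>; the rest of that walk is the extension.\<close>

lemma extension:
  assumes "awalk w \<alpha> x" "x \<notin> H"
  shows "\<exists>\<epsilon> x'. awalk x \<epsilon> x' \<and> x' \<notin> H \<and> length \<epsilon> = n"
proof -
  obtain \<delta> x' where \<delta>: "awalk w \<delta> x'" "x' \<notin> H" "length \<delta> = length \<alpha> + n"
    using walk_exists by blast
  obtain y where y: "awalk w (take (length \<alpha>) \<delta>) y" "awalk y (drop (length \<alpha>) \<delta>) x'" "y \<notin> H"
    using awalk_take[OF \<delta>(1,2)] by blast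
  have "x = y" using uniqD[OF assms(1) y(1) assms(2) y(3)] \<delta>(3) by simp
  then show ?thesis using y \<delta> by (intro exI[of _ "drop (length \<alpha>) \<delta>"] exI[of _ x']) simp
qed

text \<open>Each vertex x on the walk emits a single edge e to a vertex outside \<open>H\<close>,
  and x equals \<open>s e * g e\<close> modulo P. For regular x the other terms of the defining sum
  lie in P.\<close>

lemma vertex_expand:
  assumes "awalk w \<alpha> x" "awalk x \<epsilon> x'" "x' \<notin> H"
  shows "V x - pe \<epsilon> * V x' * ge \<epsilon> \<in> P"
  using assms
proof (induction \<epsilon> arbitrary: x \<alpha>)
  case Nil
  then show ?case using idealD(3)[OF P] by (simp add: awalk_Nil_iff)
next
  case (Cons e \<epsilon>)
  have e: "e \<in> arcs E" "tail E e = x" "awalk (head E e) \<epsilon> x'"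
    using Cons.prems by (auto simp: awalk_Cons_iff)
  have he: "head E e \<notin> H" and xH: "x \<notin> H"
    using hereditary_awalk[OF H_hered] e Cons.prems by blast+
  have x: "x \<in> verts E" using e by auto
  have ext: "awalk w (\<alpha> @ [f]) (head E f)" if "f \<in> arcs E" "tail E f = x" for f
    using Cons.prems(1) that by (auto simp: awalk_simps)
  have out: "out H x = {e}"
  proof -
    have "f = e" if "f \<in> out H x" for f
      using uniqD[OF ext[of f] ext[of e]] outD[OF that] e he by auto
    moreover have "e \<in> out H x" using e he by (simp add: out_def)
    ultimately show ?thesis by blast
  qed
  have 1: "V x - s e * g e \<in> P"
  proof (cases "finite (out_arcs E x)")
    case True
    then have "regular_vertex E x" using e x by (auto simp: regular_vertex_def)
    then have "V x - s e * g e = (\<Sum>f\<in>out_arcs E x - {e}. s f * g f)"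
      using CK[of x] True e by (simp add: sum.remove[of "out_arcs E x" e])
    moreover have sgP: "s f * g f \<in> P" if "f \<in> out_arcs E x - {e}" for f
    proof -
      have f: "f \<in> arcs E" "head E f \<in> H" using that out by (auto simp: out_def)
      then show ?thesis using s_in[OF P, of f] V_P[of "head E f"] by (intro idealD(9)[OF P] A_g) auto
    qed
    then have "(\<Sum>f\<in>out_arcs E x - {e}. s f * g f) \<in> P" by (rule ideal_sum[OF P])
    ultimately show ?thesis by simp
  next
    case False
    \<comment> \<open>For an infinite emitter with exactly one edge e to a vertex outside
      \<open>H\<close>, the element \<open>brk H x\<close> is x minus
      \<open>s e * g e\<close>.\<close>
    then have "x \<in> breaking_vertices E H" using x xH out by (auto simp: breaking_out)
    from bspec[OF B this] show ?thesis by (simp add: brk_def out)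
  qed
  have "V (head E e) - pe \<epsilon> * V x' * ge \<epsilon> \<in> P"
    using Cons.IH[OF ext[OF e(1,2)] e(3) Cons.prems(3)] .
  then have "s e * (V (head E e) - pe \<epsilon> * V x' * ge \<epsilon>) * g e \<in> P"
    using e by (intro ideal_sandwich[OF P] A_s A_g)
  moreover have "s e * (V (head E e) - pe \<epsilon> * V x' * ge \<epsilon>) * g e = s e * g e - pe (e # \<epsilon>) * V x' * ge (e # \<epsilon>)"
    using e by (simp add: right_diff_distrib left_diff_distrib s_head) (simp add: mult.assoc)
  ultimately show ?case using ideal_trans[OF ideal_lideal[OF P] 1] by simp
qed

text \<open>Replacing the middle vertex x by \<epsilon> times its ghost lengthens both paths by
  \<epsilon>. This brings monomials to prescribed lengths without changing them modulo P.\<close>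

lemma monomial_shift:
  assumes "awalk w \<alpha> x" "awalk w \<beta> x" "awalk x \<epsilon> x'" "x' \<notin> H"
  shows "pe \<alpha> * V x * ge \<beta> - pe (\<alpha> @ \<epsilon>) * V x' * ge (\<beta> @ \<epsilon>) \<in> P"
proof -
  have x: "x \<in> verts E" using assms by auto
  have "(pe \<alpha> * V x) * (V x - pe \<epsilon> * V x' * ge \<epsilon>) * (V x * ge \<beta>) \<in> P"
    using vertex_expand[OF assms(1,3,4)] assms by (intro ideal_sandwich[OF P] A_pe A_ge)
  moreover have "(pe \<alpha> * V x) * (V x - pe \<epsilon> * V x' * ge \<epsilon>) * (V x * ge \<beta>)
     = pe \<alpha> * V x * ge \<beta> - pe (\<alpha> @ \<epsilon>) * V x' * ge (\<beta> @ \<epsilon>)"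
  proof -
    have "(pe \<alpha> * V x) * V x * (V x * ge \<beta>) = pe \<alpha> * V x * ge \<beta>"
      using pe_V_ge[OF x, of \<alpha> \<beta>] V_idem[OF x] by (simp add: mult.assoc)
    moreover have "(pe \<alpha> * V x) * (pe \<epsilon> * V x' * ge \<epsilon>) * (V x * ge \<beta>) = pe \<alpha> * (V x * (pe \<epsilon> * V x')) * ge \<epsilon> * V x * ge \<beta>"
      by (simp add: mult.assoc)
    moreover have "\<dots> = pe \<alpha> * pe \<epsilon> * (V x' * ge \<epsilon> * V x) * ge \<beta>"
      using V_pe_same[OF assms(3)] by (simp add: mult.assoc)
    moreover have "\<dots> = pe (\<alpha> @ \<epsilon>) * V x' * ge (\<beta> @ \<epsilon>)"
      using ge_V_same[OF assms(3)] by (simp add: mult.assoc)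
    ultimately show ?thesis by (simp add: right_diff_distrib left_diff_distrib)
  qed
  ultimately show ?thesis by simp
qed

text \<open>These are the monomials that span the corner at w modulo P; those with middle vertex in
  \<open>H\<close> are left out because they lie in P.\<close>

definition loops :: "'a set" where
  "loops = {sc k * (pe \<alpha> * V x * ge \<beta>) | k \<alpha> x \<beta>. awalk w \<alpha> x \<and> awalk w \<beta> x \<and> x \<notin> H}"

lemma loops_A: "c \<in> sumset loops \<Longrightarrow> c \<in> A"
  by (induction rule: sumset.induct) (auto simp: loops_def intro!: A_0 A_add A_sc A_mon)

lemma corner_form:
  assumes "a \<in> A"
  shows "\<exists>c\<in>sumset loops. V w * a * V w - c \<in> P"
  using assms
proof (induction a rule: A_mon_induct)
  case 0
  show ?case using idealD(3)[OF P] by (intro bexI[of _ 0]) (auto intro: sumset_0)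
next
  case (mon k \<alpha> x \<beta> u u')
  have wv: "w \<in> verts E" using w by blast
  have eq: "V w * (sc k * (pe \<alpha> * V x * ge \<beta>)) * V w = sc k * ((V w * (pe \<alpha> * V x)) * ge \<beta> * V w)"
    using sc_V[of w k] by (simp flip: mult.assoc)
  have eq2: "pe \<alpha> * V x * ge \<beta> * V w = pe \<alpha> * (V x * ge \<beta> * V w)" by (simp add: mult.assoc)
  have eq3: "V w * (sc k * (pe \<alpha> * V x * ge \<beta>)) * V w =
     (if w = u \<and> w = u' then sc k * (pe \<alpha> * V x * ge \<beta>) else 0)"
    unfolding eq V_pe[OF mon(1) wv] using ge_V[OF mon(2) wv] eq2 by (auto simp: mult.assoc)
  show ?case
  proof (cases "w = u \<and> w = u' \<and> x \<notin> H")
    case True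
    then have "awalk w \<alpha> x" "awalk w \<beta> x" using mon by auto
    then have "sc k * (pe \<alpha> * V x * ge \<beta>) \<in> loops" unfolding loops_def using True by blast
    then show ?thesis unfolding eq3 using True idealD(3)[OF P] sumset_incl by (intro bexI[of _ "sc k * (pe \<alpha> * V x * ge \<beta>)"]) auto
  next
    case False
    have "x \<in> verts E" using mon by auto
    then have "V w * (sc k * (pe \<alpha> * V x * ge \<beta>)) * V w - 0 \<in> P"
      unfolding eq3 using False mon_in[OF P _ mon] V_P[of x] idealD(3)[OF P] by auto
    then show ?thesis using sumset_0 by blast
  qed
next
  case (add a b)
  then obtain c d where c: "c \<in> sumset loops" "V w * a * V w - c \<in> P"
    and d: "d \<in> sumset loops" "V w * b * V w - d \<in> P" by blast
  have "(V w * a * V w - c) + (V w * b * V w - d) \<in> P" using c d by (intro idealD(4)[OF P])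
  also have "(V w * a * V w - c) + (V w * b * V w - d) = V w * (a + b) * V w - (c + d)"
    by (simp add: algebra_simps)
  finally show ?case using sumset_plus[OF c(1) d(1)] by blast
qed

text \<open>Both factors are lengthened until the inner paths \<beta>\<epsilon> and
  \<alpha>'\<epsilon>' have the same length. They then agree by uniqueness and cancel, and the outer
  paths have the added lengths.\<close>

lemma loop_mult:
  assumes "awalk w \<alpha> x" "awalk w \<beta> x" "x \<notin> H" "awalk w \<alpha>' y" "awalk w \<beta>' y" "y \<notin> H"
  shows "\<exists>\<eta> \<eta>' z. awalk w \<eta> z \<and> awalk w \<eta>' z \<and> z \<notin> H \<and> length \<eta> = length \<alpha> + length \<alpha>' \<and>
    length \<eta>' = length \<beta> + length \<beta>' \<and>
    (pe \<alpha> * V x * ge \<beta>) * (pe \<alpha>' * V y * ge \<beta>') - pe \<eta> * V z * ge \<eta>' \<in> P"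
proof -
  obtain \<epsilon> z where \<epsilon>: "awalk x \<epsilon> z" "z \<notin> H" "length \<epsilon> = length \<alpha>'"
    using extension[OF assms(1,3)] by blast
  obtain \<epsilon>' z' where \<epsilon>': "awalk y \<epsilon>' z'" "z' \<notin> H" "length \<epsilon>' = length \<beta>"
    using extension[OF assms(4,6)] by blast
  have W: "awalk w (\<alpha> @ \<epsilon>) z" "awalk w (\<beta> @ \<epsilon>) z" "awalk w (\<alpha>' @ \<epsilon>') z'" "awalk w (\<beta>' @ \<epsilon>') z'"
    using assms \<epsilon> \<epsilon>' by auto
  have eq: "\<beta> @ \<epsilon> = \<alpha>' @ \<epsilon>'" "z = z'"
    using uniqD[OF W(2,3)] \<epsilon> \<epsilon>' by auto
  have z: "z \<in> verts E" using W by auto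
  let ?m = "pe \<alpha> * V x * ge \<beta>" and ?m' = "pe \<alpha>' * V y * ge \<beta>'"
  let ?n = "pe (\<alpha> @ \<epsilon>) * V z * ge (\<beta> @ \<epsilon>)" and ?n' = "pe (\<alpha>' @ \<epsilon>') * V z' * ge (\<beta>' @ \<epsilon>')"
  have "?m * ?m' - ?n * ?n' \<in> P"
    using assms W by (intro ideal_mult_cong[OF P] monomial_shift \<epsilon> \<epsilon>' A_mon)
  moreover have "?n * ?n' = pe (\<alpha> @ \<epsilon>) * V z * ge (\<beta>' @ \<epsilon>')"
  proof -
    have "?n * ?n' = pe (\<alpha> @ \<epsilon>) * (V z * V z * ge (\<beta> @ \<epsilon>) * (pe (\<beta> @ \<epsilon>) * V z)) * ge (\<beta>' @ \<epsilon>')"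
      unfolding eq(1)[symmetric] eq(2)[symmetric] V_idem[OF z] by (simp only: mult.assoc)
    also have "V z * V z * ge (\<beta> @ \<epsilon>) * (pe (\<beta> @ \<epsilon>) * V z) = V z"
      unfolding V_idem[OF z] by (rule ge_pe[OF W(2)])
    finally show ?thesis .
  qed
  ultimately show ?thesis using W \<epsilon> \<epsilon>' eq
    by (intro exI[of _ "\<alpha> @ \<epsilon>"] exI[of _ "\<beta>' @ \<epsilon>'"] exI[of _ z]) (auto simp del: pe_simps ge_simps)
qed

text \<open>The two paths of a product are determined by their lengths, and these are symmetric in
  the factors.\<close>

lemma loop_comm:
  assumes "awalk w \<alpha> x" "awalk w \<beta> x" "x \<notin> H" "awalk w \<alpha>' y" "awalk w \<beta>' y" "y \<notin> H"
  shows "(pe \<alpha> * V x * ge \<beta>) * (pe \<alpha>' * V y * ge \<beta>') - (pe \<alpha>' * V y * ge \<beta>') * (pe \<alpha> * V x * ge \<beta>) \<in> P"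
proof -
  obtain \<eta> \<eta>' z where 1: "awalk w \<eta> z" "awalk w \<eta>' z" "z \<notin> H" "length \<eta> = length \<alpha> + length \<alpha>'"
    "length \<eta>' = length \<beta> + length \<beta>'" "(pe \<alpha> * V x * ge \<beta>) * (pe \<alpha>' * V y * ge \<beta>') - pe \<eta> * V z * ge \<eta>' \<in> P"
    using loop_mult[OF assms] by blast
  obtain \<theta> \<theta>' z' where 2: "awalk w \<theta> z'" "awalk w \<theta>' z'" "z' \<notin> H" "length \<theta> = length \<alpha>' + length \<alpha>"
    "length \<theta>' = length \<beta>' + length \<beta>" "(pe \<alpha>' * V y * ge \<beta>') * (pe \<alpha> * V x * ge \<beta>) - pe \<theta> * V z' * ge \<theta>' \<in> P"
    using loop_mult[OF assms(4-6,1-3)] by blast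
  have "\<eta> = \<theta> \<and> z = z'" "\<eta>' = \<theta>' \<and> z = z'"
    using uniqD[OF 1(1) 2(1)] uniqD[OF 1(2) 2(2)] 1 2 by auto
  then show ?thesis using idealD(8)[OF P 1(6) 2(6)] by simp
qed

lemma sumset_loops_comm:
  assumes "c \<in> sumset loops" "d \<in> sumset loops"
  shows "c * d - d * c \<in> P"
  using assms(1)
proof induction
  case sumset_0
  show ?case using idealD(3)[OF P] by simp
next
  case (sumset_add c c')
  have "c * d - d * c \<in> P" using assms(2)
  proof induction
    case sumset_0
    show ?case using idealD(3)[OF P] by simp
  next
    case (sumset_add d d')
    obtain k \<alpha> x \<beta> where c: "c = sc k * (pe \<alpha> * V x * ge \<beta>)" "awalk w \<alpha> x" "awalk w \<beta> x" "x \<notin> H"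
      using \<open>c \<in> loops\<close> unfolding loops_def by blast
    obtain l \<alpha>' y \<beta>' where d: "d = sc l * (pe \<alpha>' * V y * ge \<beta>')" "awalk w \<alpha>' y" "awalk w \<beta>' y" "y \<notin> H"
      using sumset_add(1) unfolding loops_def by blast
    let ?m = "pe \<alpha> * V x * ge \<beta>" and ?n = "pe \<alpha>' * V y * ge \<beta>'"
    have A: "?m \<in> A" "?n \<in> A" using c d by (auto intro: A_mon)
    have "sc k * (sc l * (?m * ?n - ?n * ?m)) \<in> P" using c d by (intro idealD(6)[OF P] loop_comm)
    also have "sc k * (sc l * (?m * ?n - ?n * ?m)) = c * d - d * c"
    proof -
      have "c * d = sc k * (?m * sc l) * ?n" unfolding c(1) d(1) by (simp only: mult.assoc)
      also have "\<dots> = sc k * (sc l * (?m * ?n))" unfolding sc_comm[OF A(1)] by (simp only: mult.assoc)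
      finally have 1: "c * d = sc k * (sc l * (?m * ?n))" .
      have "d * c = sc l * (?n * sc k) * ?m" unfolding c(1) d(1) by (simp only: mult.assoc)
      also have "\<dots> = (sc l * sc k) * (?n * ?m)" unfolding sc_comm[OF A(2)] by (simp only: mult.assoc)
      also have "sc l * sc k = sc k * sc l" by (simp add: mult.commute flip: sc_mult)
      finally have 2: "d * c = sc k * (sc l * (?n * ?m))" by (simp only: mult.assoc)
      show ?thesis unfolding 1 2 by (simp add: right_diff_distrib)
    qed
    finally have "(c * d - d * c) + (c * d' - d' * c) \<in> P" using sumset_add by (intro idealD(4)[OF P])
    then show ?case by (simp add: algebra_simps)
  qed
  then have "(c * d - d * c) + (c' * d - d * c') \<in> P" using sumset_add by (intro idealD(4)[OF P])
  then show ?case by (simp add: algebra_simps)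
qed

lemma corner_comm:
  assumes "a \<in> A" "b \<in> A" "V w * a * V w = a" "V w * b * V w = b"
  shows "a * b - b * a \<in> P"
proof -
  obtain c d where c: "c \<in> sumset loops" "a - c \<in> P" and d: "d \<in> sumset loops" "b - d \<in> P"
    using corner_form[OF assms(1)] corner_form[OF assms(2)] assms by auto
  have "a * b - c * d \<in> P" "b * a - d * c \<in> P"
    using c d assms loops_A by (auto intro!: ideal_mult_cong[OF P])
  then have "a * b - c * d - (b * a - d * c) + (c * d - d * c) \<in> P"
    using sumset_loops_comm[OF c(1) d(1)] by (intro idealD(4)[OF P idealD(8)[OF P]])
  then show ?thesis by simp
qed

end

end

section \<open>Primitive ideals satisfy the conditions\<close>

context leavitt_model
begin

text \<open>A simple left module is \<open>A / N\<close>, where \<open>N\<close> is the annihilator of an element \<open>m = v m\<close> for some vertex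
  \<open>v\<close>. The annihilator of the module is then \<open>core N\<close>, so that \<open>N\<close> can replace the module.\<close>

definition maximal_at :: "'a set \<Rightarrow> 'v \<Rightarrow> bool" where
  "maximal_at N v \<longleftrightarrow> lideal N \<and> v \<in> verts E \<and> V v \<notin> N \<and> (\<forall>a\<in>A. a - a * V v \<in> N) \<and>
     (\<forall>y\<in>A. y \<notin> N \<longrightarrow> (\<exists>a\<in>A. V v - a * y \<in> N))"

definition core :: "'a set \<Rightarrow> 'a set" where
  "core N = {x \<in> A. \<forall>a\<in>A. x * a \<in> N}"

text \<open>The elementwise form of primeness suits the arguments below;
  \<open>prime_ideal_R\<close> identifies it with the form for products of ideals.\<close>

definition primep :: "'a set \<Rightarrow> bool" where
  "primep P \<longleftrightarrow> ideal P \<and> P \<noteq> A \<and> (\<forall>x\<in>A. \<forall>y\<in>A. x \<notin> P \<longrightarrow> y \<notin> P \<longrightarrow> (\<exists>a\<in>A. x * a * y \<notin> P))"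

lemma primepD: "primep P \<Longrightarrow> x \<in> A \<Longrightarrow> y \<in> A \<Longrightarrow> x \<notin> P \<Longrightarrow> y \<notin> P \<Longrightarrow> \<exists>a\<in>A. x * a * y \<notin> P"
  and primep_ideal: "primep P \<Longrightarrow> ideal P"
  by (simp_all add: primep_def)

definition primitive_conds :: "'a set \<Rightarrow> bool" where
  "primitive_conds P \<longleftrightarrow> (let H = vts P; B = breaking_vertices E H in
     (primep P \<and> \<not> graded P) \<or>
     (graded P \<and> primep P \<and> (\<exists>u\<in>B. P = IHS H (B - {u}))) \<or>
     (graded P \<and> P = IHS H B \<and> MT3 E (verts E - H) \<and> condition_L E (verts E - H) \<and>
       countable_separation E (verts E - H)))"

text \<open>If u a w is outside P, some monomial of a runs from u to a vertex z outside P and back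
  along a ghost path to w; this z is a common descendant.\<close>

lemma prime_MT3:
  assumes P: "primep P"
  shows "MT3 E (verts E - vts P)"
proof -
  have I: "ideal P" using P by (simp add: primep_def)
  have *: "V u * x * V w \<in> P \<or> (\<exists>z\<in>verts E - vts P. reachable E u z \<and> reachable E w z)"
    if "x \<in> A" "u \<in> verts E" "w \<in> verts E" for x u w
    using that(1)
  proof (induction x rule: A_mon_induct)
    case (mon k \<alpha> z \<beta> u' w')
    have z: "z \<in> verts E" using mon by auto
    have eq: "V u * (sc k * (pe \<alpha> * V z * ge \<beta>)) * V w = sc k * ((V u * (pe \<alpha> * V z)) * ge \<beta> * V w)"
      using sc_V[of u k] by (simp flip: mult.assoc)
    show ?case
    proof (cases "u = u' \<and> w = w'")
      case True
      then have r: "reachable E u z" "reachable E w z"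
        using mon reachable_awalkI by auto
      show ?thesis
      proof (cases "z \<in> vts P")
        case zP: True
        then have "sc k * (pe \<alpha> * V z * ge \<beta>) \<in> P" using mon_in[OF I _ mon] by (auto simp: vts_def)
        then have "V u * (sc k * (pe \<alpha> * V z * ge \<beta>)) * V w \<in> P"
          using that by (intro ideal_sandwich[OF I] A_V)
        then show ?thesis ..
      qed (use r z in blast)
    next
      case False
      have "V u * (pe \<alpha> * V z) * ge \<beta> * V w = 0"
      proof (cases "u = u'")
        case True
        have "V u * (pe \<alpha> * V z) * ge \<beta> * V w = V u * pe \<alpha> * (V z * ge \<beta> * V w)" by (simp add: mult.assoc)
        then show ?thesis using ge_V[OF mon(2) that(3)] True False by simp
      qed (simp add: V_pe[OF mon(1) that(2)])
      then show ?thesis unfolding eq using idealD(3)[OF I] by simp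
    qed
  next
    case (add x y)
    show ?case using idealD(4)[OF I, of "V u * x * V w" "V u * y * V w"] add
      by (auto simp: distrib_left distrib_right)
  qed (use idealD(3)[OF I] in simp)
  show ?thesis unfolding MT3_def
  proof (intro ballI)
    fix u w assume u: "u \<in> verts E - vts P" and w: "w \<in> verts E - vts P"
    then have "V u \<in> A" "V w \<in> A" "V u \<notin> P" "V w \<notin> P" by (auto simp: vts_def A_V)
    then obtain a where "a \<in> A" "V u * a * V w \<notin> P" using P unfolding primep_def by blast
    then show "\<exists>z\<in>verts E - vts P. reachable E u z \<and> reachable E w z" using *[of a u w] u w by blast
  qed
qed

text \<open>A path that starts with e is annihilated by the left factor or ends up in P, since e
  either does not start at u, or is one of the subtracted edges, or has its range in P. Ghost paths
  behave dually. Modulo P only vertices between the two idempotents survive.\<close>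

lemma brk_corner:
  assumes P: "ideal P" and u: "u \<in> breaking_vertices E (vts P)" and w: "w \<in> breaking_vertices E (vts P)"
    and "x \<in> A"
  shows "\<exists>k. brk (vts P) u * x * brk (vts P) w - (if u = w then sc k * brk (vts P) u else 0) \<in> P"
  using \<open>x \<in> A\<close>
proof (induction x rule: A_mon_induct)
  case 0
  show ?case using idealD(3)[OF P] by (intro exI[of _ 0]) (simp add: sc_0)
next
  case (mon k \<alpha> z \<beta> u' w')
  let ?b = "brk (vts P) u" and ?c = "brk (vts P) w"
  have z: "z \<in> verts E" using mon by auto
  note bA = brk_A[OF u] and cA = brk_A[OF w]
  have eq: "?b * (sc k * (pe \<alpha> * V z * ge \<beta>)) * ?c = sc k * ((?b * (pe \<alpha> * V z)) * (V z * ge \<beta> * ?c))"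
    using sc_comm[OF bA] pe_V_ge[OF z, of \<alpha> \<beta>] by (simp add: mult.assoc[symmetric])
  have left: "?b * (pe \<alpha> * V z) \<in> P" if ne: "\<alpha> \<noteq> []"
  proof -
    obtain e \<alpha>' where \<alpha>: "\<alpha> = e # \<alpha>'" using ne by (cases \<alpha>) auto
    have e: "e \<in> arcs E" "awalk (head E e) \<alpha>' z" using mon \<alpha> by (auto simp: awalk_Cons_iff)
    have "?b * s e \<in> P"
    proof (cases "tail E e = u")
      case True
      show ?thesis
      proof (cases "e \<in> out (vts P) u")
        case True then show ?thesis using brk_s[OF u] idealD(3)[OF P] by simp
      next
        case False
        then have "V (head E e) \<in> P" using e True by (auto simp: out_def vts_def)
        then show ?thesis using s_in[OF P] e bA by (intro idealD(5)[OF P])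
      qed
    next
      case False
      have "?b * s e = ?b * V (tail E e) * s e" using e by (simp add: tail_s mult.assoc)
      then show ?thesis using brk_V[OF u, of "tail E e"] False e idealD(3)[OF P] by simp
    qed
    then have "?b * s e * (pe \<alpha>' * V z) \<in> P" by (rule idealD(9)[OF P A_pe[OF e(2)]])
    then show ?thesis by (simp add: \<alpha> mult.assoc)
  qed
  have right: "V z * ge \<beta> * ?c \<in> P" if ne: "\<beta> \<noteq> []"
  proof -
    obtain e \<beta>' where \<beta>: "\<beta> = e # \<beta>'" using ne by (cases \<beta>) auto
    have e: "e \<in> arcs E" "awalk (head E e) \<beta>' z" using mon \<beta> by (auto simp: awalk_Cons_iff)
    have "g e * ?c \<in> P"
    proof (cases "tail E e = w")
      case True
      show ?thesis
      proof (cases "e \<in> out (vts P) w")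
        case True then show ?thesis using g_brk[OF w] idealD(3)[OF P] by simp
      next
        case False
        then have "V (head E e) \<in> P" using e True by (auto simp: out_def vts_def)
        then show ?thesis using g_in[OF P] e cA by (intro idealD(9)[OF P])
      qed
    next
      case False
      have "g e * ?c = g e * (V (tail E e) * ?c)" using e by (simp add: g_tail flip: mult.assoc)
      then show ?thesis using V_brk[OF w, of "tail E e"] False e idealD(3)[OF P] by simp
    qed
    then have "V z * ge \<beta>' * (g e * ?c) \<in> P" by (rule idealD(5)[OF P A_ge[OF e(2)]])
    then show ?thesis by (simp add: \<beta> mult.assoc)
  qed
  have A1: "?b * (pe \<alpha> * V z) \<in> A" "V z * ge \<beta> * ?c \<in> A"
    using bA cA mon by (auto intro!: A_mult[OF bA] A_mult[OF _ cA] A_pe A_ge)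
  show ?case
  proof (cases "\<alpha> = [] \<and> \<beta> = []")
    case True
    have "?b * V z * (V z * ?c) = (if z = u then ?b else 0) * (if z = w then ?c else 0)"
      by (simp only: brk_V[OF u z] V_brk[OF w z])
    also have "\<dots> = (if u = w \<and> z = u then ?b else 0)"
      by (cases "z = u"; cases "z = w") (simp_all only: brk_idem[OF u] brk_idem[OF w] if_True if_False
          mult_zero_left mult_zero_right simp_thms)
    finally have "?b * V z * (V z * ?c) = (if u = w \<and> z = u then ?b else 0)" .
    then have "?b * (sc k * (pe \<alpha> * V z * ge \<beta>)) * ?c = (if u = w then sc (if z = u then k else 0) * ?b else 0)"
      unfolding eq using True by (simp add: sc_0)
    then show ?thesis using idealD(3)[OF P] by (intro exI[of _ "if z = u then k else 0"]) simp
  next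
    case False
    then have "(?b * (pe \<alpha> * V z)) * (V z * ge \<beta> * ?c) \<in> P"
      using left right A1 idealD(5,9)[OF P] by blast
    from idealD(6)[OF P this]
    have "?b * (sc k * (pe \<alpha> * V z * ge \<beta>)) * ?c - (if u = w then sc 0 * ?b else 0) \<in> P"
      unfolding eq sc_0 mult_zero_left if_cancel diff_zero .
    then show ?thesis by blast
  qed
next
  case (add x y)
  obtain k l where kl: "brk (vts P) u * x * brk (vts P) w - (if u = w then sc k * brk (vts P) u else 0) \<in> P"
    "brk (vts P) u * y * brk (vts P) w - (if u = w then sc l * brk (vts P) u else 0) \<in> P"
    using add by blast
  have "brk (vts P) u * (x + y) * brk (vts P) w - (if u = w then sc (k + l) * brk (vts P) u else 0) \<in> P"
    using idealD(4)[OF P kl] by (auto simp: algebra_simps sc_add split: if_splits)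
  then show ?case by blast
qed

text \<open>No outcome of the reduction is possible: \<open>S\<close> already collects every
  breaking vertex whose idempotent is in P, and a comonic element would put its vertex into P
  through the component of degree zero.\<close>

lemma graded_prime_form:
  assumes P: "ideal P" "graded P"
  shows "P = IHS (vts P) {b \<in> breaking_vertices E (vts P). brk (vts P) b \<in> P}"
proof (rule ccontr)
  let ?H = "vts P"
  let ?S = "{b \<in> breaking_vertices E ?H. brk ?H b \<in> P}"
  assume ne: "P \<noteq> IHS ?H ?S"
  have H: "hereditary ?H" by (rule vts_hereditary[OF P(1)])
  have sub: "IHS ?H ?S \<subseteq> P" by (rule IHS_least[OF P(1)]) (auto simp: vts_def)
  have vJ: "vts (IHS ?H ?S) \<subseteq> ?H" using sub by (auto simp: vts_def)
  have V: "V w \<notin> P" if "w \<in> verts E - ?H" for w using that by (auto simp: vts_def)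
  show False
  proof (rule reduction[OF H _ vJ P(1) sub])
    show "IHS ?H ?S \<noteq> P" using ne by simp
    fix w D y assume w: "w \<in> verts E - ?H" "comonic w D y" "y \<in> P"
    obtain k where k: "k \<noteq> 0" "gr 0 y = sc k * V w" using comonic_gr0[OF w(2)] w(1) by blast
    have "gr 0 y \<in> P" using P(2) w(3) by (simp add: graded_def)
    then show False using V[OF w(1)] sc_cancel[OF P(1) k(1)] k(2) by simp
  qed (use V in auto)
qed

section \<open>Annihilators of simple modules A / N\<close>

context
  fixes N v assumes N: "maximal_at N v"
begin

lemma N_lideal: "lideal N" and v_verts: "v \<in> verts E" and v_N: "V v \<notin> N"
  and N_v: "a \<in> A \<Longrightarrow> a - a * V v \<in> N"
  and N_max: "y \<in> A \<Longrightarrow> y \<notin> N \<Longrightarrow> \<exists>a\<in>A. V v - a * y \<in> N"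
  using N by (auto simp: maximal_at_def)

text \<open>In the module A / N this says that a nonzero class generates the module, which follows
  because it reaches the class of v.\<close>

lemma N_factor:
  assumes "a \<in> A" "y \<in> A" "y \<notin> N"
  shows "\<exists>b\<in>A. a - b * y \<in> N"
proof -
  obtain b where b: "b \<in> A" "V v - b * y \<in> N" using N_max assms by blast
  have "a * (V v - b * y) \<in> N" using b assms by (intro lidealD(5)[OF N_lideal])
  then have "a - a * V v + a * (V v - b * y) \<in> N" using N_v[OF assms(1)] by (intro lidealD(4)[OF N_lideal])
  then have "a - (a * b) * y \<in> N" by (simp add: right_diff_distrib mult.assoc)
  then show ?thesis using A_mult[OF assms(1) b(1)] by blast
qed

lemma core_ideal: "ideal (core N)"
  unfolding ideal_def lideal_def
proof (intro conjI ballI)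
  fix a x assume a: "a \<in> A" and x: "x \<in> core N"
  show "a * x \<in> core N" "x * a \<in> core N"
    using a x lidealD(5)[OF N_lideal] by (auto simp: core_def A_mult mult.assoc)
qed (auto simp: core_def A_0 A_add distrib_right lidealD[OF N_lideal])

lemma core_sub: "core N \<subseteq> N"
proof
  fix x assume x: "x \<in> core N"
  then obtain \<epsilon> where "\<epsilon> \<in> A" "x * \<epsilon> = x" using local_unit[of x] by (auto simp: core_def)
  then show "x \<in> N" using x by (force simp: core_def)
qed

lemma core_not: "x \<in> A \<Longrightarrow> x \<notin> core N \<Longrightarrow> \<exists>a\<in>A. x * a \<notin> N"
  by (auto simp: core_def)

lemma core_prime: "primep (core N)"
  unfolding primep_def
proof (intro conjI core_ideal ballI impI)
  show "core N \<noteq> A" using core_sub v_N A_V[OF v_verts] by blast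
next
  fix x y assume x: "x \<in> A" "x \<notin> core N" and y: "y \<in> A" "y \<notin> core N"
  obtain a where a: "a \<in> A" "x * a \<notin> N" using core_not x by blast
  obtain c where c: "c \<in> A" "y * c \<notin> N" using core_not y by blast
  obtain b where b: "b \<in> A" "a - b * (y * c) \<in> N" using N_factor[OF a(1) A_mult[OF y(1) c(1)] c(2)] by blast
  have "x * (a - b * (y * c)) \<in> N" using b x by (intro lidealD(5)[OF N_lideal])
  then have "x * a - x * b * y * c \<in> N" by (simp add: right_diff_distrib mult.assoc)
  then have "x * b * y * c \<notin> N" using a(2) lideal_cong[OF N_lideal] by blast
  then have "x * b * y \<notin> core N" using c by (auto simp: core_def)
  then show "\<exists>a\<in>A. x * a * y \<notin> core N" using b by blast
qed

text \<open>The sums of these elements contain A u A. The ghost path is absorbed into the factor c;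
  what matters later is that the path \<alpha> ends at a descendant of u.\<close>

definition through :: "'v \<Rightarrow> 'a set" where
  "through u = {pe \<alpha> * V x * c | \<alpha> x c. (\<exists>u'. awalk u' \<alpha> x) \<and> reachable E u x \<and> c \<in> A}"

lemma through_mult: "a \<in> A \<Longrightarrow> u \<in> verts E \<Longrightarrow> c \<in> A \<Longrightarrow> a * V u * c \<in> sumset (through u)"
proof (induction a rule: A_mon_induct)
  case (mon k \<alpha> x \<beta> u1 u2)
  show ?case
  proof (cases "u = u2")
    case True
    then have r: "reachable E u x" using mon reachable_awalkI by auto
    have x: "x \<in> verts E" using mon by auto
    have "V x * ge \<beta> * V u \<in> A" using mon(3) by (intro A_mult[OF A_ge[OF mon(2)] A_V])
    then have c: "sc k * (V x * ge \<beta> * V u * c) \<in> A" using mon by (intro A_sc A_mult[of _ c])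
    have "sc k * (pe \<alpha> * V x * ge \<beta>) * V u * c = (sc k * (pe \<alpha> * V x)) * (V x * ge \<beta> * V u * c)"
      using pe_V_ge[OF x, of \<alpha> \<beta>] by (simp add: mult.assoc)
    also have "\<dots> = pe \<alpha> * V x * (sc k * (V x * ge \<beta> * V u * c))"
      using sc_comm[OF A_pe[OF mon(1)], of k, symmetric] by (simp add: mult.assoc)
    finally have "sc k * (pe \<alpha> * V x * ge \<beta>) * V u * c \<in> through u"
      unfolding through_def using mon(1) r c by blast
    then show ?thesis by (rule sumset_incl)
  next
    case False
    have "sc k * (pe \<alpha> * V x * ge \<beta>) * V u * c = sc k * (pe \<alpha> * (V x * ge \<beta> * V u)) * c" by (simp add: mult.assoc)
    then show ?thesis using ge_V[OF mon(2), of u] mon False sumset_0 by simp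
  qed
qed (auto simp: distrib_right intro: sumset_0 sumset_plus)

text \<open>As u does not annihilate A / N, the elements of A u A represent every class modulo
  \<open>N\<close>.\<close>

lemma N_through:
  assumes "y \<in> A" "u \<in> verts E - vts (core N)"
  shows "\<exists>r\<in>sumset (through u). y - r \<in> N"
proof -
  have "V u \<in> A" "V u \<notin> core N" using assms by (auto simp: vts_def A_V)
  then obtain a where a: "a \<in> A" "V u * a \<notin> N" using core_not by blast
  obtain b where b: "b \<in> A" "y - b * (V u * a) \<in> N"
    using N_factor[OF assms(1) A_mult a(2)] \<open>V u \<in> A\<close> a by blast
  then show ?thesis using through_mult[OF b(1) _ a(1), of u] assms by (auto simp: mult.assoc)
qed

lemma through_split:
  assumes "r \<in> sumset (through u)" "w \<in> verts E" "\<not> reachable E u w"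
  shows "\<exists>F. finite F \<and> F \<subseteq> out_arcs E w \<and>
    (\<forall>F'. finite F' \<longrightarrow> F \<subseteq> F' \<longrightarrow> F' \<subseteq> out_arcs E w \<longrightarrow> V w * r = (\<Sum>e\<in>F'. s e * g e * r))"
  using assms(1)
proof induction
  case sumset_0
  then show ?case by (intro exI[of _ "{}"]) simp
next
  case (sumset_add x r)
  obtain F where F: "finite F" "F \<subseteq> out_arcs E w"
    "\<And>F'. finite F' \<Longrightarrow> F \<subseteq> F' \<Longrightarrow> F' \<subseteq> out_arcs E w \<Longrightarrow> V w * r = (\<Sum>e\<in>F'. s e * g e * r)"
    using sumset_add by blast
  obtain \<alpha> y c u' where x: "x = pe \<alpha> * V y * c" "awalk u' \<alpha> y" "reachable E u y" "c \<in> A"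
    using sumset_add(1) unfolding through_def by blast
  have wy: "w \<noteq> y" using x assms by auto
  show ?case
  proof (cases "u' = w")
    case False
    have 0: "V w * x = 0"
      using V_pe[OF x(2) assms(2)] False by (simp add: x(1) flip: mult.assoc)
    have "s e * g e * x = 0" if "e \<in> out_arcs E w" for e
    proof -
      have "s e * g e * x = s e * g e * (V w * x)" using that g_tail[of e] by (auto simp: mult.assoc simp flip: mult.assoc[of "g e"])
      then show ?thesis using 0 by simp
    qed
    then have "V w * (x + r) = (\<Sum>e\<in>F'. s e * g e * (x + r))"
      if "finite F'" "F \<subseteq> F'" "F' \<subseteq> out_arcs E w" for F'
      using F(3)[OF that] 0 that(3) by (auto simp: distrib_left subset_iff intro!: sum.cong)
    then show ?thesis using F(1,2) by blast
  next
    case True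
    then obtain e \<alpha>' where \<alpha>: "\<alpha> = e # \<alpha>'" using x wy by (cases \<alpha>) (auto simp: awalk_Nil_iff)
    then have e: "e \<in> arcs E" "tail E e = w" using x True by (auto simp: awalk_Cons_iff)
    have eq: "V w * (x + r) = (\<Sum>f\<in>F'. s f * g f * (x + r))"
      if F': "finite F'" "insert e F \<subseteq> F'" "F' \<subseteq> out_arcs E w" for F'
    proof -
      have "s f * g f * x = (if f = e then x else 0)" if "f \<in> F'" for f
      proof -
        have "f \<in> arcs E" using that F' by auto
        have gs: "g f * s e = (if f = e then V (head E e) else 0)"
          using \<open>f \<in> arcs E\<close> e by (simp add: g_s g_s_orth)
        have "s f * g f * x = s f * ((g f * s e) * (pe \<alpha>' * V y * c))" by (simp add: x(1) \<alpha> mult.assoc)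
        also have "\<dots> = (if f = e then s f * V (head E e) * (pe \<alpha>' * V y * c) else 0)"
          unfolding gs by (simp add: mult.assoc)
        also have "\<dots> = (if f = e then x else 0)" using e by (auto simp: s_head x(1) \<alpha> mult.assoc)
        finally show ?thesis .
      qed
      then have "(\<Sum>f\<in>F'. s f * g f * x) = x" using F' by simp
      moreover have "V w * x = x" using V_pe_same[OF x(2)] True by (simp add: x(1) flip: mult.assoc)
      moreover have "V w * r = (\<Sum>f\<in>F'. s f * g f * r)" using F' by (intro F(3)) auto
      ultimately show ?thesis by (simp add: distrib_left sum.distrib)
    qed
    then show ?thesis using F(1,2) e by (intro exI[of _ "insert e F"]) auto
  qed
qed

text \<open>The walks \<open>\<beta>\<close> from \<open>v\<close> whose ghost does not annihilate the class of \<open>v\<close> modulo \<open>N\<close> form a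
  tree. If no single vertex separates, the tree has walks of every length, and the range of one
  walk of each length yields a countable separating set.\<close>

definition live :: "'e list \<Rightarrow> bool" where
  "live \<beta> \<longleftrightarrow> (\<exists>x. awalk v \<beta> x \<and> V x * ge \<beta> \<notin> N)"

lemma live_end: "live \<beta> \<Longrightarrow> awalk v \<beta> (awlast v \<beta>) \<and> V (awlast v \<beta>) * ge \<beta> \<notin> N \<and>
   awlast v \<beta> \<in> verts E - vts (core N)"
proof -
  assume "live \<beta>"
  then obtain x where x: "awalk v \<beta> x" "V x * ge \<beta> \<notin> N" by (auto simp: live_def)
  have "x \<notin> vts (core N)"
  proof
    assume "x \<in> vts (core N)"
    then have "V x * (V x * ge \<beta>) \<in> core N"
      using A_ge[OF x(1)] by (intro idealD(9)[OF core_ideal]) (auto simp: vts_def)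
    moreover have "V x * (V x * ge \<beta>) = V x * ge \<beta>"
      using V_idem[of x] x(1) by (auto simp flip: mult.assoc)
    ultimately have "V x * ge \<beta> \<in> N" using core_sub by auto
    then show False using x by simp
  qed
  moreover have "x \<in> verts E" using x(1) by auto
  ultimately show ?thesis using x by auto
qed

text \<open>Some u outside P does not reach the end w of \<beta>. Representing the class of the
  ghost of \<beta> by an element r of A u A, w r is a finite sum of terms
  \<open>s e * g e * r\<close>, and one of them is nonzero modulo \<open>N\<close>.\<close>

lemma live_extend:
  assumes "live \<beta>" "\<not> (\<forall>u\<in>verts E - vts (core N). reachable E u (awlast v \<beta>))"
  shows "\<exists>e. live (\<beta> @ [e])"
proof -
  let ?w = "awlast v \<beta>"
  define m where "m = V ?w * ge \<beta>"
  note w = live_end[OF assms(1)]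
  have wv: "?w \<in> verts E" using w by blast
  have m: "m \<in> A" "m \<notin> N" "V ?w * m = m"
    unfolding m_def using w A_ge V_idem[OF wv] by (auto simp flip: mult.assoc)
  obtain u where u: "u \<in> verts E - vts (core N)" "\<not> reachable E u ?w" using assms(2) by blast
  obtain r where r: "r \<in> sumset (through u)" "m - r \<in> N" using N_through[OF m(1) u(1)] by blast
  obtain F where F: "finite F" "F \<subseteq> out_arcs E ?w" "V ?w * r = (\<Sum>e\<in>F. s e * g e * r)"
    using through_split[OF r(1) wv u(2)] by blast
  have "V ?w * (m - r) \<in> N" using r wv by (intro lidealD(5)[OF N_lideal] A_V)
  then have "V ?w * r \<notin> N" using m lideal_cong[OF N_lideal, of m "V ?w * r"] by (simp add: right_diff_distrib)
  then have ne: "(\<Sum>e\<in>F. s e * g e * r) \<notin> N" unfolding F(3) .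
  obtain e where e: "e \<in> F" "s e * g e * r \<notin> N"
  proof (rule ccontr)
    assume *: "\<not> thesis"
    have "(\<Sum>e\<in>F. s e * g e * r) \<in> N"
      by (rule lideal_sum[OF N_lideal]) (use * that in blast)
    with ne show False ..
  qed
  have eE: "e \<in> arcs E" "tail E e = ?w" using e F by auto
  have "s e * g e * (m - r) \<in> N" using r eE by (intro lidealD(5)[OF N_lideal] A_mult A_s A_g)
  then have "s e * (g e * m) \<notin> N"
    using e(2) lideal_cong[OF N_lideal, of "s e * g e * m" "s e * g e * r"] by (simp add: right_diff_distrib mult.assoc)
  then have "g e * m \<notin> N" using lidealD(5)[OF N_lideal A_s[OF eE(1)]] by blast
  moreover have "g e * m = V (head E e) * ge (\<beta> @ [e])"
    unfolding m_def using eE g_tail[OF eE(1)] head_g[OF eE(1)] by (simp flip: mult.assoc)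
  moreover have "awalk v (\<beta> @ [e]) (head E e)" using w eE by (auto simp: awalk_simps)
  ultimately show ?thesis unfolding live_def by auto
qed

text \<open>For u outside P the class of v is represented by a finite sum r of terms \<alpha> z c
  with u above z. If \<open>b n\<close> is at least as long as all these \<alpha>, its ghost can be
  nonzero on r only if \<open>b n\<close> extends one of them that starts at v, and then u reaches
  the end of \<open>b n\<close>.\<close>

lemma core_countable_separation: "countable_separation E (verts E - vts (core N))"
proof (cases "\<exists>w\<in>verts E - vts (core N). \<forall>u\<in>verts E - vts (core N). reachable E u w")
  case True
  then obtain w where "w \<in> verts E - vts (core N)" "\<forall>u\<in>verts E - vts (core N). reachable E u w" by blast
  then show ?thesis unfolding countable_separation_def by (intro exI[of _ "{w}"]) auto
next
  case False
  have "\<exists>\<beta>. live \<beta> \<and> length \<beta> = n" for n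
  proof (induction n)
    case 0
    then show ?case using v_verts v_N by (intro exI[of _ "[]"]) (auto simp: live_def awalk_Nil_iff)
  next
    case (Suc n)
    then obtain \<beta> where \<beta>: "live \<beta>" "length \<beta> = n" by blast
    then obtain e where "live (\<beta> @ [e])" using live_extend[OF \<beta>(1)] live_end[OF \<beta>(1)] False by blast
    then show ?case using \<beta> by (intro exI[of _ "\<beta> @ [e]"]) simp
  qed
  then obtain b where b: "\<And>n. live (b n)" "\<And>n. length (b n) = n" by metis
  define C where "C = range (\<lambda>n. awlast v (b n))"
  have "\<exists>x\<in>C. reachable E u x" if u: "u \<in> verts E - vts (core N)" for u
  proof -
    obtain r where r: "r \<in> sumset (through u)" "V v - r \<in> N" using N_through[OF A_V[OF v_verts] u] by blast
    have ex: "\<exists>n0. \<forall>n\<ge>n0. \<forall>x. awalk v (b n) x \<longrightarrow> reachable E u x \<or> V x * ge (b n) * r = 0"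
      using r(1)
    proof induction
      case (sumset_add y r)
      obtain n0 where n0: "\<And>n x. n \<ge> n0 \<Longrightarrow> awalk v (b n) x \<Longrightarrow> reachable E u x \<or> V x * ge (b n) * r = 0"
        using sumset_add by blast
      obtain \<alpha> z c u' where y: "y = pe \<alpha> * V z * c" "awalk u' \<alpha> z" "reachable E u z" "c \<in> A"
        using sumset_add(1) unfolding through_def by blast
      have yn: "reachable E u x \<or> V x * ge (b n) * y = 0"
        if n: "n \<ge> length \<alpha>" and x: "awalk v (b n) x" for n x
      proof (cases "V x * ge (b n) * (pe \<alpha> * V z) = 0")
        case True
        then show ?thesis by (simp add: y(1) flip: mult.assoc)
      next
        case False
        have "u' = v"
        proof (rule ccontr)
          assume "u' \<noteq> v"
          then have "V v * (pe \<alpha> * V z) = 0" using V_pe[OF y(2) v_verts] by simp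
          moreover have "V x * ge (b n) * (pe \<alpha> * V z) = V x * ge (b n) * V v * (pe \<alpha> * V z)"
            unfolding ge_V_same[OF x] ..
          ultimately show False using False by (simp add: mult.assoc)
        qed
        have "\<not> ((\<nexists>\<gamma>. \<alpha> = b n @ \<gamma>) \<and> (\<nexists>\<gamma>. b n = \<alpha> @ \<gamma>))"
        proof
          assume "(\<nexists>\<gamma>. \<alpha> = b n @ \<gamma>) \<and> (\<nexists>\<gamma>. b n = \<alpha> @ \<gamma>)"
          then have "ge (b n) * pe \<alpha> = 0" using ge_pe_incomparable[of v "b n" x \<alpha> z] x y(2) \<open>u' = v\<close> by blast
          then have "V x * (ge (b n) * pe \<alpha>) * V z = 0" by simp
          then show False using False by (simp add: mult.assoc)
        qed
        then have "\<exists>\<gamma>. b n = \<alpha> @ \<gamma>" using n b(2)[of n] by auto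
        then obtain \<gamma> where \<gamma>: "b n = \<alpha> @ \<gamma>" by blast
        then have "awalk (awlast v \<alpha>) \<gamma> x" using x by simp
        then have "awalk z \<gamma> x" using y(2) \<open>u' = v\<close> by simp
        then show ?thesis using reachable_awalkI reachable_trans y(3) by blast
      qed
      have "reachable E u x \<or> V x * ge (b n) * (y + r) = 0"
        if "n \<ge> max n0 (length \<alpha>)" "awalk v (b n) x" for n x
        using n0[of n x] yn[of n x] that by (auto simp: distrib_left)
      then show ?case by blast
    qed simp
    then obtain n where n: "\<And>x. awalk v (b n) x \<Longrightarrow> reachable E u x \<or> V x * ge (b n) * r = 0" by blast
    let ?x = "awlast v (b n)"
    note x = live_end[OF b(1)[of n]]
    have "V ?x * ge (b n) * (V v - r) \<in> N"
      using A_ge r x by (intro lidealD(5)[OF N_lideal]) auto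
    then have "V ?x * ge (b n) - V ?x * ge (b n) * r \<in> N"
      using ge_V_same[of v "b n" ?x] x by (simp add: right_diff_distrib)
    then have "V ?x * ge (b n) * r \<noteq> 0" using x by auto
    then have "reachable E u ?x" using n[of ?x] x by blast
    then show ?thesis unfolding C_def by blast
  qed
  moreover have "C \<subseteq> verts E - vts (core N)" unfolding C_def using live_end[OF b(1)] by blast
  moreover have "countable C" unfolding C_def by simp
  ultimately show ?thesis unfolding countable_separation_def by blast
qed

text \<open>Otherwise the corner at a cycle \<open>\<gamma>\<close> without exits is commutative modulo the primitive ideal, so
  \<open>V w + pe \<gamma>\<close> is invertible in it, whereas the inverse of \<open>1 + x\<close> is no Laurent polynomial.\<close>

lemma core_condition_L:
  assumes gr: "graded (core N)" and B: "\<forall>u\<in>breaking_vertices E (vts (core N)). brk (vts (core N)) u \<in> core N"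
  shows "condition_L E (verts E - vts (core N))"
proof (rule ccontr)
  let ?P = "core N"
  let ?H = "vts ?P"
  note P = core_ideal
  assume "\<not> ?thesis"
  then obtain w \<gamma> where w: "w \<in> verts E - ?H" "unique_walks ?H w" and \<gamma>: "awalk w \<gamma> w" "\<gamma> \<noteq> []"
    using no_exit_cycle[OF vts_hereditary[OF P]] by blast
  have wv: "w \<in> verts E" and wP: "V w \<notin> ?P" using w by (auto simp: vts_def)
  note comm = corner_comm[OF P refl B w \<gamma>]
  define d where "d = int (length \<gamma>)"
  have d: "d > 0" using \<gamma>(2) by (simp add: d_def)
  define y where "y = pe \<gamma> * V w"
  define y' where "y' = V w * ge \<gamma>"
  have y: "y \<in> A" "y' \<in> A" "homog d y" "V w * y = y" "y * V w = y"
    unfolding y_def y'_def d_def using A_pe A_ge homog_pe \<gamma> V_pe_same[OF \<gamma>(1)] V_idem[OF wv] by (auto simp: mult.assoc)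
  \<comment> \<open>Modulo P the cycle is invertible in the corner; below this allows y to be
    cancelled on the right.\<close>
  have yy: "V w - y * y' \<in> ?P"
    using vertex_expand[OF P refl B w \<gamma> \<gamma>(1) \<gamma>(1)] w pe_V_ge[OF wv, of \<gamma> \<gamma>] by (simp add: y_def y'_def)
  define t where "t = V w + y"
  have t: "t \<in> A" "V w * t = t" "t * V w = t"
    unfolding t_def using y V_idem[OF wv] A_V[OF wv] by (auto simp: distrib_left distrib_right intro: A_add)
  have "gr 0 t = V w"
    unfolding t_def using gr_homog[OF homog_V[OF wv]] gr_homog[OF y(3)] d A_V[OF wv] y(1) by (simp add: gr_add)
  then have "t \<notin> ?P" using gr wP unfolding graded_def by metis
  then obtain a0 where a0: "a0 \<in> A" "t * a0 \<notin> N" using core_not t by blast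
  \<comment> \<open>The class of y1 is not annihilated by t, so some b brings t y1 back to y1 in A /
    N. Cutting b down to the corner gives q, and r = w - q t annihilates the class of y1.\<close>
  define y1 where "y1 = V w * a0"
  have y1: "y1 \<in> A" "V w * y1 = y1" "t * y1 \<notin> N"
    unfolding y1_def using a0 t V_idem[OF wv] A_V[OF wv] by (auto simp flip: mult.assoc intro: A_mult)
  then have y1N: "y1 \<notin> N" using lidealD(5)[OF N_lideal t(1)] by blast
  obtain b where b: "b \<in> A" "y1 - b * (t * y1) \<in> N"
    using N_factor[OF y1(1) A_mult[OF t(1) y1(1)] y1(3)] by blast
  define q where "q = V w * b * V w"
  have q: "q \<in> A" "V w * q = q" "q * V w = q"
    unfolding q_def using b A_V[OF wv] V_idem[OF wv] by (auto simp: A_mult mult.assoc) (simp flip: mult.assoc)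
  define r where "r = V w - q * t"
  have r: "r \<in> A" "V w * r * V w = r"
    unfolding r_def using q t A_V[OF wv] V_idem[OF wv]
    by (auto simp: A_diff A_mult left_diff_distrib right_diff_distrib mult.assoc) (simp flip: mult.assoc)
  have r_V: "r * V w = r"
    unfolding r_def using V_idem[OF wv] t(3) by (simp add: left_diff_distrib mult.assoc)
  have "V w * (y1 - b * (t * y1)) \<in> N" using b A_V[OF wv] by (intro lidealD(5)[OF N_lideal])
  also have "V w * (y1 - b * (t * y1)) = V w * y1 - V w * b * (V w * t) * y1"
    unfolding t(2) by (simp add: right_diff_distrib mult.assoc)
  also have "\<dots> = r * y1" unfolding r_def q_def by (simp add: left_diff_distrib mult.assoc)
  finally have ry1: "r * y1 \<in> N" .
  \<comment> \<open>The class of y1 generates A / N, and r commutes modulo P with the corner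
    elements that move it, so r annihilates the whole module.\<close>
  have "r * a \<in> N" if a: "a \<in> A" for a
  proof -
    obtain b' where b': "b' \<in> A" "a - b' * y1 \<in> N" using N_factor[OF a y1(1) y1N] by blast
    define q' where "q' = V w * b' * V w"
    have q': "q' \<in> A" "V w * q' * V w = q'"
      unfolding q'_def using b' A_V[OF wv] V_idem[OF wv] by (auto simp: A_mult mult.assoc) (simp flip: mult.assoc)
    have "(r * q' - q' * r) * y1 \<in> ?P" using comm[OF r(1) q'(1) r(2) q'(2)] y1 by (intro idealD(9)[OF P])
    then have "r * q' * y1 - q' * (r * y1) \<in> N" using core_sub by (auto simp: left_diff_distrib mult.assoc)
    moreover have "q' * (r * y1) \<in> N" by (rule lidealD(5)[OF N_lideal q'(1) ry1])
    ultimately have 1: "r * q' * y1 \<in> N" using lideal_cong[OF N_lideal] by blast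
    have "r * q' * y1 = r * V w * b' * (V w * y1)" unfolding q'_def by (simp add: mult.assoc)
    then have "r * q' * y1 = r * (b' * y1)" unfolding r_V y1(2) by (simp add: mult.assoc)
    then have "r * (b' * y1) \<in> N" using 1 by simp
    moreover have "r * (a - b' * y1) \<in> N" using b' r by (intro lidealD(5)[OF N_lideal])
    ultimately have "r * (a - b' * y1) + r * (b' * y1) \<in> N" by (intro lidealD(4)[OF N_lideal])
    then show ?thesis by (simp add: right_diff_distrib)
  qed
  then have rP: "r \<in> ?P" using r by (simp add: core_def)
  \<comment> \<open>Since r lies in P, q (w + y) equals w modulo P. In degree n this compares the
    component of q in degree n plus its component in degree n - d times y with w or 0.\<close>
  have "r = V w - q - q * y" unfolding r_def t_def using q by (simp add: distrib_left)
  then have grr: "gr n r = (if n = 0 then V w else 0) - gr n q - gr (n - d) q * y" for n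
  proof -
    assume req: "r = V w - q - q * y"
    have "gr n (V w) = gr n (r + q + q * y)" by (simp add: req)
    also have "\<dots> = gr n r + gr n q + gr (n - d) q * y"
      using r q y gr_mult_right[OF q(1) y(3)] by (simp add: gr_add A_add A_mult)
    finally show ?thesis using gr_homog[OF homog_V[OF wv], of n] by (auto simp: algebra_simps)
  qed
  define K where "K = {n. gr n q \<notin> ?P}"
  have "K \<subseteq> Poly_Mapping.keys (lau q)"
    using idealD(3)[OF P] by (auto simp: K_def gr_def in_keys_iff)
  then have finK: "finite K" by (rule finite_subset) simp
  have step: "gr n q + gr (n - d) q * y - (if n = 0 then V w else 0) \<in> ?P" for n
  proof -
    have "- gr n r \<in> ?P" using gr rP by (intro idealD(7)[OF P]) (simp add: graded_def)
    then show ?thesis unfolding grr by (simp add: algebra_simps)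
  qed
  have yP: "gr n q \<in> ?P" if "gr n q * y \<in> ?P" for n
  proof -
    have "gr n q * V w = gr n q" using gr_mult_right[OF q(1) homog_V[OF wv], of n] q(3) by simp
    moreover have "gr n q * y * y' \<in> ?P" by (rule idealD(9)[OF P y(2) that])
    moreover have "gr n q * (V w - y * y') \<in> ?P" using yy gr_A[OF q(1)] by (intro idealD(5)[OF P]) auto
    ultimately have "gr n q * (V w - y * y') + gr n q * y * y' \<in> ?P" by (intro idealD(4)[OF P])
    then show ?thesis using \<open>gr n q * V w = gr n q\<close> by (simp add: right_diff_distrib mult.assoc)
  qed
  have "K \<noteq> {}"
  proof
    assume "K = {}"
    then have "gr n q \<in> ?P" for n by (auto simp: K_def)
    then have "gr 0 q + gr (0 - d) q * y \<in> ?P" by (intro idealD(4)[OF P] idealD(9)[OF P y(1)])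
    then show False using step[of 0] wP ideal_cong[OF P, of "gr 0 q + gr (0 - d) q * y" "V w"] by simp
  qed
  have max: "Max K \<in> K" and min: "Min K \<in> K" using finK \<open>K \<noteq> {}\<close> by auto
  \<comment> \<open>In degree Max K + d only the term with y survives, in degree Min K only the one
    without. Both must match w, the only term of degree 0 on the other side, which gives Max K = - d
    < 0 = Min K.\<close>
  have "Max K + d = 0"
  proof (rule ccontr)
    assume ne: "Max K + d \<noteq> 0"
    have "Max K + d \<notin> K" using finK d by (metis Max_ge add_le_same_cancel1 linorder_not_le)
    then have "gr (Max K + d) q \<in> ?P" by (simp add: K_def)
    moreover have "gr (Max K + d) q + gr (Max K) q * y \<in> ?P" using step[of "Max K + d"] ne by simp
    ultimately have "gr (Max K + d) q + gr (Max K) q * y - gr (Max K + d) q \<in> ?P" by (intro idealD(8)[OF P])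
    then have "gr (Max K) q \<in> ?P" using yP by simp
    then show False using max by (simp add: K_def)
  qed
  moreover have "Min K = 0"
  proof (rule ccontr)
    assume ne: "Min K \<noteq> 0"
    have "Min K - d \<notin> K" using finK d by (metis Min_le diff_gt_0_iff_gt diff_less_eq less_add_same_cancel1 linorder_not_le)
    then have "gr (Min K - d) q \<in> ?P" by (simp add: K_def)
    then have "gr (Min K - d) q * y \<in> ?P" by (rule idealD(9)[OF P y(1)])
    moreover have "gr (Min K) q + gr (Min K - d) q * y \<in> ?P" using step[of "Min K"] ne by simp
    ultimately have "gr (Min K) q + gr (Min K - d) q * y - gr (Min K - d) q * y \<in> ?P" by (intro idealD(8)[OF P])
    then show False using min by (simp add: K_def)
  qed
  moreover have "Min K \<le> Max K" using finK \<open>K \<noteq> {}\<close> by simp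
  ultimately show False using d by simp
qed

theorem core_conds: "primitive_conds (core N)"
proof -
  let ?P = "core N"
  let ?H = "vts ?P"
  let ?B = "breaking_vertices E ?H"
  let ?S = "{b \<in> ?B. brk ?H b \<in> ?P}"
  show ?thesis
  proof (cases "graded ?P")
    case False
    then show ?thesis using core_prime by (simp add: primitive_conds_def)
  next
    case True
    have form: "?P = IHS ?H ?S" by (rule graded_prime_form[OF core_ideal True])
    show ?thesis
    proof (cases "?S = ?B")
      case True
      then have "?P = IHS ?H ?B" using form by simp
      moreover have "condition_L E (verts E - ?H)"
        using True by (intro core_condition_L \<open>graded ?P\<close>) blast
      ultimately show ?thesis
        using prime_MT3[OF core_prime] core_countable_separation \<open>graded ?P\<close>
        by (simp add: primitive_conds_def Let_def)
    next
      case False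
      then obtain u where u: "u \<in> ?B" "brk ?H u \<notin> ?P" by blast
      have uu: "u' = u" if u': "u' \<in> ?B" "brk ?H u' \<notin> ?P" for u'
      proof (rule ccontr)
        assume ne: "u' \<noteq> u"
        obtain a where a: "a \<in> A" "brk ?H u' * a * brk ?H u \<notin> ?P"
          using primepD[OF core_prime brk_A[OF u'(1)] brk_A[OF u(1)] u'(2) u(2)] by blast
        then show False using brk_corner[OF core_ideal u'(1) u(1) a(1)] ne by simp
      qed
      have "?S = ?B - {u}"
      proof (intro equalityI subsetI)
        fix b assume "b \<in> ?B - {u}"
        then show "b \<in> ?S" using uu[of b] by blast
      next
        fix b assume "b \<in> ?S"
        then have "b \<in> ?B" "b \<noteq> u" using u(2) by auto
        then show "b \<in> ?B - {u}" by simp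
      qed
      then have "?P = IHS ?H (?B - {u})" using form by simp
      then have "\<exists>u\<in>?B. ?P = IHS ?H (?B - {u})" by (rule bexI) (rule u(1))
      then show ?thesis using core_prime True by (simp only: primitive_conds_def Let_def simp_thms)
    qed
  qed
qed

end

end

section \<open>The conditions produce simple modules\<close>

context leavitt_model
begin

lemma primitive_of_idempotent:
  assumes P: "primep P" and v: "v \<in> verts E" and \<epsilon>: "\<epsilon> \<in> A" "V v * \<epsilon> = \<epsilon>" "\<epsilon> * \<epsilon> = \<epsilon>" "\<epsilon> \<notin> P"
    and inv: "\<And>y. y \<in> A \<Longrightarrow> \<epsilon> * y * \<epsilon> \<notin> P \<Longrightarrow> \<exists>b\<in>A. b * (\<epsilon> * y * \<epsilon>) - \<epsilon> \<in> P"
  shows "\<exists>N. maximal_at N v \<and> P = core N"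
proof -
  note I = primep_ideal[OF P]
  \<comment> \<open>The map x to x \<epsilon> identifies A / N with A \<epsilon> / P
    \<epsilon>.\<close>
  define N where "N = {x \<in> A. x * \<epsilon> \<in> P}"
  have "lideal N"
    unfolding lideal_def N_def using idealD[OF I]
    by (auto simp: A_0 A_add A_mult distrib_right mult.assoc)
  moreover have "V v \<notin> N" using \<epsilon> by (simp add: N_def)
  moreover have "a - a * V v \<in> N" if a: "a \<in> A" for a
  proof -
    have "(a - a * V v) * \<epsilon> = 0" using \<epsilon>(2) by (simp add: left_diff_distrib mult.assoc)
    then show ?thesis using a A_V[OF v] idealD(3)[OF I] by (simp add: N_def A_diff A_mult)
  qed
  moreover have "\<exists>a\<in>A. V v - a * y \<in> N" if y: "y \<in> A" "y \<notin> N" for y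
  proof -
    have "y * \<epsilon> \<notin> P" using y by (simp add: N_def)
    \<comment> \<open>Primeness moves the nonzero class of y \<epsilon> into the corner, where it
      can be inverted.\<close>
    then obtain a where a: "a \<in> A" "\<epsilon> * a * (y * \<epsilon>) \<notin> P"
      using primepD[OF P \<epsilon>(1) A_mult[OF y(1) \<epsilon>(1)] \<epsilon>(4)] by blast
    then have "\<epsilon> * (a * y) * \<epsilon> \<notin> P" by (simp add: mult.assoc)
    then obtain b where b: "b \<in> A" "b * (\<epsilon> * (a * y) * \<epsilon>) - \<epsilon> \<in> P"
      using inv[OF A_mult[OF a(1) y(1)]] by blast
    have "(V v - b * \<epsilon> * a * y) * \<epsilon> = - (b * (\<epsilon> * (a * y) * \<epsilon>) - \<epsilon>)"
      using \<epsilon>(2) by (simp add: left_diff_distrib mult.assoc)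
    then have "(V v - b * \<epsilon> * a * y) * \<epsilon> \<in> P" using idealD(7)[OF I b(2)] by simp
    then have "V v - (b * \<epsilon> * a) * y \<in> N"
      unfolding N_def using a b y v \<epsilon> by (simp add: A_diff A_mult A_V)
    then show ?thesis using A_mult[OF A_mult[OF b(1) \<epsilon>(1)] a(1)] by blast
  qed
  ultimately have "maximal_at N v" unfolding maximal_at_def using v by blast
  moreover have "P = core N"
  proof (intro equalityI subsetI)
    fix x assume x: "x \<in> P"
    have "x * a * \<epsilon> \<in> P" if "a \<in> A" for a
      by (rule idealD(9)[OF I \<epsilon>(1) idealD(9)[OF I that x]])
    then show "x \<in> core N" using idealD(2)[OF I x] by (simp add: core_def N_def A_mult)
  next
    fix x assume "x \<in> core N"
    then have x: "x \<in> A" "\<And>a. a \<in> A \<Longrightarrow> x * a * \<epsilon> \<in> P" by (auto simp: core_def N_def)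
    then show "x \<in> P" using primepD[OF P x(1) \<epsilon>(1) _ \<epsilon>(4)] by blast
  qed
  ultimately show ?thesis by blast
qed

text \<open>By \<open>brk_corner\<close> the corner at u^H consists modulo P of the scalar multiples
  of u^H, so nonzero elements are inverted by inverting a scalar.\<close>

lemma primitive_of_breaking:
  assumes P: "primep P" and u: "u \<in> breaking_vertices E (vts P)" "brk (vts P) u \<notin> P"
  shows "\<exists>N. maximal_at N u \<and> P = core N"
proof -
  let ?b = "brk (vts P) u"
  note I = primep_ideal[OF P]
  show ?thesis
  proof (rule primitive_of_idempotent[OF P brk_u(1)[OF u(1)] brk_A[OF u(1)] _ brk_idem[OF u(1)] u(2)])
    show "V u * ?b = ?b" using V_brk[OF u(1) brk_u(1)[OF u(1)]] by simp
  next
    fix y assume y: "y \<in> A" "?b * y * ?b \<notin> P"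
    obtain k where k: "?b * y * ?b - sc k * ?b \<in> P" using brk_corner[OF I u(1) u(1) y(1)] by auto
    have "k \<noteq> 0" using k y(2) by (auto simp: sc_0)
    have "sc (inverse k) * ?b * (?b * y * ?b - sc k * ?b) \<in> P"
      by (rule idealD(5)[OF I A_sc[OF brk_A[OF u(1)]] k])
    also have "sc (inverse k) * ?b * (?b * y * ?b - sc k * ?b) =
       sc (inverse k) * ?b * (?b * y * ?b) - sc (inverse k) * (?b * sc k) * ?b"
      by (simp add: right_diff_distrib mult.assoc)
    also have "sc (inverse k) * (?b * sc k) * ?b = (sc (inverse k) * sc k) * (?b * ?b)"
      unfolding sc_comm[OF brk_A[OF u(1)]] by (simp add: mult.assoc)
    also have "\<dots> = ?b" using \<open>k \<noteq> 0\<close> brk_idem[OF u(1)] by (simp add: sc_1 flip: sc_mult)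
    finally show "\<exists>b\<in>A. b * (?b * y * ?b) - ?b \<in> P" using A_sc[OF brk_A[OF u(1)]] by blast
  qed
qed

section \<open>Modulo a non-graded prime, the corner at a cycle without exits is a field\<close>

context
  fixes P H w
  assumes Pp: "primep P" and H: "H = vts P" and B: "\<forall>u\<in>breaking_vertices E H. brk H u \<in> P"
    and w: "w \<in> verts E - H" and uniq: "unique_walks H w"
    and ex: "\<exists>\<gamma>. awalk w \<gamma> w \<and> \<gamma> \<noteq> []"
begin

lemma P_ideal: "ideal P"
  by (rule primep_ideal[OF Pp])

text \<open>The shortest nontrivial closed walk at w is the cycle based at w; every closed walk at w
  is a power of it.\<close>

definition root :: "'e list" where
  "root = arg_min length (\<lambda>\<gamma>. awalk w \<gamma> w \<and> \<gamma> \<noteq> [])"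

lemma root: "awalk w root w" "root \<noteq> []" "awalk w \<gamma> w \<Longrightarrow> \<gamma> \<noteq> [] \<Longrightarrow> length root \<le> length \<gamma>"
proof -
  obtain \<gamma>0 where "awalk w \<gamma>0 w \<and> \<gamma>0 \<noteq> []" using ex by blast
  from arg_min_nat_lemma[of "\<lambda>\<gamma>. awalk w \<gamma> w \<and> \<gamma> \<noteq> []", OF this, of length]
  show "awalk w root w" "root \<noteq> []" "awalk w \<gamma> w \<Longrightarrow> \<gamma> \<noteq> [] \<Longrightarrow> length root \<le> length \<gamma>"
    by (auto simp: root_def)
qed

lemmas cyc = P_ideal H B w uniq root(1,2)

lemma w_verts: "w \<in> verts E"
  using w by blast

definition rt :: "nat \<Rightarrow> 'e list" where "rt n = concat (replicate n root)"

lemma rt_walk: "awalk w (rt n) w"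
  unfolding rt_def by (rule closed_power[OF cyc])

lemma rt_add: "rt (m + n) = rt m @ rt n"
  by (simp add: rt_def replicate_add)

lemma length_rt: "length (rt n) = n * length root"
  by (induction n) (auto simp: rt_def)

text \<open>The initial segment of length |root| avoids \<open>H\<close> and starts at w, hence
  equals \<open>root\<close> by uniqueness; the remainder is a shorter closed walk at w.\<close>

lemma closed_is_rt: "awalk w \<gamma> w \<Longrightarrow> \<exists>n. \<gamma> = rt n"
proof (induction \<gamma> rule: length_induct)
  case (1 \<gamma>)
  show ?case
  proof (cases "\<gamma> = []")
    case True
    then have "\<gamma> = rt 0" by (simp add: rt_def)
    then show ?thesis ..
  next
    case False
    have len: "length root \<le> length \<gamma>" using root(3) 1 False by blast
    have "w \<notin> H" using w by blast
    then obtain x where x: "awalk w (take (length root) \<gamma>) x" "awalk x (drop (length root) \<gamma>) w" "x \<notin> H"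
      using awalk_take[OF cyc, of w \<gamma> w "length root"] 1 by blast
    have eq: "take (length root) \<gamma> = root \<and> x = w"
      by (rule uniqD[OF cyc x(1) root(1) x(3)]) (use w len in auto)
    then have "awalk w (drop (length root) \<gamma>) w" using x by simp
    moreover have "length (drop (length root) \<gamma>) < length \<gamma>" using root(2) False by simp
    ultimately obtain n where n: "drop (length root) \<gamma> = rt n" using 1 by blast
    have "\<gamma> = root @ rt n" using eq n by (metis append_take_drop_id)
    then have "\<gamma> = rt (Suc n)" by (simp add: rt_def)
    then show ?thesis ..
  qed
qed

definition C :: "nat \<Rightarrow> 'a" where "C n = pe (rt n) * V w"

lemma C_A: "C n \<in> A"
  unfolding C_def by (rule A_pe[OF rt_walk])

lemma V_C: "V w * C n = C n" and C_V: "C n * V w = C n"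
  unfolding C_def using V_pe_same[OF rt_walk] V_idem[OF w_verts] by (auto simp: mult.assoc)

lemma C_0: "C 0 = V w"
  by (simp add: C_def rt_def)

lemma C_add: "C (m + n) = C m * C n"
  using V_C[of n] by (simp add: C_def rt_add mult.assoc)

lemma C_inverse: "V w - C n * (V w * ge (rt n)) \<in> P"
  using vertex_expand[OF cyc rt_walk rt_walk[of n]] w pe_V_ge[OF w_verts, of "rt n" "rt n"] by (simp add: C_def)

text \<open>Horner evaluation of a polynomial at the cycle \<open>C 1\<close>, with w as the unit: a
  homomorphism from K[x] to the corner at w.\<close>

definition ev :: "'k poly \<Rightarrow> 'a" where
  "ev f = fold_coeffs (\<lambda>a x. sc a * V w + C 1 * x) f 0"

lemma ev_0 [simp]: "ev 0 = 0"
  by (simp add: ev_def)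

lemma ev_pCons: "ev (pCons a f) = sc a * V w + C 1 * ev f"
proof (cases "f = 0 \<and> a = 0")
  case False
  then show ?thesis
    by (cases "a = 0") (auto simp: ev_def fold_coeffs_pCons_not_0_0_eq fold_coeffs_pCons_coeff_not_0_eq)
qed (simp add: sc_0)

lemma ev_add: "ev (f + h) = ev f + ev h"
  by (induction f h rule: poly_induct2) (simp_all add: ev_pCons sc_add algebra_simps)

lemma ev_A: "ev f \<in> A"
  by (induction f) (auto simp: ev_pCons intro!: A_0 A_add A_sc A_V A_mult C_A w_verts)

lemma ev_smult: "ev (smult k f) = sc k * ev f"
proof (induction f)
  case (pCons a f)
  have "C 1 * (sc k * ev f) = sc k * (C 1 * ev f)" using sc_comm[OF C_A] by (simp flip: mult.assoc)
  then show ?case by (simp add: ev_pCons pCons sc_mult distrib_left mult.assoc)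
qed simp

lemma V_ev: "V w * ev f = ev f"
proof (induction f)
  case (pCons a f)
  have "V w * (sc a * V w) = sc a * V w"
    using sc_V[of w a] V_idem[OF w_verts] by (simp add: mult.assoc flip: mult.assoc[of "V w"])
  moreover have "V w * (C 1 * ev f) = C 1 * ev f" using V_C by (simp flip: mult.assoc)
  ultimately show ?case by (simp add: ev_pCons distrib_left)
qed simp

lemma ev_V: "ev f * V w = ev f"
  by (induction f) (simp_all add: ev_pCons distrib_right mult.assoc V_idem[OF w_verts])

lemma ev_mult: "ev (f * h) = ev f * ev h"
proof (induction f)
  case (pCons a f)
  have "ev (pCons a f * h) = sc a * (V w * ev h) + C 1 * (ev f * ev h)"
    by (simp add: ev_add ev_smult ev_pCons pCons sc_0 V_ev)
  then show ?case by (simp add: ev_pCons distrib_right mult.assoc)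
qed simp

lemma ev_minus: "ev (f - h) = ev f - ev h"
  using ev_add[of "f - h" h] by simp

lemma ev_uminus: "ev (- f) = - ev f"
  using ev_minus[of 0 f] by simp

lemma ev_sum: "ev (sum f I) = (\<Sum>i\<in>I. ev (f i))"
  by (induction I rule: infinite_finite_induct) (auto simp: ev_add)

lemma ev_monom: "ev (monom a n) = sc a * C n"
proof (induction n)
  case 0
  then show ?case by (simp add: monom_0 ev_pCons C_0)
next
  case (Suc n)
  have "C 1 * (sc a * C n) = sc a * (C 1 * C n)" using sc_comm[OF C_A] by (simp flip: mult.assoc)
  then show ?case using C_add[of 1 n] by (simp add: monom_Suc ev_pCons Suc sc_0)
qed

text \<open>Primeness gives x a y outside P, and a may be taken in the corner. As the corner is
  commutative modulo P, a multiple of x y would otherwise put x a y into P; so the corner modulo P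
  is a domain.\<close>

lemma corner_prime:
  assumes "x \<in> A" "V w * x * V w = x" "x \<notin> P" "y \<in> A" "V w * y * V w = y" "y \<notin> P"
  shows "x * y \<notin> P"
proof
  assume xy: "x * y \<in> P"
  obtain a where a: "a \<in> A" "x * a * y \<notin> P" using primepD[OF Pp] assms by blast
  let ?a = "V w * a * V w"
  have aA: "?a \<in> A" "V w * ?a * V w = ?a"
    using a V_idem[OF w_verts] A_V[OF w_verts] by (auto simp: A_mult mult.assoc) (simp flip: mult.assoc)
  have xV: "x * V w = x"
  proof -
    have "x * V w = V w * x * (V w * V w)" using assms(2) by (metis mult.assoc)
    then show ?thesis using V_idem[OF w_verts] assms(2) by simp
  qed
  have yV: "V w * y = y"
  proof -
    have "V w * y = (V w * V w) * y * V w" using assms(5) by (metis mult.assoc)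
    then show ?thesis using V_idem[OF w_verts] assms(5) by simp
  qed
  have eq: "x * a * y = x * ?a * y"
  proof -
    have "x * ?a * y = (x * V w) * a * (V w * y)" by (simp only: mult.assoc)
    then show ?thesis unfolding xV yV by simp
  qed
  have "(x * ?a - ?a * x) * y \<in> P"
    using corner_comm[OF cyc assms(1) aA(1) assms(2) aA(2)] assms(4) by (intro idealD(9)[OF P_ideal])
  moreover have "?a * (x * y) \<in> P" by (rule idealD(5)[OF P_ideal aA(1) xy])
  ultimately have "(x * ?a - ?a * x) * y + ?a * (x * y) \<in> P" by (rule idealD(4)[OF P_ideal])
  then show False using a(2) eq by (simp add: left_diff_distrib mult.assoc)
qed

lemma V_not_P: "V w \<notin> P"
  using w H by (auto simp: vts_def)

lemma ev_corner: "V w * ev f * V w = ev f"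
  by (simp add: V_ev ev_V)

text \<open>The comonic element of P is a polynomial in the cycle with nonzero constant term, so the
  kernel of K[x] in the quotient corner is nonzero. The image is then a finite-dimensional domain,
  and inverses come from division with remainder.\<close>

lemma ev_inverse:
  assumes y: "comonic w D y" "y \<in> P" and f: "ev f \<notin> P"
  shows "\<exists>b. ev b * ev f - V w \<in> P"
proof -
  obtain k c where D: "finite D" "\<And>\<gamma>. \<gamma> \<in> D \<Longrightarrow> awalk w \<gamma> w \<and> \<gamma> \<noteq> []" "k \<noteq> 0"
    "y = sc k * V w + (\<Sum>\<gamma>\<in>D. sc (c \<gamma>) * (pe \<gamma> * V w))"
    using y(1) unfolding comonic_def by blast
  define m where "m \<gamma> = (SOME n. \<gamma> = rt n)" for \<gamma>
  have m: "\<gamma> = rt (m \<gamma>)" "m \<gamma> \<noteq> 0" if "\<gamma> \<in> D" for \<gamma>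
  proof -
    show 1: "\<gamma> = rt (m \<gamma>)"
      unfolding m_def by (rule someI_ex) (use closed_is_rt D(2)[OF that] in blast)
    show "m \<gamma> \<noteq> 0"
    proof
      assume "m \<gamma> = 0"
      then have "\<gamma> = []" using 1 by (simp add: rt_def)
      then show False using D(2)[OF that] by simp
    qed
  qed
  define p0 where "p0 = [:k:] + (\<Sum>\<gamma>\<in>D. monom (c \<gamma>) (m \<gamma>))"
  have "pe \<gamma> * V w = C (m \<gamma>)" if "\<gamma> \<in> D" for \<gamma>
    unfolding C_def using m(1)[OF that] by simp
  then have "y = ev p0"
    unfolding p0_def D(4) ev_add ev_sum ev_monom by (simp add: ev_pCons)
  moreover have "(\<Sum>\<gamma>\<in>D. coeff (monom (c \<gamma>) (m \<gamma>)) 0) = 0"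
    by (rule sum.neutral) (auto dest: m(2))
  then have "coeff p0 0 = k" unfolding p0_def coeff_add coeff_sum by simp
  ultimately have p0: "p0 \<noteq> 0 \<and> ev p0 \<in> P" using y(2) D(3) by auto
  \<comment> \<open>A nonzero polynomial of least degree in the kernel plays the role of the minimal
    polynomial of the cycle modulo P.\<close>
  define p where "p = arg_min degree (\<lambda>p. p \<noteq> 0 \<and> ev p \<in> P)"
  have p: "p \<noteq> 0" "ev p \<in> P" "\<And>q. q \<noteq> 0 \<Longrightarrow> ev q \<in> P \<Longrightarrow> degree p \<le> degree q"
    using arg_min_nat_lemma[of "\<lambda>p. p \<noteq> 0 \<and> ev p \<in> P", OF p0, of degree] by (auto simp: p_def)
  \<comment> \<open>Dividing p by f leaves a remainder r of smaller degree with \<open>ev r\<close>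
    congruent to a multiple of \<open>ev f\<close>, so an inverse for r gives one for f. If r were
    zero, p would be a product of two polynomials of smaller degree, impossible in a domain.\<close>
  have small: "\<exists>b. ev b * ev f - V w \<in> P" if "f \<noteq> 0" "degree f < degree p" for f
    using that
  proof (induction "degree f" arbitrary: f rule: less_induct)
    case less
    have fP: "ev f \<notin> P" using p(3)[of f] less.prems by auto
    show ?case
    proof (cases "degree f = 0")
      case True
      then obtain a where a: "f = [:a:]" "a \<noteq> 0" using less.prems by (metis degree_eq_zeroE pCons_0_0)
      have "ev [:inverse a:] * ev f = ev [:1:]" using a by (simp flip: ev_mult)
      then have "ev [:inverse a:] * ev f - V w \<in> P" using idealD(3)[OF P_ideal] by (simp add: ev_pCons sc_1)
      then show ?thesis ..
    next
      case False
      define r where "r = p mod f"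
      have pr: "p = p div f * f + r" unfolding r_def by simp
      have "r \<noteq> 0"
      proof
        assume "r = 0"
        then have pq: "p = p div f * f" using pr by simp
        then have q0: "p div f \<noteq> 0" using p(1) by auto
        have "degree p = degree (p div f) + degree f"
          using pq degree_mult_eq[OF q0 less.prems(1)] by simp
        then have "ev (p div f) \<notin> P" using p(3)[OF q0] False by auto
        then have "ev (p div f) * ev f \<notin> P" using fP by (intro corner_prime ev_A ev_corner)
        then show False using p(2) pq by (simp flip: ev_mult)
      qed
      moreover have "degree r < degree f" unfolding r_def
        using degree_mod_less[OF less.prems(1), of p] \<open>r \<noteq> 0\<close> r_def by auto
      ultimately obtain b where b: "ev b * ev r - V w \<in> P" using less.hyps[of r] less.prems by auto
      have "r = p - p div f * f" using pr by (simp add: algebra_simps)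
      then have "ev b * ev r = ev b * ev p - ev (b * (p div f)) * ev f"
        by (simp add: ev_minus ev_mult right_diff_distrib mult.assoc)
      then have "ev (- (b * (p div f))) * ev f - V w = (ev b * ev r - V w) - ev b * ev p"
        by (simp add: ev_uminus)
      moreover have "(ev b * ev r - V w) - ev b * ev p \<in> P"
        using b p(2) by (intro idealD(8)[OF P_ideal b] idealD(5)[OF P_ideal ev_A])
      ultimately show ?thesis by metis
    qed
  qed
  define r where "r = f mod p"
  have fr: "f = p * (f div p) + r" unfolding r_def by simp
  have "ev f = ev p * ev (f div p) + ev r" by (subst fr) (simp only: ev_add ev_mult)
  moreover have "ev p * ev (f div p) \<in> P" by (rule idealD(9)[OF P_ideal ev_A p(2)])
  ultimately have diff: "ev f - ev r \<in> P" by simp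
  then have "ev r \<notin> P" using f ideal_cong[OF P_ideal] by blast
  then have "r \<noteq> 0" using idealD(3)[OF P_ideal] by auto
  moreover have "degree r < degree p" using degree_mod_less[OF p(1), of f] \<open>r \<noteq> 0\<close> r_def by auto
  ultimately obtain b where b: "ev b * ev r - V w \<in> P" using small by blast
  have "ev b * (ev f - ev r) + (ev b * ev r - V w) \<in> P"
    by (intro idealD(4)[OF P_ideal _ b] idealD(5)[OF P_ideal ev_A diff])
  then have "ev b * ev f - V w \<in> P" by (simp add: right_diff_distrib)
  then show ?thesis ..
qed

text \<open>Multiplication by a power of the cycle clears the ghost edges, just as a power of x
  turns a Laurent polynomial into a polynomial.\<close>

lemma loops_ev:
  assumes "x \<in> sumset (loops H w)"
  shows "\<exists>m f. x * C m - ev f \<in> P"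
  using assms
proof induction
  case sumset_0
  show ?case using idealD(3)[OF P_ideal] by (intro exI[of _ 0] exI[of _ "0::'k poly"]) simp
next
  case (sumset_add x y)
  obtain m2 f2 where y: "y * C m2 - ev f2 \<in> P" using sumset_add by blast
  obtain k \<alpha> z \<beta> where x: "x = sc k * (pe \<alpha> * V z * ge \<beta>)" "awalk w \<alpha> z" "awalk w \<beta> z" "z \<notin> H"
    using sumset_add(1) unfolding loops_def[OF cyc] by blast
  define m1 where "m1 = length \<beta>"
  \<comment> \<open>The length is chosen so that \<beta>\<epsilon> is as long as the power of
    \<open>root\<close> with exponent |\<beta>|; by uniqueness it is that power.\<close>
  obtain \<epsilon> z' where \<epsilon>: "awalk z \<epsilon> z'" "z' \<notin> H" "length \<epsilon> = length \<beta> * length root - length \<beta>"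
    using extension[OF cyc x(2,4)] by blast
  have W: "awalk w (\<alpha> @ \<epsilon>) z'" "awalk w (\<beta> @ \<epsilon>) z'" using x \<epsilon> by auto
  have "length \<beta> \<le> length \<beta> * length root" using root(2) by (cases root) auto
  then have len: "length (\<beta> @ \<epsilon>) = length (rt m1)" using \<epsilon>(3) by (simp add: length_rt m1_def)
  have \<beta>\<epsilon>: "\<beta> @ \<epsilon> = rt m1 \<and> z' = w" by (rule uniqD[OF cyc W(2) rt_walk \<epsilon>(2) _ len]) (use w in blast)
  then obtain n where n: "\<alpha> @ \<epsilon> = rt n" using closed_is_rt[of "\<alpha> @ \<epsilon>"] W by auto
  have shift: "pe \<alpha> * V z * ge \<beta> - C n * ge (rt m1) \<in> P"
    using monomial_shift[OF cyc x(2,3) \<epsilon>(1,2)] \<beta>\<epsilon> n by (simp only: C_def)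
  have "sc k * ((pe \<alpha> * V z * ge \<beta> - C n * ge (rt m1)) * C m1) \<in> P"
    by (rule idealD(6)[OF P_ideal idealD(9)[OF P_ideal C_A shift]])
  also have "sc k * ((pe \<alpha> * V z * ge \<beta> - C n * ge (rt m1)) * C m1) = x * C m1 - sc k * (C n * (V w * ge (rt m1) * C m1))"
    using C_V[of n] by (simp add: x(1) left_diff_distrib right_diff_distrib mult.assoc) (simp flip: mult.assoc)
  also have "V w * ge (rt m1) * C m1 = V w" unfolding C_def by (rule ge_pe[OF rt_walk])
  also have "sc k * (C n * V w) = ev (monom k n)" by (simp add: C_V ev_monom)
  finally have x1: "x * C m1 - ev (monom k n) \<in> P" .
  have "(x * C m1 - ev (monom k n)) * C m2 + (y * C m2 - ev f2) * C m1 \<in> P"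
    by (intro idealD(4)[OF P_ideal] idealD(9)[OF P_ideal C_A] x1 y)
  also have "(x * C m1 - ev (monom k n)) * C m2 + (y * C m2 - ev f2) * C m1
     = (x + y) * C (m1 + m2) - ev (monom k n * monom 1 m2 + f2 * monom 1 m1)"
  proof -
    have 1: "x * C (m1 + m2) = x * C m1 * C m2" by (simp add: C_add mult.assoc)
    have 2: "y * C (m1 + m2) = y * C m2 * C m1" by (subst add.commute) (simp add: C_add mult.assoc)
    show ?thesis
      unfolding ev_add ev_mult distrib_right 1 2
      by (simp add: ev_monom[of 1] sc_1 left_diff_distrib)
  qed
  finally show ?case by blast
qed

text \<open>A power \<open>C m\<close> of the cycle, invertible modulo P, turns the given element
  into some \<open>ev f\<close>. An inverse of \<open>ev f\<close> multiplied by \<open>C m\<close>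
  then inverts the element, by commutativity.\<close>

lemma corner_inverse:
  assumes y: "comonic w D y" "y \<in> P" and x: "x \<in> A" "V w * x * V w \<notin> P"
  shows "\<exists>b\<in>A. b * (V w * x * V w) - V w \<in> P"
proof -
  let ?x = "V w * x * V w"
  have xA: "?x \<in> A" "V w * ?x * V w = ?x" "?x * V w = ?x"
    using x A_V[OF w_verts] V_idem[OF w_verts]
    by (auto simp: A_mult mult.assoc) (simp flip: mult.assoc)
  obtain l where l: "l \<in> sumset (loops H w)" "?x - l \<in> P" using corner_form[OF cyc x(1)] by blast
  obtain m f where mf: "l * C m - ev f \<in> P" using loops_ev[OF l(1)] by blast
  have "(?x - l) * C m + (l * C m - ev f) \<in> P"
    by (intro idealD(4)[OF P_ideal idealD(9)[OF P_ideal C_A l(2)] mf])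
  then have xC: "?x * C m - ev f \<in> P" by (simp add: left_diff_distrib)
  have "ev f \<notin> P"
  proof
    assume "ev f \<in> P"
    then have "?x * C m \<in> P" using xC ideal_cong[OF P_ideal] by blast
    then have "?x * C m * (V w * ge (rt m)) \<in> P" by (rule idealD(9)[OF P_ideal A_ge[OF rt_walk]])
    moreover have "?x * (V w - C m * (V w * ge (rt m))) \<in> P" by (rule idealD(5)[OF P_ideal xA(1) C_inverse])
    ultimately have "?x * (V w - C m * (V w * ge (rt m))) + ?x * C m * (V w * ge (rt m)) \<in> P"
      by (intro idealD(4)[OF P_ideal])
    then have "?x * V w \<in> P" by (simp add: right_diff_distrib mult.assoc)
    then show False using xA(3) x(2) by simp
  qed
  then obtain b where b: "ev b * ev f - V w \<in> P" using ev_inverse[OF y] by blast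
  have bx: "ev b * ?x \<in> A" "V w * (ev b * ?x) * V w = ev b * ?x"
    using ev_A xA V_ev[of b] by (auto simp: A_mult) (metis mult.assoc)
  have CC: "V w * C m * V w = C m" by (simp add: V_C C_V)
  have "ev b * (?x * C m - ev f) + (ev b * ev f - V w) \<in> P"
    by (intro idealD(4)[OF P_ideal _ b] idealD(5)[OF P_ideal ev_A xC])
  moreover have "ev b * ?x * C m - C m * (ev b * ?x) \<in> P"
    by (rule corner_comm[OF cyc bx(1) C_A bx(2) CC])
  ultimately have "ev b * (?x * C m - ev f) + (ev b * ev f - V w) - (ev b * ?x * C m - C m * (ev b * ?x)) \<in> P"
    by (rule idealD(8)[OF P_ideal])
  then have "C m * ev b * ?x - V w \<in> P" by (simp add: right_diff_distrib mult.assoc)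
  then show ?thesis using A_mult[OF C_A ev_A] by blast
qed

lemma primitive_of_cycle:
  assumes "comonic w D y" "y \<in> P"
  shows "\<exists>N. maximal_at N w \<and> P = core N"
  by (rule primitive_of_idempotent[OF Pp w_verts A_V[OF w_verts] V_idem[OF w_verts] V_idem[OF w_verts] V_not_P])
    (rule corner_inverse[OF assms])

end

lemma primitive_nongraded:
  assumes P: "primep P" "\<not> graded P"
  shows "\<exists>N v. maximal_at N v \<and> P = core N"
proof (cases "\<forall>u\<in>breaking_vertices E (vts P). brk (vts P) u \<in> P")
  case False
  then show ?thesis using primitive_of_breaking[OF P(1)] by blast
next
  case True
  let ?H = "vts P"
  note I = primep_ideal[OF P(1)]
  have H: "hereditary ?H" by (rule vts_hereditary[OF I])
  let ?J = "IHS ?H (breaking_vertices E ?H)"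
  have sub: "?J \<subseteq> P" using True by (intro IHS_least[OF I]) (auto simp: vts_def)
  have vJ: "vts ?J \<subseteq> ?H" using sub by (auto simp: vts_def)
  have "?J \<noteq> P" using IHS_graded[OF H order_refl] P(2) by auto
  then show ?thesis
  proof (rule reduction[OF H order_refl vJ I sub])
    fix w D y assume w: "w \<in> verts E - ?H" "unique_walks ?H w" "D \<noteq> {}" "comonic w D y" "y \<in> P"
    then have "\<exists>\<gamma>. awalk w \<gamma> w \<and> \<gamma> \<noteq> []" unfolding comonic_def by blast
    from primitive_of_cycle[OF P(1) refl True w(1,2) this w(4,5)] show ?thesis by blast
  qed (auto simp: vts_def)
qed

lemma primitive_countable:
  assumes I: "ideal P" and ne: "P \<noteq> A" and form: "P = IHS (vts P) (breaking_vertices E (vts P))"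
    and M: "MT3 E (verts E - vts P)" and L: "condition_L E (verts E - vts P)"
    and S: "countable_separation E (verts E - vts P)"
  shows "\<exists>N v. maximal_at N v \<and> P = core N"
proof -
  let ?H = "vts P"
  let ?X = "verts E - ?H"
  have H: "hereditary ?H" by (rule vts_hereditary[OF I])
  obtain C where C: "C \<subseteq> ?X" "countable C" "\<And>u. u \<in> ?X \<Longrightarrow> \<exists>v\<in>C. reachable E u v"
    using S unfolding countable_separation_def by blast
  have "?X \<noteq> {}" using ideal_vertices_all[OF I] ne by (auto simp: vts_def)
  then have "C \<noteq> {}" using C(3) by blast
  define c where "c = from_nat_into C"
  have c: "range c = C" unfolding c_def by (rule range_from_nat_into[OF \<open>C \<noteq> {}\<close> C(2)])
  then have cX: "c n \<in> ?X" for n using C(1) by blast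
  define w0 where "w0 = c 0"
  have w0: "w0 \<in> verts E" using cX[of 0] by (simp add: w0_def)
  \<comment> \<open>The path is prolonged step by step: MT-3 supplies a common descendant outside
    \<open>H\<close> of its present end and of the next separating vertex.\<close>
  have "\<exists>f. \<forall>n. (awalk w0 (fst (f n)) (snd (f n)) \<and> snd (f n) \<in> ?X \<and> reachable E (c n) (snd (f n))) \<and>
      (\<exists>\<nu>. fst (f (Suc n)) = fst (f n) @ \<nu>)"
  proof (rule dependent_nat_choice)
    show "\<exists>x. awalk w0 (fst x) (snd x) \<and> snd x \<in> ?X \<and> reachable E (c 0) (snd x)"
      using cX[of 0] by (intro exI[of _ "([], w0)"]) (auto simp: w0_def awalk_Nil_iff)
  next
    fix x n assume x: "awalk w0 (fst x) (snd x) \<and> snd x \<in> ?X \<and> reachable E (c n) (snd x)"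
    then obtain z where z: "z \<in> ?X" "reachable E (snd x) z" "reachable E (c (Suc n)) z"
      using M cX[of "Suc n"] unfolding MT3_def by blast
    then obtain \<nu> where "awalk (snd x) \<nu> z" using reachable_awalk by blast
    then have "awalk w0 (fst x @ \<nu>) z" using x by auto
    then show "\<exists>y. (awalk w0 (fst y) (snd y) \<and> snd y \<in> ?X \<and> reachable E (c (Suc n)) (snd y)) \<and> (\<exists>\<nu>. fst y = fst x @ \<nu>)"
      using z by (intro exI[of _ "(fst x @ \<nu>, z)"]) auto
  qed
  then obtain f where f: "\<And>n. awalk w0 (fst (f n)) (snd (f n))" "\<And>n. snd (f n) \<in> ?X"
    "\<And>n. reachable E (c n) (snd (f n))" "\<And>n. \<exists>\<nu>. fst (f (Suc n)) = fst (f n) @ \<nu>" by blast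
  define \<mu> where "\<mu> n = fst (f n)" for n
  define z where "z n = snd (f n)" for n
  have \<mu>: "awalk w0 (\<mu> n) (z n)" "z n \<in> ?X" "reachable E (c n) (z n)" for n
    using f by (auto simp: \<mu>_def z_def)
  have z: "z n \<in> verts E" "V (z n) \<notin> P" for n using \<mu>(2) by (auto simp: vts_def)
  have prefix: "\<exists>\<nu>. \<mu> m = \<mu> n @ \<nu>" if "n \<le> m" for n m
    using that
  proof (induction m rule: dec_induct)
    case (step m)
    obtain \<nu> where "\<mu> m = \<mu> n @ \<nu>" using step.IH by blast
    moreover obtain \<nu>' where "\<mu> (Suc m) = \<mu> m @ \<nu>'" using f(4)[of m] unfolding \<mu>_def by blast
    ultimately show ?case by simp
  qed simp
  \<comment> \<open>The idempotent is the initial path \<mu> n times its ghost. It decreases with n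
    because these paths extend one another.\<close>
  define e where "e n = pe (\<mu> n) * V (z n) * ge (\<mu> n)" for n
  have eA: "e n \<in> A" for n unfolding e_def by (rule A_mon[OF \<mu>(1) \<mu>(1)])
  have ee: "e n * e m = e m" if nm: "n \<le> m" for n m
  proof -
    obtain \<nu> where \<nu>: "\<mu> m = \<mu> n @ \<nu>" using prefix[OF nm] by blast
    have "awalk (awlast w0 (\<mu> n)) \<nu> (z m)" using \<mu>(1)[of m] unfolding \<nu> by simp
    then have wl: "awalk (z n) \<nu> (z m)" using \<mu>(1)[of n] by simp
    have "e n * e m = pe (\<mu> n) * (V (z n) * ge (\<mu> n) * (pe (\<mu> m) * V (z m))) * ge (\<mu> m)"
      unfolding e_def by (simp only: mult.assoc)
    also have "V (z n) * ge (\<mu> n) * (pe (\<mu> m) * V (z m)) = pe \<nu> * V (z m)"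
      unfolding \<nu> by (rule ge_pe_append(1)[OF \<mu>(1) wl])
    also have "pe (\<mu> n) * (pe \<nu> * V (z m)) * ge (\<mu> m) = e m"
      unfolding e_def \<nu> by (simp add: mult.assoc)
    finally show ?thesis .
  qed
  have Ve: "V w0 * e n = e n" for n
    unfolding e_def using V_pe_same[OF \<mu>(1)[of n]] by (simp flip: mult.assoc)
  have e_P: "e n \<notin> P" for n
  proof
    assume "e n \<in> P"
    then have "(V (z n) * ge (\<mu> n)) * e n * (pe (\<mu> n) * V (z n)) \<in> P"
      using \<mu> by (intro ideal_sandwich[OF I] A_ge A_pe)
    also have "(V (z n) * ge (\<mu> n)) * e n * (pe (\<mu> n) * V (z n)) =
       (V (z n) * ge (\<mu> n) * (pe (\<mu> n) * V (z n))) * (ge (\<mu> n) * (pe (\<mu> n) * V (z n)))"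
      unfolding e_def by (simp only: mult.assoc)
    also have "\<dots> = V (z n)" using ge_pe[OF \<mu>(1)[of n]] by (simp add: mult.assoc)
    finally show False using z by simp
  qed
  \<comment> \<open>This left ideal contains P and all w0 - e n. It misses w0, since no e n lies in
    P, and is the starting point for Zorn's lemma.\<close>
  define N0 where "N0 = {x \<in> A. \<exists>n. x * e n \<in> P}"
  have N0: "lideal N0"
    unfolding lideal_def
  proof (intro conjI ballI)
    fix x y assume "x \<in> N0" "y \<in> N0"
    then obtain n m where nm: "x \<in> A" "y \<in> A" "x * e n \<in> P" "y * e m \<in> P" by (auto simp: N0_def)
    have "x * e n * e (max n m) \<in> P" "y * e m * e (max n m) \<in> P"
      by (rule idealD(9)[OF I eA nm(3)], rule idealD(9)[OF I eA nm(4)])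
    then have "(x + y) * e (max n m) \<in> P"
      using ee[of n "max n m"] ee[of m "max n m"] idealD(4)[OF I] by (simp add: mult.assoc distrib_right)
    then show "x + y \<in> N0" using nm A_add by (auto simp: N0_def)
  next
    fix a x assume a: "a \<in> A" and "x \<in> N0"
    then obtain n where n: "x \<in> A" "x * e n \<in> P" by (auto simp: N0_def)
    have "a * x * e n \<in> P" using idealD(5)[OF I a n(2)] by (simp add: mult.assoc)
    then show "a * x \<in> N0" using a n A_mult by (auto simp: N0_def)
  qed (use idealD(3)[OF I] A_0 in \<open>auto simp: N0_def\<close>)
  have Vw0_e: "V w0 - e n \<in> N0" for n
    using w0 eA ee[of n n] Ve[of n] idealD(3)[OF I] A_V[OF w0]
    by (auto simp: N0_def A_diff left_diff_distrib intro!: exI[of _ n])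
  have w0N0: "V w0 \<notin> N0" using Ve e_P by (simp add: N0_def)
  define Z where "Z = {N. lideal N \<and> N0 \<subseteq> N \<and> V w0 \<notin> N}"
  have "\<exists>M\<in>Z. \<forall>X\<in>Z. M \<subseteq> X \<longrightarrow> X = M"
  proof (rule subset_Zorn_nonempty)
    show "Z \<noteq> {}" using N0 w0N0 by (auto simp: Z_def)
  next
    fix K assume K: "K \<noteq> {}" "subset.chain Z K"
    have KZ: "N \<in> Z" if "N \<in> K" for N using K that by (auto simp: subset.chain_def)
    have "x + y \<in> \<Union>K" if xy: "x \<in> \<Union>K" "y \<in> \<Union>K" for x y
    proof -
      obtain N1 N2 where N: "N1 \<in> K" "N2 \<in> K" "x \<in> N1" "y \<in> N2" using xy by blast
      then have "N1 \<subseteq> N2 \<or> N2 \<subseteq> N1" using K(2) by (auto simp: subset.chain_def)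
      then obtain N where N: "N \<in> K" "x \<in> N" "y \<in> N" using N by blast
      have "lideal N" using KZ[OF N(1)] by (simp add: Z_def)
      from lidealD(4)[OF this N(2,3)] show ?thesis using N(1) by blast
    qed
    moreover have "a * x \<in> \<Union>K" if ax: "a \<in> A" "x \<in> \<Union>K" for a x
    proof -
      obtain N where N: "N \<in> K" "x \<in> N" using ax(2) by blast
      have "lideal N" using KZ[OF N(1)] by (simp add: Z_def)
      from lidealD(5)[OF this ax(1) N(2)] show ?thesis using N(1) by blast
    qed
    moreover have "0 \<in> \<Union>K" "N0 \<subseteq> \<Union>K"
    proof -
      obtain N where N: "N \<in> K" using K(1) by blast
      then show "N0 \<subseteq> \<Union>K" using KZ[OF N] by (auto simp: Z_def)
      then show "0 \<in> \<Union>K" using lidealD(3)[OF N0] by blast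
    qed
    moreover have "\<Union>K \<subseteq> A"
    proof
      fix x assume "x \<in> \<Union>K"
      then obtain N where N: "N \<in> K" "x \<in> N" by blast
      then have "lideal N" using KZ[OF N(1)] by (simp add: Z_def)
      then show "x \<in> A" using N(2) by (rule lidealD(2))
    qed
    moreover have "V w0 \<notin> \<Union>K" using KZ unfolding Z_def by blast
    ultimately show "\<Union>K \<in> Z" by (simp add: Z_def lideal_def)
  qed
  then obtain N where "N \<in> Z" and max: "\<And>N'. N' \<in> Z \<Longrightarrow> N \<subseteq> N' \<Longrightarrow> N' = N" by blast
  then have N: "lideal N" "N0 \<subseteq> N" "V w0 \<notin> N" by (auto simp: Z_def)
  have "maximal_at N w0"
    unfolding maximal_at_def
  proof (intro conjI ballI impI N w0)
    fix a assume a: "a \<in> A"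
    have "(a - a * V w0) * e 0 = 0" using Ve[of 0] by (simp add: left_diff_distrib mult.assoc)
    then have "a - a * V w0 \<in> N0"
      using a A_V[OF w0] idealD(3)[OF I] by (auto simp: N0_def A_diff A_mult intro!: exI[of _ 0])
    then show "a - a * V w0 \<in> N" using N by blast
  next
    fix y assume y: "y \<in> A" "y \<notin> N"
    define N' where "N' = {n + a * y | n a. n \<in> N \<and> a \<in> A}"
    have N'I: "n + a * y \<in> N'" if "n \<in> N" "a \<in> A" for n a using that by (auto simp: N'_def)
    have "lideal N'"
      unfolding lideal_def
    proof (intro conjI ballI)
      show "N' \<subseteq> A" using y lidealD[OF N(1)] by (auto simp: N'_def intro!: A_add A_mult)
      show "0 \<in> N'" using N'I[of 0 0] lidealD[OF N(1)] A_0 by simp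
    next
      fix x x' assume "x \<in> N'" "x' \<in> N'"
      then obtain n a n' a' where n: "x = n + a * y" "x' = n' + a' * y" "n \<in> N" "n' \<in> N" "a \<in> A" "a' \<in> A"
        by (auto simp: N'_def)
      have "(n + n') + (a + a') * y \<in> N'" using n by (intro N'I lidealD(4)[OF N(1)] A_add)
      then show "x + x' \<in> N'" unfolding n by (simp add: algebra_simps)
    next
      fix b x assume b: "b \<in> A" and "x \<in> N'"
      then obtain n a where n: "x = n + a * y" "n \<in> N" "a \<in> A" by (auto simp: N'_def)
      have "b * n + (b * a) * y \<in> N'" using n b by (intro N'I lidealD(5)[OF N(1)] A_mult)
      then show "b * x \<in> N'" unfolding n by (simp add: algebra_simps)
    qed
    moreover have NN': "N \<subseteq> N'" using N'I[of _ 0] A_0 by force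
    moreover have "y \<in> N'"
    proof -
      obtain \<epsilon> where "\<epsilon> \<in> A" "\<epsilon> * y = y" using local_unit y by blast
      then show ?thesis using N'I[of 0 \<epsilon>] lidealD[OF N(1)] by simp
    qed
    ultimately have "N' \<notin> Z" using max[of N'] y by blast
    then have "V w0 \<in> N'" using \<open>lideal N'\<close> NN' N by (auto simp: Z_def)
    then obtain n a where n: "V w0 = n + a * y" "n \<in> N" "a \<in> A" by (auto simp: N'_def)
    then have "V w0 - a * y \<in> N" by simp
    then show "\<exists>a\<in>A. V w0 - a * y \<in> N" using n by blast
  qed
  note mx = this
  have Q: "ideal (core N)" by (rule core_ideal[OF mx])
  have PQ: "P \<subseteq> core N"
  proof
    fix x assume x: "x \<in> P"
    have "x * a \<in> N0" if "a \<in> A" for a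
      using idealD(9)[OF I that x] idealD(9)[OF I eA, of "x * a"] idealD(2)[OF I] by (auto simp: N0_def)
    then show "x \<in> core N" using x N idealD(2)[OF I] by (auto simp: core_def)
  qed
  have "P = core N"
  proof (rule ccontr)
    assume ne: "P \<noteq> core N"
    have vJ: "vts (IHS ?H (breaking_vertices E ?H)) \<subseteq> ?H" using form by simp
    have sub: "IHS ?H (breaking_vertices E ?H) \<subseteq> core N" using form PQ by simp
    have ne': "IHS ?H (breaking_vertices E ?H) \<noteq> core N" using form ne by simp
    show False
    proof (rule reduction[OF H order_refl vJ Q sub ne'])
      fix w D y assume w: "w \<in> ?X" "unique_walks ?H w" "D \<noteq> {}" "comonic w D y"
      then obtain \<gamma> where "awalk w \<gamma> w" "\<gamma> \<noteq> []" unfolding comonic_def by blast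
      then show False using unique_walks_not_L[OF H w(1,2)] L by blast
    next
      \<comment> \<open>The vertex w reaches some separating vertex c n and hence z n, which puts e
        n into the core. As w0 - e n lies in N as well, w0 would lie in N.\<close>
      fix w assume w: "w \<in> ?X" "V w \<in> core N"
      then obtain n where "reachable E w (c n)" using C(3) c by blast
      then have "reachable E w (z n)" using \<mu>(3) reachable_trans by blast
      then obtain \<alpha> where "awalk w \<alpha> (z n)" using reachable_awalk by blast
      moreover have "w \<in> vts (core N)" using w by (simp add: vts_def)
      ultimately have "z n \<in> vts (core N)" using hereditary_awalk[OF vts_hereditary[OF Q]] by blast
      then have "sc 1 * (pe (\<mu> n) * V (z n) * ge (\<mu> n)) \<in> core N"
        using \<mu> by (intro mon_in[OF Q]) (auto simp: vts_def)
      then have "e n \<in> N" using core_sub[OF mx] by (auto simp: e_def sc_1)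
      then have "V w0 - e n + e n \<in> N" using Vw0_e N by (intro lidealD(4)[OF N(1)]) auto
      then show False using N by simp
    qed auto
  qed
  then show ?thesis using mx by blast
qed

end

section \<open>Breaking vertices are independent\<close>

text \<open>The algebra acts on functions on the finite walks that end at the breaking vertex \<open>u\<close>.\<close>

definition walk_start :: "('v, 'e) pre_digraph \<Rightarrow> 'v \<Rightarrow> 'e list \<Rightarrow> 'v" where
  "walk_start E u p = (if p = [] then u else tail E (hd p))"

definition walks_to :: "('v, 'e) pre_digraph \<Rightarrow> 'v \<Rightarrow> 'e list set" where
  "walks_to E u = {p. \<exists>x. pre_digraph.awalk E x p u}"

lift_definition walk_V :: "('v, 'e) pre_digraph \<Rightarrow> 'v \<Rightarrow> 'v \<Rightarrow> ('e list \<Rightarrow> 'k::field, 'k) endo"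
  is "\<lambda>E u v z. (\<lambda>p. if p \<in> walks_to E u \<and> walk_start E u p = v then fst z p else 0, 0)"
  by (auto simp: fun_eq_iff)

lift_definition walk_s :: "('v, 'e) pre_digraph \<Rightarrow> 'v \<Rightarrow> 'e \<Rightarrow> ('e list \<Rightarrow> 'k::field, 'k) endo"
  is "\<lambda>E u e z. (\<lambda>p. if p \<in> walks_to E u \<and> p \<noteq> [] \<and> hd p = e then fst z (tl p) else 0, 0)"
  by (auto simp: fun_eq_iff)

lift_definition walk_g :: "('v, 'e) pre_digraph \<Rightarrow> 'v \<Rightarrow> 'e \<Rightarrow> ('e list \<Rightarrow> 'k::field, 'k) endo"
  is "\<lambda>E u e z. (\<lambda>p. if e # p \<in> walks_to E u then fst z (e # p) else 0, 0)"
  by (auto simp: fun_eq_iff)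

lift_definition walk_sc :: "'k::field \<Rightarrow> ('e list \<Rightarrow> 'k, 'k) endo"
  is "\<lambda>k z. (\<lambda>p. k * fst z p, k * snd z)"
  by (auto simp: fun_eq_iff algebra_simps)

lemma walk_app:
  "app (walk_V E u v) z = (\<lambda>p. if p \<in> walks_to E u \<and> walk_start E u p = v then fst z p else 0, 0)"
  "app (walk_s E u e) z = (\<lambda>p. if p \<in> walks_to E u \<and> p \<noteq> [] \<and> hd p = e then fst z (tl p) else 0, 0)"
  "app (walk_g E u e) z = (\<lambda>p. if e # p \<in> walks_to E u then fst z (e # p) else 0, 0)"
  "app (walk_sc k) z = (\<lambda>p. k * fst z p, k * snd z)"
  by (transfer; simp)+

context wf_digraph
begin

lemma walks_to_Cons:
  "e # p \<in> walks_to G u \<longleftrightarrow> e \<in> arcs G \<and> p \<in> walks_to G u \<and> walk_start G u p = head G e"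
proof (cases p)
  case Nil
  then show ?thesis by (auto simp: walks_to_def walk_start_def awalk_simps)
next
  case (Cons f q)
  then show ?thesis by (auto simp: walks_to_def walk_start_def awalk_simps)
qed

lemma walks_to_tl:
  "p \<in> walks_to G u \<Longrightarrow> p \<noteq> [] \<Longrightarrow> tl p \<in> walks_to G u \<and> walk_start G u (tl p) = head G (hd p)"
  by (cases p) (auto simp: walks_to_Cons)

lemma walk_sg:
  "app (walk_s G u e * walk_g G u e :: ('b list \<Rightarrow> 'k::field, 'k) endo) z =
    (\<lambda>p. if p \<in> walks_to G u \<and> p \<noteq> [] \<and> hd p = e then fst z p else 0, 0)"
  by (auto simp: walk_app fun_eq_iff)

lemma walk_sg_sum:
  assumes "finite F"
  shows "app (\<Sum>e\<in>F. walk_s G u e * walk_g G u e :: ('b list \<Rightarrow> 'k::field, 'k) endo) z =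
    (\<lambda>p. if p \<in> walks_to G u \<and> p \<noteq> [] \<and> hd p \<in> F then fst z p else 0, 0)"
  using assms
  by (induction F rule: finite_induct) (auto simp: walk_sg fun_eq_iff zero_prod_def zero_fun_def plus_fun_def simp del: app_simps(4))

text \<open>The trivial walk at u is the only walk to u without a first edge. As u is an infinite
  emitter, no relation at a regular vertex concerns it, so the remaining walks at a regular vertex
  are sorted by their first edges.\<close>

lemma walk_family:
  assumes "infinite (out_arcs G u)"
  shows "leavitt_family G (walk_sc :: 'k::field \<Rightarrow> _) (walk_V G u) (walk_s G u) (walk_g G u)"
proof
  fix v assume v: "regular_vertex G v"
  then have "u \<noteq> v" using assms by (auto simp: regular_vertex_def)
  show "walk_V G u v = (\<Sum>e\<in>out_arcs G v. walk_s G u e * walk_g G u e :: ('b list \<Rightarrow> 'k, 'k) endo)"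
  proof (rule endo_eqI)
    fix f :: "'b list \<Rightarrow> 'k" and k :: 'k
    have "(p \<in> walks_to G u \<and> walk_start G u p = v) \<longleftrightarrow> (p \<in> walks_to G u \<and> p \<noteq> [] \<and> hd p \<in> out_arcs G v)" for p
      using \<open>u \<noteq> v\<close> by (cases p) (auto simp: walk_start_def walks_to_Cons)
    then show "app (walk_V G u v) (f, k) = app (\<Sum>e\<in>out_arcs G v. walk_s G u e * walk_g G u e) (f, k)"
      using v by (simp add: walk_app walk_sg_sum regular_vertex_def)
  qed
qed (rule endo_eqI; auto simp: walk_app fun_eq_iff walks_to_Cons walk_start_def algebra_simps
    zero_prod_def zero_fun_def dest: walks_to_tl; fail)+

end

context leavitt_model
begin

text \<open>In the action on walks to u the element u^H is the projection to the trivial walk, hence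
  nonzero. The generators of the ideal act as zero: no walk to u meets \<open>H\<close>, and for w
  other than u the walks that start at w are nontrivial with first edge in
  \<open>out H w\<close>.\<close>

lemma brk_notin_IHS:
  assumes H: "hereditary H" and u: "u \<in> breaking_vertices E H"
  shows "brk H u \<notin> IHS H (breaking_vertices E H - {u})"
proof
  have uv: "u \<in> verts E" "u \<notin> H" "infinite (out_arcs E u)" using u by (auto simp: breaking_out)
  interpret R: leavitt_family E "walk_sc :: 'k \<Rightarrow> _" "walk_V E u" "walk_s E u" "walk_g E u"
    by (rule walk_family[OF uv(3)])
  define h where "h x = R.eval (tm x)" for x
  have h_eval: "h (eval t) = R.eval t" if "t \<in> lpa_terms E" for t
    unfolding h_def using tm_eval[OF that] by (rule R.eval_cong)
  have h_add: "h (x + y) = h x + h y" if "x \<in> A" "y \<in> A" for x y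
    using h_eval[of "Add (tm x) (tm y)"] tm[OF that(1)] tm[OF that(2)] by (auto simp: h_def intro: lpa_terms.intros)
  have h_mult: "h (x * y) = h x * h y" if "x \<in> A" "y \<in> A" for x y
    using h_eval[of "Mul (tm x) (tm y)"] tm[OF that(1)] tm[OF that(2)] by (auto simp: h_def intro: lpa_terms.intros)
  have h_0: "h 0 = 0" using h_eval[of Null] by (auto intro: lpa_terms.intros)
  have h_V: "h (V v) = walk_V E u v" if "v \<in> verts E" for v
    using h_eval[of "Vertex v"] that by (auto intro: lpa_terms.intros)
  have h_sg: "h (s e * g e) = walk_s E u e * walk_g E u e" if "e \<in> arcs E" for e
    using h_eval[of "Mul (Edge e) (Ghost e)"] that by (auto intro: lpa_terms.intros)
  have h_sum: "h (sum f I) = (\<Sum>i\<in>I. h (f i))" if "\<And>i. i \<in> I \<Longrightarrow> f i \<in> A" for f and I :: "'e set"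
    using that by (induction I rule: infinite_finite_induct) (auto simp: h_0 h_add A_sum)
  define K where "K = {x \<in> A. h x = 0}"
  have K: "ideal K"
    unfolding ideal_def lideal_def K_def by (auto simp: h_add h_mult h_0 A_0 A_add A_mult)
  have avoid: "walk_start E u p \<notin> H \<and> (p \<noteq> [] \<longrightarrow> head E (hd p) \<notin> H)" if "p \<in> walks_to E u" for p
  proof -
    obtain x where x: "awalk x p u" using \<open>p \<in> walks_to E u\<close> by (auto simp: walks_to_def)
    show ?thesis
      using awalk_avoids[OF H x uv(2)] uv(2) by (cases p) (auto simp: walk_start_def)
  qed
  have h_brk: "app (h (brk H w)) z = (\<lambda>p. if p \<in> walks_to E u \<and> walk_start E u p = w \<and> p = [] then fst z p else 0, 0)"
    if w: "w \<in> breaking_vertices E H" for w z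
  proof -
    have wv: "w \<in> verts E" and fin: "finite (out H w)" using w by (auto simp: breaking_out)
    have sgA: "s e * g e \<in> A" if "e \<in> out H w" for e using outD[OF that] by (intro A_mult A_s A_g) auto
    have "h (brk H w) + h (\<Sum>e\<in>out H w. s e * g e) = h (V w)"
      using h_add[OF brk_A[OF w] A_sum[of "out H w" "\<lambda>e. s e * g e"]] sgA by (simp add: brk_def)
    moreover have "h (\<Sum>e\<in>out H w. s e * g e) = (\<Sum>e\<in>out H w. walk_s E u e * walk_g E u e)"
      using sgA h_sg outD by (subst h_sum) (auto intro!: sum.cong)
    ultimately have "h (brk H w) = walk_V E u w - (\<Sum>e\<in>out H w. walk_s E u e * walk_g E u e)"
      using h_V[OF wv] by (simp add: eq_diff_eq)
    then have "h (brk H w) + (\<Sum>e\<in>out H w. walk_s E u e * walk_g E u e) = walk_V E u w" by simp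
    then have "app (h (brk H w)) z + app (\<Sum>e\<in>out H w. walk_s E u e * walk_g E u e) z = app (walk_V E u w) z"
      by (simp flip: app_simps(3))
    then have "app (h (brk H w)) z = app (walk_V E u w) z - app (\<Sum>e\<in>out H w. walk_s E u e * walk_g E u e) z"
      by (simp add: eq_diff_eq)
    also have "\<dots> = (\<lambda>p. if p \<in> walks_to E u \<and> walk_start E u p = w \<and> p = [] then fst z p else 0, 0)"
    proof -
      have "(p \<in> walks_to E u \<and> p \<noteq> [] \<and> hd p \<in> out H w) \<longleftrightarrow> (p \<in> walks_to E u \<and> walk_start E u p = w \<and> p \<noteq> [])" for p
        using avoid[of p] by (cases p) (auto simp: out_def walk_start_def walks_to_Cons)
      then show ?thesis by (auto simp: walk_sg_sum[OF fin] walk_app fun_eq_iff)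
    qed
    finally show ?thesis .
  qed
  have "IHS H (breaking_vertices E H - {u}) \<subseteq> K"
  proof (rule IHS_least[OF K])
    show "V ` H \<subseteq> K"
    proof
      fix x assume "x \<in> V ` H"
      then obtain v where v: "v \<in> H" "x = V v" by blast
      have vv: "v \<in> verts E" using v H by (auto simp: hereditary_def)
      have "walk_V E u v = (0 :: ('e list \<Rightarrow> 'k, 'k) endo)"
        by (rule endo_eqI) (use avoid v in \<open>auto simp: walk_app zero_prod_def zero_fun_def fun_eq_iff\<close>)
      then show "x \<in> K" using v h_V[OF vv] A_V[OF vv] by (simp add: K_def)
    qed
    show "brk H ` (breaking_vertices E H - {u}) \<subseteq> K"
    proof
      fix x assume "x \<in> brk H ` (breaking_vertices E H - {u})"
      then obtain w where w: "w \<in> breaking_vertices E H" "w \<noteq> u" "x = brk H w" by blast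
      have "h (brk H w) = 0"
        by (rule endo_eqI) (use w in \<open>auto simp: h_brk[OF w(1)] walk_start_def zero_prod_def zero_fun_def fun_eq_iff\<close>)
      then show "x \<in> K" using w brk_A by (simp add: K_def)
    qed
  qed
  moreover assume "brk H u \<in> IHS H (breaking_vertices E H - {u})"
  ultimately have "h (brk H u) = 0" by (auto simp: K_def)
  then have "app (h (brk H u)) (\<lambda>_. 1, 0) = 0" by simp
  then have "(if [] \<in> walks_to E u \<and> walk_start E u [] = u then 1 else 0 :: 'k) = 0"
    unfolding h_brk[OF u] by (auto simp: zero_prod_def zero_fun_def fun_eq_iff split: if_splits)
  moreover have "[] \<in> walks_to E u" using uv by (auto simp: walks_to_def awalk_Nil_iff)
  ultimately show False by (simp add: walk_start_def)
qed

theorem conds_imp_primitive: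
  assumes I: "ideal P" and ne: "P \<noteq> A" and c: "primitive_conds P"
  shows "\<exists>N v. maximal_at N v \<and> P = core N"
proof -
  let ?H = "vts P"
  let ?B = "breaking_vertices E ?H"
  consider "primep P" "\<not> graded P"
    | u where "primep P" "u \<in> ?B" "P = IHS ?H (?B - {u})"
    | "P = IHS ?H ?B" "MT3 E (verts E - ?H)" "condition_L E (verts E - ?H)" "countable_separation E (verts E - ?H)"
    using c unfolding primitive_conds_def Let_def by blast
  then show ?thesis
  proof cases
    case 1 then show ?thesis by (rule primitive_nongraded)
  next
    case (2 u)
    \<comment> \<open>That u^H is really missing from P must be extracted from the form of P, for
      which the independence of the breaking vertices is needed.\<close>
    have "brk ?H u \<notin> P" using brk_notin_IHS[OF vts_hereditary[OF I] 2(2)] 2(3) by simp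
    then show ?thesis using primitive_of_breaking[OF 2(1,2)] by blast
  next
    case 3 then show ?thesis by (rule primitive_countable[OF I ne])
  qed
qed

end

section \<open>The involution\<close>

primrec star_term :: "('v, 'e, 'k) lpa_term \<Rightarrow> ('v, 'e, 'k) lpa_term" where
  "star_term (Vertex v) = Vertex v"
| "star_term (Edge e) = Ghost e"
| "star_term (Ghost e) = Edge e"
| "star_term Null = Null"
| "star_term (Add a b) = Add (star_term a) (star_term b)"
| "star_term (Mul a b) = Mul (star_term b) (star_term a)"
| "star_term (Scl x a) = Scl x (star_term a)"

lemma star_term_in_terms: "a \<in> lpa_terms E \<Longrightarrow> star_term a \<in> lpa_terms E"
  by (induction rule: lpa_terms.induct) (auto intro: lpa_terms.intros)

lemma star_term_star_term [simp]: "star_term (star_term a) = a"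
  by (induction a) auto

context leavitt_model
begin

lemma eval_star_axiom: "algebra_axiom a b \<Longrightarrow> eval (star_term a) = eval (star_term b)"
proof (induction rule: algebra_axiom.induct)
  case (12 x a b)
  have "eval (star_term b) * sc x * eval (star_term a) = sc x * eval (star_term b) * eval (star_term a)"
    by (simp only: eval_sc)
  then show ?case by (simp add: mult.assoc)
qed (simp_all add: distrib_left distrib_right add.assoc mult.assoc sc_add sc_mult sc_1 sc_minus add.commute)

lemma eval_star_foldr:
  "distinct es \<Longrightarrow> eval (star_term (foldr (\<lambda>e. Add (Mul (Edge e) (Ghost e))) es Null)) = (\<Sum>e\<in>set es. s e * g e)"
  by (induction es) auto

text \<open>The involution permutes the relations: those for edges and for ghost edges are
  exchanged, and the defining sum at a regular vertex is fixed term by term.\<close>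

lemma eval_star_relation: "lpa_relation E a b \<Longrightarrow> eval (star_term a) = eval (star_term b)"
proof (induction rule: lpa_relation.induct)
  case (9 v es)
  then show ?case using CK[of v] by (simp add: eval_star_foldr)
next
  case (8 e f)
  then show ?case using g_s_orth[of f e] by simp
qed (auto simp: V_idem V_orth tail_s s_head head_g g_tail g_s)

lemma eval_star_cong: "lpa_eq E a b \<Longrightarrow> eval (star_term a) = eval (star_term b)"
  by (induction rule: lpa_eq.induct) (auto simp: eval_star_axiom eval_star_relation)

definition star :: "'a \<Rightarrow> 'a" where "star x = eval (star_term (tm x))"

lemma star_eval: "t \<in> lpa_terms E \<Longrightarrow> star (eval t) = eval (star_term t)"
  unfolding star_def using tm_eval eval_star_cong by blast

lemma star_A: "x \<in> A \<Longrightarrow> star x \<in> A"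
  using tm[of x] star_term_in_terms[of "tm x" E] by (auto simp: star_def A_def)

lemma star_star: "x \<in> A \<Longrightarrow> star (star x) = x"
  using tm[of x] star_eval[of "star_term (tm x)"] star_term_in_terms[of "tm x" E] by (simp add: star_def)

lemma star_add: "x \<in> A \<Longrightarrow> y \<in> A \<Longrightarrow> star (x + y) = star x + star y"
  using star_eval[of "Add (tm x) (tm y)"] tm[of x] tm[of y] by (auto simp: star_def intro: lpa_terms.intros)

lemma star_mult: "x \<in> A \<Longrightarrow> y \<in> A \<Longrightarrow> star (x * y) = star y * star x"
  using star_eval[of "Mul (tm x) (tm y)"] tm[of x] tm[of y] by (auto simp: star_def intro: lpa_terms.intros)

lemma star_sc: "x \<in> A \<Longrightarrow> star (sc k * x) = sc k * star x"
  using star_eval[of "Scl k (tm x)"] tm[of x] by (auto simp: star_def intro: lpa_terms.intros)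

lemma star_0: "star 0 = 0"
  using star_eval[of Null] by (auto intro: lpa_terms.intros)

lemma star_V: "v \<in> verts E \<Longrightarrow> star (V v) = V v"
  and star_s: "e \<in> arcs E \<Longrightarrow> star (s e) = g e"
  and star_g: "e \<in> arcs E \<Longrightarrow> star (g e) = s e"
  using star_eval[of "Vertex v"] star_eval[of "Edge e"] star_eval[of "Ghost e"]
  by (auto intro: lpa_terms.intros)

lemma star_sum: "(\<And>i. i \<in> I \<Longrightarrow> f i \<in> A) \<Longrightarrow> star (sum f I) = (\<Sum>i\<in>I. star (f i))"
  by (induction I rule: infinite_finite_induct) (auto simp: star_0 star_add A_sum)

lemma star_diff: "x \<in> A \<Longrightarrow> y \<in> A \<Longrightarrow> star (x - y) = star x - star y"
  using star_add[of "x - y" y] by (simp add: A_diff)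

lemma star_brk: "u \<in> breaking_vertices E H \<Longrightarrow> star (brk H u) = brk H u"
proof -
  assume u: "u \<in> breaking_vertices E H"
  have sg: "s e * g e \<in> A" "star (s e * g e) = s e * g e" if "e \<in> out H u" for e
    using outD[OF that] by (auto simp: star_mult star_s star_g A_s A_g A_mult)
  have "star (\<Sum>e\<in>out H u. s e * g e) = (\<Sum>e\<in>out H u. s e * g e)"
    using sg by (simp add: star_sum)
  then show ?thesis
    using sg brk_u(1)[OF u] by (simp add: brk_def star_diff star_V A_V A_sum)
qed

lemma star_pe: "awalk u \<alpha> w \<Longrightarrow> star (pe \<alpha> * V w) = V w * ge \<alpha>"
proof (induction \<alpha> arbitrary: u)
  case (Cons e \<alpha>)
  then have e: "e \<in> arcs E" "awalk (head E e) \<alpha> w" by (auto simp: awalk_Cons_iff)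
  then show ?case using Cons.IH[OF e(2)]
    by (simp add: mult.assoc star_mult A_s A_pe star_s)
qed (auto simp: awalk_Nil_iff star_V)

lemma star_mon:
  assumes "awalk u \<alpha> w" "awalk u' \<beta> w"
  shows "star (pe \<alpha> * V w * ge \<beta>) = pe \<beta> * V w * ge \<alpha>"
proof -
  have w: "w \<in> verts E" using assms by auto
  have "star (V w * ge \<beta>) = pe \<beta> * V w"
    using star_star[OF A_pe[OF assms(2)]] star_pe[OF assms(2)] by simp
  then show ?thesis
    using star_pe[OF assms(1)] A_pe[OF assms(1)] A_ge[OF assms(2)]
    unfolding pe_V_ge[OF w] by (simp add: star_mult)
qed

lemma gr_star: "x \<in> A \<Longrightarrow> gr n (star x) = star (gr (- n) x)"
proof (induction x rule: A_mon_induct)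
  case (mon k \<alpha> w \<beta> u u')
  have "star (sc k * (pe \<alpha> * V w * ge \<beta>)) = sc k * (pe \<beta> * V w * ge \<alpha>)"
    using star_sc[OF A_mon[OF mon]] star_mon[OF mon] by simp
  then show ?case
    using gr_homog[OF homog_mon[OF mon(2,1), THEN homog_sc], of n k]
      gr_homog[OF homog_mon[OF mon, THEN homog_sc], of "- n" k] by (auto simp: star_0)
qed (auto simp: star_0 star_add gr_add star_A gr_A)

lemma star_image_iff: "P \<subseteq> A \<Longrightarrow> x \<in> A \<Longrightarrow> x \<in> star ` P \<longleftrightarrow> star x \<in> P"
proof
  assume "P \<subseteq> A" "x \<in> A" "x \<in> star ` P"
  then show "star x \<in> P" using star_star by auto
next
  assume "P \<subseteq> A" "x \<in> A" "star x \<in> P"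
  then show "x \<in> star ` P" by (intro image_eqI[of _ _ "star x"]) (simp_all add: star_star)
qed

lemma star_image_A: "P \<subseteq> A \<Longrightarrow> star ` P \<subseteq> A"
  using star_A by blast

lemma star_star_image: "P \<subseteq> A \<Longrightarrow> star ` star ` P = P"
proof -
  assume P: "P \<subseteq> A"
  have "star ` star ` P = (\<lambda>x. x) ` P"
    unfolding image_image by (rule image_cong) (use P star_star in auto)
  then show ?thesis by simp
qed

lemma ideal_star: "ideal P \<Longrightarrow> ideal (star ` P)"
proof -
  assume P: "ideal P"
  note I = idealD[OF P]
  have sub: "star ` P \<subseteq> A" by (rule star_image_A[OF I(1)])
  have iff: "x \<in> star ` P \<longleftrightarrow> star x \<in> P" if "x \<in> A" for x by (rule star_image_iff[OF I(1) that])
  have "0 \<in> star ` P" using iff[OF A_0] I(3) star_0 by simp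
  moreover have "x + y \<in> star ` P" if "x \<in> star ` P" "y \<in> star ` P" for x y
  proof -
    have "x \<in> A" "y \<in> A" using that sub by auto
    then show ?thesis using that iff[of x] iff[of y] iff[of "x + y"] I(4) by (simp add: star_add A_add)
  qed
  moreover have "a * x \<in> star ` P" "x * a \<in> star ` P" if "a \<in> A" "x \<in> star ` P" for a x
  proof -
    have x: "x \<in> A" using that sub by auto
    then have "star x \<in> P" using that iff by blast
    then have "star (a * x) \<in> P" "star (x * a) \<in> P"
      using that x I star_A[OF that(1)] by (simp_all add: star_mult)
    then show "a * x \<in> star ` P" "x * a \<in> star ` P" using iff that x A_mult by blast+
  qed
  ultimately show ?thesis using sub unfolding ideal_def lideal_def by blast
qed

lemma vts_star: "P \<subseteq> A \<Longrightarrow> vts (star ` P) = vts P"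
  unfolding vts_def by (intro Collect_cong conj_cong refl) (simp add: star_image_iff A_V star_V)

lemma graded_star: "P \<subseteq> A \<Longrightarrow> graded P \<Longrightarrow> graded (star ` P)"
proof -
  assume P: "P \<subseteq> A" "graded P"
  have "gr n (star x) \<in> star ` P" if "x \<in> P" for n x
    using P that gr_star[of x n] by (auto simp: graded_def)
  then show ?thesis by (auto simp: graded_def)
qed

lemma primep_star: "primep P \<Longrightarrow> primep (star ` P)"
proof -
  assume P: "primep P"
  note I = primep_ideal[OF P]
  have iff: "x \<in> star ` P \<longleftrightarrow> star x \<in> P" if "x \<in> A" for x by (rule star_image_iff[OF idealD(1)[OF I] that])
  have "star ` P \<noteq> A"
  proof
    assume "star ` P = A"
    then have "star x \<in> P" if "x \<in> A" for x using iff that by blast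
    then have "star (star x) \<in> P" if "x \<in> A" for x using star_A that by blast
    then have "x \<in> P" if "x \<in> A" for x using star_star that by simp
    then show False using P idealD(1)[OF I] unfolding primep_def by blast
  qed
  moreover have "\<exists>a\<in>A. x * a * y \<notin> star ` P"
    if xy: "x \<in> A" "y \<in> A" "x \<notin> star ` P" "y \<notin> star ` P" for x y
  proof -
    obtain a where a: "a \<in> A" "star y * a * star x \<notin> P"
      using primepD[OF P star_A[OF xy(2)] star_A[OF xy(1)]] iff xy by blast
    have "star (x * star a * y) = star y * a * star x"
      using a xy by (simp add: star_mult star_A A_mult star_star mult.assoc)
    then show ?thesis using a iff[of "x * star a * y"] xy star_A[OF a(1)] by (auto simp: A_mult)
  qed
  ultimately show ?thesis using ideal_star[OF I] unfolding primep_def by blast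
qed

text \<open>The generators are fixed by the involution, which gives one inclusion; applying the
  involution to it gives the other.\<close>

lemma IHS_star:
  assumes H: "hereditary H" and S: "S \<subseteq> breaking_vertices E H"
  shows "star ` IHS H S = IHS H S"
proof -
  note I = IHS_ideal[OF H S]
  have sub: "IHS H S \<subseteq> star ` IHS H S"
  proof (rule IHS_least[OF ideal_star[OF I]])
    show "V ` H \<subseteq> star ` IHS H S"
    proof
      fix x assume "x \<in> V ` H"
      then obtain v where v: "v \<in> H" "x = V v" by blast
      then have "v \<in> verts E" using H by (auto simp: hereditary_def)
      then show "x \<in> star ` IHS H S" using v IHS_V[OF H S v(1)] star_V by (intro image_eqI[of _ _ "V v"]) auto
    qed
    show "brk H ` S \<subseteq> star ` IHS H S"
    proof
      fix x assume "x \<in> brk H ` S"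
      then obtain u where u: "u \<in> S" "x = brk H u" by blast
      then show "x \<in> star ` IHS H S" using IHS_brk[OF H S u(1)] star_brk S by (intro image_eqI[of _ _ "brk H u"]) auto
    qed
  qed
  then have "star ` IHS H S \<subseteq> star ` star ` IHS H S" by (rule image_mono)
  then show ?thesis using sub star_star_image[OF idealD(1)[OF I]] by blast
qed

lemma primitive_conds_star:
  assumes P: "ideal P" and c: "primitive_conds P"
  shows "primitive_conds (star ` P)"
proof -
  let ?H = "vts P"
  let ?B = "breaking_vertices E ?H"
  note PA = idealD(1)[OF P]
  have H: "hereditary ?H" by (rule vts_hereditary[OF P])
  have gr: "graded (star ` P) \<longleftrightarrow> graded P"
    using graded_star[OF PA] graded_star[OF star_image_A[OF PA]] star_star_image[OF PA] by auto
  have IHS: "star ` P = IHS ?H S" if "P = IHS ?H S" "S \<subseteq> ?B" for S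
    using IHS_star[OF H that(2)] that(1) by simp
  consider "primep P" "\<not> graded P"
    | u where "graded P" "primep P" "u \<in> ?B" "P = IHS ?H (?B - {u})"
    | "graded P" "P = IHS ?H ?B" "MT3 E (verts E - ?H)" "condition_L E (verts E - ?H)" "countable_separation E (verts E - ?H)"
    using c unfolding primitive_conds_def Let_def by blast
  then show ?thesis
  proof cases
    case 1
    then show ?thesis using gr primep_star by (simp add: primitive_conds_def Let_def)
  next
    case 2
    have "star ` P = IHS ?H (?B - {u})" by (rule IHS[OF 2(4)]) blast
    then have "\<exists>u\<in>?B. star ` P = IHS ?H (?B - {u})" by (rule bexI) (rule 2(3))
    then show ?thesis using 2(1) gr primep_star[OF 2(2)]
      by (simp only: primitive_conds_def Let_def vts_star[OF PA] simp_thms)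
  next
    case 3
    then show ?thesis using gr IHS[OF 3(2) order_refl]
      by (simp only: primitive_conds_def Let_def vts_star[OF PA] simp_thms)
  qed
qed

end

section \<open>Transport to the presented algebra\<close>

lemma lpa_eq_in_terms: "lpa_eq E a b \<Longrightarrow> a \<in> lpa_terms E \<and> b \<in> lpa_terms E"
  by (induction rule: lpa_eq.induct) (auto intro: lpa_terms.intros)

context leavitt_model
begin

abbreviation R :: "('k, ('v, 'e, 'k) lpa_term set) module" where "R \<equiv> leavitt E"

text \<open>This is the isomorphism from the copy \<open>A\<close> inside the ring onto the
  presented algebra; ideals of the latter are carried back by \<open>pull\<close>.\<close>

definition cls :: "'a \<Rightarrow> ('v, 'e, 'k) lpa_term set" where "cls x = lpa_class E (tm x)"

definition pull :: "('v, 'e, 'k) lpa_term set set \<Rightarrow> 'a set" where "pull P = {x \<in> A. cls x \<in> P}"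

lemma lpa_class_eq: "lpa_eq E a b \<Longrightarrow> lpa_class E a = lpa_class E b"
  unfolding lpa_class_def using lpa_eq_sym lpa_eq_trans by blast

lemma cls_eval: "t \<in> lpa_terms E \<Longrightarrow> lpa_class E t = cls (eval t)"
  unfolding cls_def using tm_eval lpa_class_eq lpa_eq_sym by blast

lemma cls_inj: "x \<in> A \<Longrightarrow> y \<in> A \<Longrightarrow> cls x = cls y \<longleftrightarrow> x = y"
proof
  assume "x \<in> A" "y \<in> A" "cls x = cls y"
  then have "tm y \<in> lpa_class E (tm x)"
    using tm[of y] unfolding cls_def by (simp add: lpa_class_def lpa_eq_refl)
  then have "lpa_eq E (tm x) (tm y)" by (simp add: lpa_class_def)
  then have "eval (tm x) = eval (tm y)" by (rule eval_cong)
  then show "x = y" using tm \<open>x \<in> A\<close> \<open>y \<in> A\<close> by simp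
qed simp

lemma carrier_R: "carrier R = cls ` A"
proof -
  have "carrier R = lpa_class E ` lpa_terms E" by (simp add: leavitt_def)
  also have "\<dots> = (\<lambda>t. cls (eval t)) ` lpa_terms E" by (rule image_cong) (auto simp: cls_eval)
  also have "\<dots> = cls ` A" by (simp add: A_def image_image)
  finally show ?thesis .
qed

lemma cls_carrier: "x \<in> A \<Longrightarrow> cls x \<in> carrier R"
  by (simp add: carrier_R)

lemma zero_R: "\<zero>\<^bsub>R\<^esub> = cls 0"
  using cls_eval[of Null] by (simp add: leavitt_def lpa_terms.intros)

text \<open>The operations of \<open>leavitt\<close> are unions over all representatives. By the
  congruence rules all members of such a union coincide.\<close>

lemma lift_R:
  assumes f: "\<And>a a' b b'. lpa_eq E a a' \<Longrightarrow> lpa_eq E b b' \<Longrightarrow> lpa_eq E (f a b) (f a' b')"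
    and x: "x \<in> A" and y: "y \<in> A"
  shows "(\<Union>a\<in>cls x. \<Union>b\<in>cls y. lpa_class E (f a b)) = cls (eval (f (tm x) (tm y)))"
proof -
  have t: "tm x \<in> lpa_terms E" "tm y \<in> lpa_terms E" using tm x y by auto
  have "lpa_class E (f a b) = lpa_class E (f (tm x) (tm y))" if "a \<in> cls x" "b \<in> cls y" for a b
    using that f[of "tm x" a "tm y" b] lpa_class_eq lpa_eq_sym by (simp add: cls_def lpa_class_def) blast
  moreover have "tm x \<in> cls x" "tm y \<in> cls y" using t by (auto simp: cls_def lpa_class_def lpa_eq_refl)
  ultimately have "(\<Union>a\<in>cls x. \<Union>b\<in>cls y. lpa_class E (f a b)) = lpa_class E (f (tm x) (tm y))" by blast
  also have "f (tm x) (tm y) \<in> lpa_terms E"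
    using f[OF lpa_eq_refl[OF t(1)] lpa_eq_refl[OF t(2)]] lpa_eq_in_terms by blast
  then have "lpa_class E (f (tm x) (tm y)) = cls (eval (f (tm x) (tm y)))" by (rule cls_eval)
  finally show ?thesis .
qed

lemma add_R: "x \<in> A \<Longrightarrow> y \<in> A \<Longrightarrow> cls x \<oplus>\<^bsub>R\<^esub> cls y = cls (x + y)"
  using lift_R[of Add x y] tm[of x] tm[of y] by (simp add: leavitt_def lpa_eq_Add)

lemma mult_R: "x \<in> A \<Longrightarrow> y \<in> A \<Longrightarrow> cls x \<otimes>\<^bsub>R\<^esub> cls y = cls (x * y)"
  using lift_R[of Mul x y] tm[of x] tm[of y] by (simp add: leavitt_def lpa_eq_Mul)

lemma abelian_group_R: "abelian_group R"
proof (rule abelian_groupI)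
  show "\<exists>y\<in>carrier R. y \<oplus>\<^bsub>R\<^esub> x = \<zero>\<^bsub>R\<^esub>" if "x \<in> carrier R" for x
  proof -
    from that obtain a where "a \<in> A" "x = cls a" by (auto simp: carrier_R)
    then show ?thesis by (intro bexI[of _ "cls (- a)"]) (auto simp: add_R zero_R carrier_R A_uminus)
  qed
qed (auto simp: carrier_R add_R zero_R A_add A_0 algebra_simps)

interpretation R: abelian_group R
  by (rule abelian_group_R)

lemma minus_R: "x \<in> A \<Longrightarrow> \<ominus>\<^bsub>R\<^esub> cls x = cls (- x)"
  by (rule R.minus_equality) (auto simp: add_R zero_R cls_carrier A_uminus)

lemma diff_R: "x \<in> A \<Longrightarrow> y \<in> A \<Longrightarrow> cls x \<ominus>\<^bsub>R\<^esub> cls y = cls (x - y)"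
  by (simp add: a_minus_def minus_R add_R A_uminus)

lemma finsum_R:
  "finite I \<Longrightarrow> (\<And>i. i \<in> I \<Longrightarrow> f i \<in> A) \<Longrightarrow> (\<Oplus>\<^bsub>R\<^esub>i\<in>I. cls (f i)) = cls (sum f I)"
proof (induction I rule: finite_induct)
  case (insert i I)
  then have "(\<lambda>i. cls (f i)) \<in> I \<rightarrow> carrier R" "cls (f i) \<in> carrier R" by (auto intro: cls_carrier)
  then have "(\<Oplus>\<^bsub>R\<^esub>i\<in>insert i I. cls (f i)) = cls (f i) \<oplus>\<^bsub>R\<^esub> (\<Oplus>\<^bsub>R\<^esub>i\<in>I. cls (f i))"
    using insert by (intro R.finsum_insert)
  then show ?case using insert by (simp add: add_R A_sum)
qed (simp add: zero_R)

lemma pull_image: "X \<subseteq> A \<Longrightarrow> pull (cls ` X) = X"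
  using cls_inj by (auto simp: pull_def)

lemma image_pull: "P \<subseteq> carrier R \<Longrightarrow> cls ` pull P = P"
  by (auto simp: pull_def carrier_R)

lemma rng_ideal_sub: "rng_ideal R P \<Longrightarrow> P \<subseteq> carrier R"
  using additive_subgroup.a_subset unfolding rng_ideal_def by blast

lemma rng_ideal_pull:
  assumes P: "rng_ideal R P"
  shows "ideal (pull P)"
proof -
  interpret additive_subgroup P R using P by (simp add: rng_ideal_def)
  have m: "cls (a * x) \<in> P" "cls (x * a) \<in> P" if "a \<in> A" "x \<in> A" "cls x \<in> P" for a x
    using P that cls_carrier[OF that(1)] unfolding rng_ideal_def by (auto simp flip: mult_R)
  show ?thesis
    unfolding ideal_def lideal_def pull_def
    using m zero_closed a_closed by (auto simp: A_0 A_add A_mult zero_R simp flip: add_R)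
qed

lemma ideal_rng_ideal:
  assumes I: "ideal I"
  shows "rng_ideal R (cls ` I)"
  unfolding rng_ideal_def
proof
  note D = idealD[OF I]
  show "additive_subgroup (cls ` I) R"
    unfolding additive_subgroup_def
  proof (rule subgroup.intro)
    fix x assume "x \<in> cls ` I"
    then obtain a where a: "a \<in> I" "x = cls a" by blast
    have "inv\<^bsub>add_monoid R\<^esub> x = cls (- a)" using minus_R[of a] a D by (simp add: a_inv_def)
    then show "inv\<^bsub>add_monoid R\<^esub> x \<in> cls ` I" using a D by simp
  qed (use D in \<open>auto simp: zero_R add_R carrier_R\<close>)
  show "\<forall>a\<in>cls ` I. \<forall>x\<in>carrier R. x \<otimes>\<^bsub>R\<^esub> a \<in> cls ` I \<and> a \<otimes>\<^bsub>R\<^esub> x \<in> cls ` I"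
    using D by (auto simp: carrier_R mult_R)
qed

lemma rng_ideal_iff: "rng_ideal R P \<longleftrightarrow> P \<subseteq> carrier R \<and> ideal (pull P)"
  using rng_ideal_sub rng_ideal_pull ideal_rng_ideal[of "pull P"] image_pull by metis

lemma ideal_generated_R:
  assumes X: "X \<subseteq> A"
  shows "ideal_generated R (cls ` X) = cls ` gen X"
proof
  have "rng_ideal R (cls ` gen X)" "cls ` X \<subseteq> cls ` gen X"
    using ideal_rng_ideal[OF ideal_gen[OF X]] gen_incl by auto
  then show "ideal_generated R (cls ` X) \<subseteq> cls ` gen X" unfolding ideal_generated_def by blast
  show "cls ` gen X \<subseteq> ideal_generated R (cls ` X)"
    unfolding ideal_generated_def
  proof (rule Inter_greatest)
    fix I assume "I \<in> {I. rng_ideal R I \<and> cls ` X \<subseteq> I}"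
    then have I: "rng_ideal R I" "cls ` X \<subseteq> I" by auto
    then have "X \<subseteq> pull I" using X by (auto simp: pull_def)
    then have "gen X \<subseteq> pull I" by (rule gen_least[OF rng_ideal_pull[OF I(1)]])
    then show "cls ` gen X \<subseteq> I" by (auto simp: pull_def)
  qed
qed

lemma ideal_vertices_pull: "ideal_vertices E P = vts (pull P)"
proof -
  have "lpa_class E (Vertex v) = cls (V v)" if "v \<in> verts E" for v
    using cls_eval[of "Vertex v"] that by (simp add: lpa_terms.intros)
  then show ?thesis by (auto simp: ideal_vertices_def vts_def pull_def A_V)
qed

lemma breaking_element_R:
  assumes u: "u \<in> breaking_vertices E H"
  shows "breaking_element E H u = cls (brk H u)"
proof -
  have uv: "u \<in> verts E" "finite (out H u)" using brk_u[OF u] by auto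
  have c: "lpa_class E (Vertex u) = cls (V u)" using cls_eval[of "Vertex u"] uv by (simp add: lpa_terms.intros)
  have eg: "lpa_class E (Edge e) \<otimes>\<^bsub>R\<^esub> lpa_class E (Ghost e) = cls (s e * g e)" "s e * g e \<in> A"
    if "e \<in> out H u" for e
    using outD[OF that] cls_eval[of "Edge e"] cls_eval[of "Ghost e"]
    by (simp_all add: lpa_terms.intros mult_R A_s A_g A_mult)
  have "(\<Oplus>\<^bsub>R\<^esub>e\<in>out H u. lpa_class E (Edge e) \<otimes>\<^bsub>R\<^esub> lpa_class E (Ghost e)) = (\<Oplus>\<^bsub>R\<^esub>e\<in>out H u. cls (s e * g e))"
    using eg by (intro R.finsum_cong') (auto intro: cls_carrier)
  also have "\<dots> = cls (\<Sum>e\<in>out H u. s e * g e)" using eg uv by (intro finsum_R)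
  finally have sum: "(\<Oplus>\<^bsub>R\<^esub>e\<in>out H u. lpa_class E (Edge e) \<otimes>\<^bsub>R\<^esub> lpa_class E (Ghost e)) =
    cls (\<Sum>e\<in>out H u. s e * g e)" .
  have "(\<Sum>e\<in>out H u. s e * g e) \<in> A" by (rule A_sum) (rule eg(2))
  then show ?thesis
    unfolding breaking_element_def c out_def[symmetric] sum using uv by (simp add: diff_R brk_def A_V)
qed

lemma ideal_HS_R:
  assumes H: "hereditary H" and S: "S \<subseteq> breaking_vertices E H"
  shows "ideal_HS E H S = cls ` IHS H S"
proof -
  have "(\<lambda>v. lpa_class E (Vertex v)) ` H = cls ` V ` H"
    unfolding image_image using H cls_eval[of "Vertex v" for v]
    by (intro image_cong) (auto simp: hereditary_def lpa_terms.intros)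
  moreover have "breaking_element E H ` S = cls ` brk H ` S"
    unfolding image_image using S breaking_element_R by (intro image_cong) auto
  moreover have "V ` H \<union> brk H ` S \<subseteq> A" using IHS_gens[OF H S] by (auto simp: homog_def)
  ultimately show ?thesis
    unfolding ideal_HS_def IHS_def using ideal_generated_R by (simp flip: image_Un)
qed

lemma proper_ideal_R: "proper_ideal R P \<longleftrightarrow> P \<subseteq> carrier R \<and> ideal (pull P) \<and> pull P \<noteq> A"
proof -
  have "P = carrier R \<longleftrightarrow> pull P = A" if "P \<subseteq> carrier R"
    using image_pull[OF that] pull_image[of A] carrier_R by auto
  then show ?thesis unfolding proper_ideal_def rng_ideal_iff by blast
qed

text \<open>If x A y lies in P, then B, the set of b with x A b in P, and C, the set of c with c A B
  in P, are ideals that contain y and x. Their product lies in P because of local units. This avoids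
  describing the ideals generated by x and y in a ring without unit.\<close>

lemma prime_ideal_pull:
  assumes P: "prime_ideal R P"
  shows "primep (pull P)"
proof -
  have pr: "proper_ideal R P" using P by (simp add: prime_ideal_def)
  then have I: "ideal (pull P)" and ne: "pull P \<noteq> A" by (auto simp: proper_ideal_R)
  note D = idealD[OF I]
  have "\<exists>a\<in>A. x * a * y \<notin> pull P"
    if xy: "x \<in> A" "y \<in> A" "x \<notin> pull P" "y \<notin> pull P" for x y
  proof (rule ccontr)
    assume "\<not> ?thesis"
    then have xay: "x * a * y \<in> pull P" if "a \<in> A" for a using that by blast
    define B where "B = {y \<in> A. \<forall>a\<in>A. x * a * y \<in> pull P}"
    define C where "C = {z \<in> A. \<forall>a\<in>A. \<forall>b\<in>B. z * a * b \<in> pull P}"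
    have BA: "b \<in> A" if "b \<in> B" for b using that by (simp add: B_def)
    have B: "ideal B"
      unfolding ideal_def lideal_def
    proof (intro conjI ballI)
      fix a b assume a: "a \<in> A" and b: "b \<in> B"
      have "x * c * (a * b) \<in> pull P" if "c \<in> A" for c
      proof -
        have "x * (c * a) * b \<in> pull P" using b a that A_mult unfolding B_def by blast
        then show ?thesis by (simp add: mult.assoc)
      qed
      then show "a * b \<in> B" using a BA[OF b] by (simp add: B_def A_mult)
      have "x * c * (b * a) \<in> pull P" if "c \<in> A" for c
      proof -
        have "x * c * b \<in> pull P" using b that unfolding B_def by blast
        then have "x * c * b * a \<in> pull P" by (rule D(9)[OF a])
        then show ?thesis by (simp add: mult.assoc)
      qed
      then show "b * a \<in> B" using a BA[OF b] by (simp add: B_def A_mult)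
    qed (use D in \<open>auto simp: B_def A_0 A_add distrib_left\<close>)
    have C: "ideal C"
      unfolding ideal_def lideal_def
    proof (intro conjI ballI)
      fix a z assume a: "a \<in> A" and z: "z \<in> C"
      then have zA: "z \<in> A" by (simp add: C_def)
      have "a * z * c * b \<in> pull P" if "c \<in> A" "b \<in> B" for c b
      proof -
        have "z * c * b \<in> pull P" using z that unfolding C_def by blast
        then have "a * (z * c * b) \<in> pull P" by (rule D(5)[OF a])
        then show ?thesis by (simp add: mult.assoc)
      qed
      then show "a * z \<in> C" using a zA by (simp add: C_def A_mult)
      have "z * a * c * b \<in> pull P" if "c \<in> A" "b \<in> B" for c b
      proof -
        have "z * (a * c) * b \<in> pull P" using z a that A_mult unfolding C_def by blast
        then show ?thesis by (simp add: mult.assoc)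
      qed
      then show "z * a \<in> C" using a zA by (simp add: C_def A_mult)
    qed (use D in \<open>auto simp: C_def A_0 A_add distrib_right\<close>)
    have CB: "z * b \<in> pull P" if zb: "z \<in> C" "b \<in> B" for z b
    proof -
      obtain \<epsilon> where \<epsilon>: "\<epsilon> \<in> A" "z * \<epsilon> = z" using local_unit[of z] zb by (auto simp: C_def)
      have "z * \<epsilon> * b \<in> pull P" using zb \<epsilon>(1) unfolding C_def by blast
      then show ?thesis using \<epsilon> by simp
    qed
    have "ideal_prod R (cls ` C) (cls ` B) \<subseteq> cls ` pull P"
    proof
      fix t assume "t \<in> ideal_prod R (cls ` C) (cls ` B)"
      then show "t \<in> cls ` pull P"
      proof induction
        case (prod i j)
        then show ?case using CB idealD(1)[OF C] idealD(1)[OF B] by (auto simp: mult_R subset_iff)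
      next
        case (sum s1 s2)
        then show ?case using D by (auto simp: add_R)
      qed
    qed
    moreover have "cls ` pull P = P" using pr by (intro image_pull) (simp add: proper_ideal_R)
    ultimately have "cls ` C \<subseteq> P \<or> cls ` B \<subseteq> P"
      using P ideal_rng_ideal[OF B] ideal_rng_ideal[OF C] unfolding prime_ideal_def by simp
    moreover have "y \<in> B" using xay xy by (simp add: B_def)
    moreover have "x \<in> C" using xy by (auto simp: C_def B_def)
    ultimately show False using xy by (auto simp: pull_def)
  qed
  then show ?thesis using I ne unfolding primep_def by blast
qed

lemma prime_ideal_R: "prime_ideal R P \<longleftrightarrow> P \<subseteq> carrier R \<and> primep (pull P)"
proof
  assume P: "prime_ideal R P"
  then show "P \<subseteq> carrier R \<and> primep (pull P)"
    using prime_ideal_pull by (auto simp: prime_ideal_def proper_ideal_def dest: rng_ideal_sub)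
next
  assume P: "P \<subseteq> carrier R \<and> primep (pull P)"
  have "A1 \<subseteq> P \<or> B1 \<subseteq> P"
    if AB: "rng_ideal R A1" "rng_ideal R B1" "ideal_prod R A1 B1 \<subseteq> P" for A1 B1
  proof (rule ccontr)
    assume n: "\<not> ?thesis"
    obtain x where x: "x \<in> A" "cls x \<in> A1" "cls x \<notin> P"
      using n rng_ideal_sub[OF AB(1)] by (auto simp: carrier_R)
    obtain y where y: "y \<in> A" "cls y \<in> B1" "cls y \<notin> P"
      using n rng_ideal_sub[OF AB(2)] by (auto simp: carrier_R)
    obtain a where a: "a \<in> A" "x * a * y \<notin> pull P"
      using primepD[of "pull P" x y] P x y by (auto simp: pull_def)
    have "cls x \<otimes>\<^bsub>R\<^esub> cls a \<in> A1" using AB(1) x cls_carrier[OF a(1)] by (simp add: rng_ideal_def)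
    then have "cls (x * a) \<otimes>\<^bsub>R\<^esub> cls y \<in> ideal_prod R A1 B1" using x y a by (intro ideal_prod.prod) (auto simp: mult_R)
    then have "cls (x * a * y) \<in> P" using AB(3) x y a by (auto simp: mult_R A_mult)
    then show False using a x y by (simp add: pull_def A_mult)
  qed
  then show "prime_ideal R P"
    using P primep_ideal[of "pull P"] unfolding prime_ideal_def proper_ideal_R primep_def by blast
qed

lemma homogeneous_term_homog: "homogeneous_term E n t \<Longrightarrow> t \<in> lpa_terms E \<and> homog n (eval t)"
  by (induction rule: homogeneous_term.induct)
    (auto intro: lpa_terms.intros homog_V homog_s homog_g homog_0 homog_add homog_mult homog_sc)

text \<open>Homogeneity in the official sense, by terms of degree n. It agrees with the description
  by Laurent polynomials: \<open>Hom_homog\<close> and \<open>gr_Hom\<close> give the two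
  directions.\<close>

definition Hom :: "int \<Rightarrow> 'a set" where "Hom n = {eval t | t. homogeneous_term E n t}"

lemma Hom_closed:
  "v \<in> verts E \<Longrightarrow> V v \<in> Hom 0" "e \<in> arcs E \<Longrightarrow> s e \<in> Hom 1" "e \<in> arcs E \<Longrightarrow> g e \<in> Hom (- 1)"
  "0 \<in> Hom n" "x \<in> Hom n \<Longrightarrow> y \<in> Hom n \<Longrightarrow> x + y \<in> Hom n" "x \<in> Hom n \<Longrightarrow> y \<in> Hom m \<Longrightarrow> x * y \<in> Hom (n + m)"
  "x \<in> Hom n \<Longrightarrow> sc k * x \<in> Hom n"
  unfolding Hom_def
  by (auto intro: homogeneous_term.intros exI[of _ "Vertex v"] exI[of _ "Edge e"] exI[of _ "Ghost e"] exI[of _ Null]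
    | metis homogeneous_term.intros eval.simps)+

lemma Hom_pe: "awalk u \<alpha> w \<Longrightarrow> pe \<alpha> * V w \<in> Hom (int (length \<alpha>))"
proof (induction \<alpha> arbitrary: u)
  case (Cons e \<alpha>)
  then show ?case using Hom_closed(6)[of "s e" 1 "pe \<alpha> * V w" "int (length \<alpha>)"]
    by (auto simp: awalk_Cons_iff mult.assoc Hom_closed)
qed (auto simp: awalk_Nil_iff Hom_closed)

lemma Hom_ge: "awalk u \<alpha> w \<Longrightarrow> V w * ge \<alpha> \<in> Hom (- int (length \<alpha>))"
proof (induction \<alpha> arbitrary: u)
  case (Cons e \<alpha>)
  have "- int (length (e # \<alpha>)) = - int (length \<alpha>) + - 1" by simp
  then show ?case using Cons Hom_closed(6)[of "V w * ge \<alpha>" "- int (length \<alpha>)" "g e" "- 1"]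
    unfolding \<open>- int (length (e # \<alpha>)) = _\<close> by (auto simp: awalk_Cons_iff mult.assoc Hom_closed)
qed (auto simp: awalk_Nil_iff Hom_closed)

lemma gr_Hom: "x \<in> A \<Longrightarrow> gr n x \<in> Hom n"
proof (induction rule: A_mon_induct)
  case (mon k \<alpha> w \<beta> u u')
  have "w \<in> verts E" using mon by auto
  then have "pe \<alpha> * V w * ge \<beta> \<in> Hom (int (length \<alpha>) + - int (length \<beta>))"
    unfolding pe_V_ge[OF \<open>w \<in> verts E\<close>] using Hom_pe[OF mon(1)] Hom_ge[OF mon(2)] by (intro Hom_closed(6))
  then show ?case using gr_homog[OF homog_mon[OF mon, THEN homog_sc], of n k] by (auto simp: Hom_closed)
qed (auto simp: gr_add Hom_closed)

lemma homogeneous_component_R: "homogeneous_component E n = cls ` Hom n"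
  unfolding homogeneous_component_def Hom_def using homogeneous_term_homog cls_eval by fastforce

lemma Hom_homog: "x \<in> Hom n \<Longrightarrow> homog n x"
  using homogeneous_term_homog by (auto simp: Hom_def)

text \<open>The official notion only asks for some decomposition inside the ideal. As
  \<open>gr\<close> recovers the homogeneous summands of any decomposition, the components
  themselves then lie in the ideal.\<close>

lemma graded_ideal_R: "graded_ideal E P \<longleftrightarrow> P \<subseteq> carrier R \<and> ideal (pull P) \<and> graded (pull P)"
proof
  assume P: "graded_ideal E P"
  then have r: "rng_ideal R P" by (simp add: graded_ideal_def)
  note D = idealD[OF rng_ideal_pull[OF r]]
  have "gr n x \<in> pull P" if x: "x \<in> pull P" for x n
  proof -
    have "cls x \<in> P" using x by (simp add: pull_def)
    then obtain M f where f: "finite M" "\<forall>n\<in>M. f n \<in> P \<inter> homogeneous_component E n" "cls x = (\<Oplus>\<^bsub>R\<^esub>n\<in>M. f n)"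
      using P unfolding graded_ideal_def by blast
    have "\<forall>n\<in>M. \<exists>y. y \<in> Hom n \<and> f n = cls y" using f(2) by (auto simp: homogeneous_component_R)
    then obtain y where y: "\<And>n. n \<in> M \<Longrightarrow> y n \<in> Hom n \<and> f n = cls (y n)" by metis
    have h: "homog n (y n)" if "n \<in> M" for n using y[OF that] Hom_homog by blast
    have yA: "y n \<in> A" if "n \<in> M" for n using h[OF that] by (simp add: homog_def)
    have yP: "y n \<in> pull P" if "n \<in> M" for n using y[OF that] yA[OF that] f(2) that by (auto simp: pull_def)
    have "(\<Oplus>\<^bsub>R\<^esub>n\<in>M. f n) = (\<Oplus>\<^bsub>R\<^esub>n\<in>M. cls (y n))"
      using y yA by (intro R.finsum_cong') (auto intro: cls_carrier)
    also have "\<dots> = cls (sum y M)" using f(1) yA by (intro finsum_R)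
    finally have "cls x = cls (sum y M)" using f(3) by simp
    moreover have "sum y M \<in> A" by (rule A_sum) (rule yA)
    ultimately have "x = sum y M" using cls_inj D(2)[OF x] by blast
    then have "gr n x = (\<Sum>i\<in>M. gr n (y i))" using yA by (simp add: gr_sum)
    also have "\<dots> \<in> pull P"
      using yP D(3) by (intro ideal_sum[OF rng_ideal_pull[OF r]]) (auto simp: gr_homog[OF h])
    finally show ?thesis .
  qed
  then show "P \<subseteq> carrier R \<and> ideal (pull P) \<and> graded (pull P)"
    using r rng_ideal_iff by (auto simp: graded_def)
next
  assume P: "P \<subseteq> carrier R \<and> ideal (pull P) \<and> graded (pull P)"
  then have r: "rng_ideal R P" by (simp add: rng_ideal_iff)
  have "\<exists>M f. finite M \<and> (\<forall>n\<in>M. f n \<in> P \<inter> homogeneous_component E n) \<and> x = (\<Oplus>\<^bsub>R\<^esub>n\<in>M. f n)" if x: "x \<in> P" for x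
  proof -
    obtain a where a: "a \<in> pull P" "x = cls a" using image_pull[of P] P x by blast
    then have aA: "a \<in> A" by (simp add: pull_def)
    obtain M where M: "finite M" "a = (\<Sum>n\<in>M. gr n a)" using gr_decomp[OF aA] by blast
    have "gr n a \<in> pull P" for n using P a by (simp add: graded_def)
    then have "cls (gr n a) \<in> P \<inter> homogeneous_component E n" for n
      using gr_Hom[OF aA] by (auto simp: homogeneous_component_R pull_def)
    moreover have "x = (\<Oplus>\<^bsub>R\<^esub>n\<in>M. cls (gr n a))"
      using finsum_R[OF M(1), of "\<lambda>n. gr n a"] gr_A[OF aA] M(2) a(2) by simp
    ultimately show ?thesis using M(1)
      by (intro exI[of _ M] exI[of _ "\<lambda>n. cls (gr n a)"] conjI ballI)
  qed
  then show "graded_ideal E P" using r unfolding graded_ideal_def by blast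
qed

end

section \<open>Simple modules and maximal left ideals\<close>

context leavitt_model
begin

interpretation R: abelian_group R
  by (rule abelian_group_R)

lemma simple_left_maximal:
  fixes M :: "(('v, 'e, 'k) lpa_term set, 'b) module"
  assumes M: "left_module R M" and simple: "simple_action R M"
  shows "\<exists>N v. maximal_at N v \<and> pull (annihilator R M) = core N"
proof -
  define act where "act a x = cls a \<odot>\<^bsub>M\<^esub> x" for a x
  have grp: "abelian_group M"
    and act_closed: "a \<in> A \<Longrightarrow> x \<in> carrier M \<Longrightarrow> act a x \<in> carrier M"
    and act_add_left: "a \<in> A \<Longrightarrow> b \<in> A \<Longrightarrow> x \<in> carrier M \<Longrightarrow> act (a + b) x = act a x \<oplus>\<^bsub>M\<^esub> act b x"
    and act_add_right: "a \<in> A \<Longrightarrow> x \<in> carrier M \<Longrightarrow> y \<in> carrier M \<Longrightarrow> act a (x \<oplus>\<^bsub>M\<^esub> y) = act a x \<oplus>\<^bsub>M\<^esub> act a y"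
    and act_mult: "a \<in> A \<Longrightarrow> b \<in> A \<Longrightarrow> x \<in> carrier M \<Longrightarrow> act (a * b) x = act a (act b x)"
    for a b x y
    using M by (auto simp: left_module_def additive_action_def act_def cls_carrier simp flip: add_R mult_R)
  interpret M: abelian_group M by (rule grp)
  have act_0: "act 0 x = \<zero>\<^bsub>M\<^esub>" if "x \<in> carrier M" for x
    using act_add_left[OF A_0 A_0 that] act_closed[OF A_0 that] M.add.l_cancel_one' by fastforce
  have act_zero: "act a \<zero>\<^bsub>M\<^esub> = \<zero>\<^bsub>M\<^esub>" if "a \<in> A" for a
    using act_add_right[OF that M.zero_closed M.zero_closed] act_closed[OF that M.zero_closed] M.add.l_cancel_one' by fastforce
  have act_uminus: "act (- a) x = \<ominus>\<^bsub>M\<^esub> act a x" if "a \<in> A" "x \<in> carrier M" for a x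
  proof -
    have "act (- a) x \<oplus>\<^bsub>M\<^esub> act a x = \<zero>\<^bsub>M\<^esub>"
      using act_add_left[OF A_uminus[OF that(1)] that] act_0[OF that(2)] by simp
    then show ?thesis using act_closed A_uminus that M.minus_equality by metis
  qed
  have act_diff: "act (a - b) x = \<zero>\<^bsub>M\<^esub> \<longleftrightarrow> act a x = act b x"
    if "a \<in> A" "b \<in> A" "x \<in> carrier M" for a b x
  proof -
    have eq: "act a x = act (a - b) x \<oplus>\<^bsub>M\<^esub> act b x"
      using act_add_left[OF A_diff[OF that(1,2)] that(2,3)] by simp
    have c: "act (a - b) x \<in> carrier M" "act b x \<in> carrier M" using that act_closed A_diff by auto
    show ?thesis
    proof
      assume "act (a - b) x = \<zero>\<^bsub>M\<^esub>"
      then show "act a x = act b x" using eq c by simp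
    next
      assume "act a x = act b x"
      then have "act (a - b) x \<oplus>\<^bsub>M\<^esub> act b x = act b x" using eq by simp
      then show "act (a - b) x = \<zero>\<^bsub>M\<^esub>" using c M.add.r_cancel_one by blast
    qed
  qed
  define Ann where "Ann = {a \<in> A. \<forall>x\<in>carrier M. act a x = \<zero>\<^bsub>M\<^esub>}"
  have ann: "pull (annihilator R M) = Ann"
    by (auto simp: pull_def annihilator_def Ann_def act_def cls_carrier)
  have "ideal Ann"
    unfolding ideal_def lideal_def Ann_def
    by (auto simp: A_0 A_add A_mult act_0 act_add_left act_mult act_closed act_zero)
  moreover have "Ann \<noteq> A"
  proof -
    obtain a x where "a \<in> carrier R" "x \<in> carrier M" "a \<odot>\<^bsub>M\<^esub> x \<noteq> \<zero>\<^bsub>M\<^esub>"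
      using simple unfolding simple_action_def by blast
    then obtain b where "b \<in> A" "act b x \<noteq> \<zero>\<^bsub>M\<^esub>" by (auto simp: act_def carrier_R)
    then show ?thesis using \<open>x \<in> carrier M\<close> by (auto simp: Ann_def)
  qed
  \<comment> \<open>The annihilator is a proper ideal, and an ideal that contains all vertices is
    everything; so some vertex acts nontrivially.\<close>
  ultimately obtain v where v: "v \<in> verts E" "V v \<notin> Ann" using ideal_vertices_all by blast
  then obtain y where y: "y \<in> carrier M" "act (V v) y \<noteq> \<zero>\<^bsub>M\<^esub>" by (auto simp: Ann_def A_V)
  define m where "m = act (V v) y"
  have m: "m \<in> carrier M" "m \<noteq> \<zero>\<^bsub>M\<^esub>" "act (V v) m = m"
    using y v V_idem[OF v(1)] act_mult[OF A_V[OF v(1)] A_V[OF v(1)] y(1)] by (auto simp: m_def act_closed A_V)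
  \<comment> \<open>The multiples of z form a submodule, which is nonzero by assumption and hence
    the whole module.\<close>
  have gens: "\<exists>b\<in>A. act b z = x" if z: "z \<in> carrier M" "\<exists>a\<in>A. act a z \<noteq> \<zero>\<^bsub>M\<^esub>" and x: "x \<in> carrier M" for z x
  proof -
    define S where "S = (\<lambda>b. act b z) ` A"
    have "module_sub R M S"
      unfolding module_sub_def
    proof
      show "additive_subgroup S M"
        unfolding additive_subgroup_def
      proof (rule subgroup.intro)
        fix t assume "t \<in> S"
        then obtain b where b: "b \<in> A" "t = act b z" by (auto simp: S_def)
        have "inv\<^bsub>add_monoid M\<^esub> t = act (- b) z" using act_uminus b z by (simp add: a_inv_def)
        then show "inv\<^bsub>add_monoid M\<^esub> t \<in> S" using A_uminus[OF b(1)] by (auto simp: S_def)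
      next
        fix t t' assume "t \<in> S" "t' \<in> S"
        then obtain b c where bc: "b \<in> A" "t = act b z" "c \<in> A" "t' = act c z" by (auto simp: S_def)
        then have "t \<otimes>\<^bsub>add_monoid M\<^esub> t' = act (b + c) z"
          using act_add_left[of b c z] z by simp
        then show "t \<otimes>\<^bsub>add_monoid M\<^esub> t' \<in> S" unfolding S_def using A_add bc by blast
      next
        show "\<one>\<^bsub>add_monoid M\<^esub> \<in> S" using act_0[OF z(1)] A_0 by (auto simp: S_def image_iff intro: bexI[of _ 0])
      qed (use z act_closed in \<open>auto simp: S_def\<close>)
      show "\<forall>a\<in>carrier R. \<forall>x\<in>S. a \<odot>\<^bsub>M\<^esub> x \<in> S"
      proof (intro ballI)
        fix c t assume "c \<in> carrier R" "t \<in> S"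
        then obtain a b where ab: "a \<in> A" "c = cls a" "b \<in> A" "t = act b z" by (auto simp: carrier_R S_def)
        then have "c \<odot>\<^bsub>M\<^esub> t = act (a * b) z" using act_mult z(1) by (simp add: act_def)
        then show "c \<odot>\<^bsub>M\<^esub> t \<in> S" unfolding S_def using A_mult ab by blast
      qed
    qed
    moreover have "S \<noteq> {\<zero>\<^bsub>M\<^esub>}" using z(2) by (auto simp: S_def)
    ultimately have "S = carrier M" using simple unfolding simple_action_def by blast
    then have "x \<in> S" using x by simp
    then show ?thesis by (auto simp: S_def)
  qed
  define N where "N = {a \<in> A. act a m = \<zero>\<^bsub>M\<^esub>}"
  have "lideal N"
    unfolding lideal_def N_def using m(1)
    by (auto simp: A_0 A_add A_mult act_0 act_add_left act_mult act_zero)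
  moreover have "V v \<notin> N" using m by (simp add: N_def)
  moreover have "a - a * V v \<in> N" if a: "a \<in> A" for a
    using act_diff[OF a A_mult[OF a A_V[OF v(1)]] m(1)] act_mult[OF a A_V[OF v(1)] m(1)] m(3) a v
    by (simp add: N_def A_diff A_mult A_V)
  moreover have "\<exists>a\<in>A. V v - a * b \<in> N" if b: "b \<in> A" "b \<notin> N" for b
  proof -
    have bm: "act b m \<in> carrier M" "act b m \<noteq> \<zero>\<^bsub>M\<^esub>" using b m act_closed by (auto simp: N_def)
    obtain \<epsilon> where "\<epsilon> \<in> A" "\<epsilon> * b = b" using local_unit b by blast
    then have "\<exists>a\<in>A. act a (act b m) \<noteq> \<zero>\<^bsub>M\<^esub>" using act_mult[of \<epsilon> b m] b m bm by (intro bexI[of _ \<epsilon>]) auto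
    then obtain a where a: "a \<in> A" "act a (act b m) = m" using gens[OF bm(1) _ m(1)] by blast
    then have "V v - a * b \<in> N"
      using act_diff[of "V v" "a * b" m] act_mult[of a b m] b m v by (simp add: N_def A_diff A_mult A_V)
    then show ?thesis using a by blast
  qed
  ultimately have "maximal_at N v" using v unfolding maximal_at_def by blast
  moreover have "Ann = core N"
  proof (intro equalityI subsetI)
    fix a assume "a \<in> Ann"
    then show "a \<in> core N" using m act_mult act_closed by (auto simp: Ann_def core_def N_def A_mult)
  next
    fix a assume a: "a \<in> core N"
    have "act a x = \<zero>\<^bsub>M\<^esub>" if x: "x \<in> carrier M" for x
    proof -
      have "\<exists>a\<in>A. act a m \<noteq> \<zero>\<^bsub>M\<^esub>" using m A_V[OF v(1)] by (intro bexI[of _ "V v"]) auto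
      then obtain b where "b \<in> A" "act b m = x" using gens[OF m(1) _ x] by blast
      then show ?thesis using a act_mult[of a b m] m by (auto simp: core_def N_def)
    qed
    then show "a \<in> Ann" using a by (simp add: Ann_def core_def)
  qed
  ultimately show ?thesis using ann by blast
qed

lemma maximal_simple_left:
  assumes N: "maximal_at N v"
  shows "\<exists>M :: (('v, 'e, 'k) lpa_term set, ('v, 'e, 'k) lpa_term set set) module.
    left_module R M \<and> simple_action R M \<and> annihilator R M = cls ` core N"
proof -
  note L = N_lideal[OF N]
  note LD = lidealD[OF L]
  \<comment> \<open>The coset of x modulo \<open>N\<close> is stored as a set of classes, since the
    module must live on sets of elements of the presented algebra.\<close>
  define q where "q x = {cls y | y. y \<in> A \<and> y - x \<in> N}" for x
  have q_eq: "q x = q y \<longleftrightarrow> x - y \<in> N" if "x \<in> A" "y \<in> A" for x y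
  proof
    assume eq: "q x = q y"
    have "cls x \<in> q x" using that LD(3) by (auto simp: q_def)
    then obtain z where "cls x = cls z" "z \<in> A" "z - y \<in> N" unfolding eq by (auto simp: q_def)
    then show "x - y \<in> N" using cls_inj that by metis
  next
    assume xy: "x - y \<in> N"
    have "z - x \<in> N \<longleftrightarrow> z - y \<in> N" for z
      using LD(4)[OF _ xy, of "z - x"] LD(8)[OF _ xy, of "z - y"] by auto
    then show "q x = q y" by (auto simp: q_def)
  qed
  \<comment> \<open>The module operations are functions on cosets, so they need chosen
    representatives; \<open>unc\<close> likewise inverts \<open>cls\<close> on scalars of the
    action.\<close>
  define rep where "rep C = (SOME x. x \<in> A \<and> q x = C)" for C
  have rep: "rep (q x) \<in> A \<and> q (rep (q x)) = q x" if "x \<in> A" for x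
    unfolding rep_def by (rule someI[of _ x]) (use that in simp)
  have rep_N: "rep (q x) - x \<in> N" if "x \<in> A" for x
    using rep[OF that] q_eq that by blast
  define unc where "unc c = (THE a. a \<in> A \<and> cls a = c)" for c
  have unc: "unc (cls a) = a" if "a \<in> A" for a
    unfolding unc_def using that cls_inj by (intro the_equality) auto
  define M :: "(('v, 'e, 'k) lpa_term set, ('v, 'e, 'k) lpa_term set set) module" where
    "M = \<lparr>carrier = q ` A, mult = undefined, one = undefined, zero = q 0,
      add = (\<lambda>C D. q (rep C + rep D)), module.smult = (\<lambda>c C. q (unc c * rep C))\<rparr>"
  have carrier: "carrier M = q ` A" and zero: "\<zero>\<^bsub>M\<^esub> = q 0" by (simp_all add: M_def)
  have add: "q x \<oplus>\<^bsub>M\<^esub> q y = q (x + y)" if "x \<in> A" "y \<in> A" for x y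
  proof -
    have "rep (q x) + rep (q y) - (x + y) = (rep (q x) - x) + (rep (q y) - y)" by simp
    then have "rep (q x) + rep (q y) - (x + y) \<in> N" using rep_N that LD(4) by metis
    then show ?thesis using q_eq that rep A_add by (simp add: M_def)
  qed
  have act: "cls a \<odot>\<^bsub>M\<^esub> q x = q (a * x)" if "a \<in> A" "x \<in> A" for a x
  proof -
    have "a * (rep (q x) - x) \<in> N" using rep_N that LD(5) by blast
    then have "a * rep (q x) - a * x \<in> N" by (simp add: right_diff_distrib)
    then show ?thesis using q_eq that rep A_mult unc by (simp add: M_def)
  qed
  have grp: "abelian_group M"
  proof (rule abelian_groupI)
    show "\<exists>y\<in>carrier M. y \<oplus>\<^bsub>M\<^esub> x = \<zero>\<^bsub>M\<^esub>" if x: "x \<in> carrier M" for x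
    proof -
      obtain a where "a \<in> A" "x = q a" using x by (auto simp: carrier)
      then show ?thesis by (intro bexI[of _ "q (- a)"]) (auto simp: add zero carrier A_uminus)
    qed
  qed (auto simp: carrier zero add A_0 A_add algebra_simps)
  have "left_module R M"
    unfolding left_module_def additive_action_def using grp
    by (auto simp: carrier carrier_R act add add_R mult_R A_mult A_add distrib_left distrib_right mult.assoc)
  moreover have "simple_action R M"
    unfolding simple_action_def
  proof (intro conjI allI impI)
    have Vv: "V v \<in> A" "V v \<notin> N" "v \<in> verts E" using N by (auto simp: maximal_at_def A_V)
    have "cls (V v) \<odot>\<^bsub>M\<^esub> q (V v) \<noteq> \<zero>\<^bsub>M\<^esub>"
      using act[OF Vv(1) Vv(1)] V_idem[OF Vv(3)] q_eq[OF Vv(1) A_0] Vv by (simp add: zero)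
    then show "\<exists>a\<in>carrier R. \<exists>x\<in>carrier M. a \<odot>\<^bsub>M\<^esub> x \<noteq> \<zero>\<^bsub>M\<^esub>"
      using Vv cls_carrier carrier by blast
    fix S assume S: "module_sub R M S"
    then interpret S: additive_subgroup S M by (simp add: module_sub_def)
    have Sact: "q (a * x) \<in> S" if "a \<in> A" "x \<in> A" "q x \<in> S" for a x
      using S that act[OF that(1,2)] cls_carrier[OF that(1)] unfolding module_sub_def by metis
    show "S = {\<zero>\<^bsub>M\<^esub>} \<or> S = carrier M"
    proof (cases "S \<subseteq> {\<zero>\<^bsub>M\<^esub>}")
      case True
      then show ?thesis using S.zero_closed by blast
    next
      case False
      then obtain t where t: "t \<in> S" "t \<noteq> q 0" unfolding zero by blast
      then have "t \<in> q ` A" using S.a_subset carrier by blast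
      then obtain y where y: "y \<in> A" "q y \<in> S" "q y \<noteq> q 0" using t by blast
      then have "y \<notin> N" using q_eq[OF y(1) A_0] by simp
      then obtain b where b: "b \<in> A" "V v - b * y \<in> N" using N y unfolding maximal_at_def by blast
      have "q (V v) \<in> S" using Sact[OF b(1) y(1,2)] q_eq[OF Vv(1) A_mult[OF b(1) y(1)]] b by simp
      then have "q (a * V v) \<in> S" if "a \<in> A" for a using Sact Vv that by blast
      moreover have "q a = q (a * V v)" if "a \<in> A" for a
        using N that q_eq[OF that A_mult[OF that Vv(1)]] unfolding maximal_at_def by blast
      ultimately have "carrier M \<subseteq> S" by (auto simp: carrier)
      then show ?thesis using S.a_subset by blast
    qed
  qed
  moreover have "annihilator R M = cls ` core N"
  proof -
    have "(\<forall>x\<in>carrier M. cls a \<odot>\<^bsub>M\<^esub> x = \<zero>\<^bsub>M\<^esub>) \<longleftrightarrow> (\<forall>x\<in>A. a * x \<in> N)" if "a \<in> A" for a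
      using that act q_eq A_0 A_mult by (auto simp: carrier zero)
    then show ?thesis by (auto simp: annihilator_def carrier_R core_def)
  qed
  ultimately show ?thesis by blast
qed

lemma left_primitive_R:
  "left_primitive R P \<longleftrightarrow> P \<subseteq> carrier R \<and> ideal (pull P) \<and> (\<exists>N v. maximal_at N v \<and> pull P = core N)"
proof
  assume "left_primitive R P"
  then show "P \<subseteq> carrier R \<and> ideal (pull P) \<and> (\<exists>N v. maximal_at N v \<and> pull P = core N)"
    unfolding left_primitive_def rng_ideal_iff using simple_left_maximal by blast
next
  assume P: "P \<subseteq> carrier R \<and> ideal (pull P) \<and> (\<exists>N v. maximal_at N v \<and> pull P = core N)"
  then obtain N v where N: "maximal_at N v" "pull P = core N" by blast
  have "P = cls ` core N" using image_pull[of P] P N(2) by simp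
  then show "left_primitive R P"
    unfolding left_primitive_def rng_ideal_iff using P maximal_simple_left[OF N(1)] by metis
qed

text \<open>Restriction of scalars along the involution exchanges left and right modules.\<close>

definition st :: "('v, 'e, 'k) lpa_term set \<Rightarrow> ('v, 'e, 'k) lpa_term set" where
  "st c = cls (star (THE a. a \<in> A \<and> cls a = c))"

lemma st_cls: "a \<in> A \<Longrightarrow> st (cls a) = cls (star a)"
proof -
  assume a: "a \<in> A"
  then have "(THE b. b \<in> A \<and> cls b = cls a) = a" using cls_inj by (intro the_equality) auto
  then show ?thesis by (simp add: st_def)
qed

lemma st_closed: "c \<in> carrier R \<Longrightarrow> st c \<in> carrier R"
  and st_st: "c \<in> carrier R \<Longrightarrow> st (st c) = c"
  and st_add: "c \<in> carrier R \<Longrightarrow> d \<in> carrier R \<Longrightarrow> st (c \<oplus>\<^bsub>R\<^esub> d) = st c \<oplus>\<^bsub>R\<^esub> st d"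
  and st_mult: "c \<in> carrier R \<Longrightarrow> d \<in> carrier R \<Longrightarrow> st (c \<otimes>\<^bsub>R\<^esub> d) = st d \<otimes>\<^bsub>R\<^esub> st c"
  by (auto simp: carrier_R st_cls star_A star_star add_R mult_R star_add star_mult A_add A_mult)

lemma pull_st: "P \<subseteq> carrier R \<Longrightarrow> pull (st ` P) = star ` pull P"
proof -
  assume P: "P \<subseteq> carrier R"
  have "st ` P = st ` cls ` pull P" using image_pull[OF P] by simp
  also have "\<dots> = cls ` star ` pull P"
    unfolding image_image by (intro image_cong) (auto simp: st_cls pull_def)
  finally have "pull (st ` P) = pull (cls ` star ` pull P)" by simp
  also have "\<dots> = star ` pull P" by (rule pull_image) (use star_A in \<open>auto simp: pull_def\<close>)
  finally show ?thesis .
qed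

lemma st_st_image: "P \<subseteq> carrier R \<Longrightarrow> st ` st ` P = P"
proof -
  assume P: "P \<subseteq> carrier R"
  have "st ` st ` P = (\<lambda>x. x) ` P"
    unfolding image_image by (rule image_cong) (use P st_st in auto)
  then show ?thesis by simp
qed

definition twist :: "(('v, 'e, 'k) lpa_term set, 'b) module \<Rightarrow> (('v, 'e, 'k) lpa_term set, 'b) module" where
  "twist M = M\<lparr>module.smult := \<lambda>a x. st a \<odot>\<^bsub>M\<^esub> x\<rparr>"

lemma twist_simps [simp]:
  "carrier (twist M) = carrier M" "\<zero>\<^bsub>twist M\<^esub> = \<zero>\<^bsub>M\<^esub>" "x \<oplus>\<^bsub>twist M\<^esub> y = x \<oplus>\<^bsub>M\<^esub> y"
  "a \<odot>\<^bsub>twist M\<^esub> x = st a \<odot>\<^bsub>M\<^esub> x"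
  by (simp_all add: twist_def)

lemma abelian_group_twist: "abelian_group M \<Longrightarrow> abelian_group (twist M)"
proof -
  assume "abelian_group M"
  then interpret M: abelian_group M .
  show ?thesis
    by (rule abelian_groupI)
      (auto simp: M.a_assoc M.a_comm M.a_lcomm intro: M.l_neg bexI[of _ "\<ominus>\<^bsub>M\<^esub> x" for x])
qed

lemma additive_action_twist: "additive_action R M \<Longrightarrow> additive_action R (twist M)"
  unfolding additive_action_def by (auto simp: st_add st_closed intro: abelian_group_twist)

lemma twist_right: "right_module R M \<Longrightarrow> left_module R (twist M)"
  unfolding left_module_def right_module_def by (auto simp: st_mult st_closed intro: additive_action_twist)

lemma twist_left: "left_module R M \<Longrightarrow> right_module R (twist M)"
  unfolding left_module_def right_module_def by (auto simp: st_mult st_closed intro: additive_action_twist)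

lemma module_sub_twist: "module_sub R (twist M) N \<longleftrightarrow> module_sub R M N"
proof -
  have "additive_subgroup N (twist M) \<longleftrightarrow> additive_subgroup N M"
    by (simp add: additive_subgroup_def subgroup_def twist_def m_inv_def)
  moreover have "(\<forall>a\<in>carrier R. \<forall>x\<in>N. st a \<odot>\<^bsub>M\<^esub> x \<in> N) \<longleftrightarrow> (\<forall>a\<in>carrier R. \<forall>x\<in>N. a \<odot>\<^bsub>M\<^esub> x \<in> N)"
    using st_closed st_st by metis
  ultimately show ?thesis by (simp add: module_sub_def)
qed

lemma simple_twist: "simple_action R M \<Longrightarrow> simple_action R (twist M)"
proof -
  assume M: "simple_action R M"
  then obtain a x where a: "a \<in> carrier R" "x \<in> carrier M" "a \<odot>\<^bsub>M\<^esub> x \<noteq> \<zero>\<^bsub>M\<^esub>"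
    unfolding simple_action_def by blast
  then have "st a \<in> carrier R" "st (st a) \<odot>\<^bsub>M\<^esub> x \<noteq> \<zero>\<^bsub>M\<^esub>" using st_closed st_st by auto
  then have "\<exists>a\<in>carrier R. \<exists>x\<in>carrier M. st a \<odot>\<^bsub>M\<^esub> x \<noteq> \<zero>\<^bsub>M\<^esub>" using a(2) by blast
  then show ?thesis using M by (simp add: simple_action_def module_sub_twist)
qed

lemma annihilator_twist: "annihilator R (twist M) = st ` annihilator R M"
proof (intro equalityI subsetI)
  fix a assume "a \<in> annihilator R (twist M)"
  then have "st a \<in> annihilator R M" "a = st (st a)" using st_closed st_st by (auto simp: annihilator_def)
  then show "a \<in> st ` annihilator R M" by blast
next
  fix a assume "a \<in> st ` annihilator R M"
  then show "a \<in> annihilator R (twist M)" using st_closed st_st by (auto simp: annihilator_def)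
qed

lemma rng_ideal_st: "rng_ideal R P \<Longrightarrow> rng_ideal R (st ` P)"
proof -
  assume P: "rng_ideal R P"
  have "st ` P \<subseteq> carrier R" using rng_ideal_sub[OF P] st_closed by blast
  then show ?thesis
    using ideal_star[OF rng_ideal_pull[OF P]] pull_st[OF rng_ideal_sub[OF P]] by (simp add: rng_ideal_iff)
qed

lemma right_imp_left: "right_primitive R P \<Longrightarrow> left_primitive R (st ` P)"
  unfolding right_primitive_def left_primitive_def
  using rng_ideal_st twist_right simple_twist annihilator_twist by blast

lemma left_imp_right: "left_primitive R P \<Longrightarrow> right_primitive R (st ` P)"
  unfolding right_primitive_def left_primitive_def
  using rng_ideal_st twist_left simple_twist annihilator_twist by blast

lemma left_primitive_iff:
  assumes "proper_ideal R P"
  shows "left_primitive R P \<longleftrightarrow> primitive_conds (pull P)"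
proof -
  have P: "P \<subseteq> carrier R" "ideal (pull P)" "pull P \<noteq> A" using assms by (auto simp: proper_ideal_R)
  show ?thesis
  proof
    assume "left_primitive R P"
    then obtain N v where "maximal_at N v" "pull P = core N" by (auto simp: left_primitive_R)
    then show "primitive_conds (pull P)" using core_conds by simp
  next
    assume "primitive_conds (pull P)"
    then show "left_primitive R P" using conds_imp_primitive[OF P(2,3)] P by (simp add: left_primitive_R)
  qed
qed

text \<open>P is right primitive exactly when its image under the involution is left primitive, and
  the conditions that characterise left primitivity are invariant under the involution.\<close>

lemma right_primitive_iff:
  assumes pr: "proper_ideal R P"
  shows "right_primitive R P \<longleftrightarrow> left_primitive R P"
proof -
  have P: "P \<subseteq> carrier R" "ideal (pull P)" "pull P \<noteq> A" using pr by (auto simp: proper_ideal_R)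
  have PA: "pull P \<subseteq> A" by (auto simp: pull_def)
  have "star ` pull P \<noteq> A"
  proof
    assume "star ` pull P = A"
    then have "star ` A = pull P" using star_star_image[OF PA] by simp
    moreover have "star ` A = A" using star_star_image[OF order_refl] star_A by blast
    ultimately show False using P by simp
  qed
  then have pr': "proper_ideal R (st ` P)"
    using P st_closed ideal_star[OF P(2)] pull_st[OF P(1)] by (auto simp: proper_ideal_R)
  have "right_primitive R P \<longleftrightarrow> left_primitive R (st ` P)"
    using right_imp_left[of P] left_imp_right[of "st ` P"] st_st_image[OF P(1)] by auto
  also have "\<dots> \<longleftrightarrow> primitive_conds (star ` pull P)"
    using left_primitive_iff[OF pr'] pull_st[OF P(1)] by simp
  also have "\<dots> \<longleftrightarrow> primitive_conds (pull P)"
    using primitive_conds_star[OF P(2)] primitive_conds_star[OF ideal_star[OF P(2)]] star_star_image[OF PA] by auto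
  also have "\<dots> \<longleftrightarrow> left_primitive R P" using left_primitive_iff[OF pr] by simp
  finally show ?thesis .
qed

lemma primitive_conds_R:
  assumes pr: "proper_ideal R P" and H: "H = ideal_vertices E P"
  shows "primitive_conds (pull P) \<longleftrightarrow>
       (prime_ideal R P \<and> \<not> graded_ideal E P) \<or>
       (graded_ideal E P \<and> prime_ideal R P \<and>
          (\<exists>u\<in>breaking_vertices E H. P = ideal_HS E H (breaking_vertices E H - {u}))) \<or>
       (graded_ideal E P \<and> P = ideal_HS E H (breaking_vertices E H) \<and>
          MT3 E (verts E - H) \<and> condition_L E (verts E - H) \<and>
          countable_separation E (verts E - H))"
proof -
  have P: "P \<subseteq> carrier R" "ideal (pull P)" "pull P \<noteq> A" using pr by (auto simp: proper_ideal_R)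
  have Hv: "vts (pull P) = H" using H by (simp add: ideal_vertices_pull)
  have her: "hereditary H" using vts_hereditary[OF P(2)] Hv by simp
  have form: "P = ideal_HS E H S \<longleftrightarrow> pull P = IHS H S" if S: "S \<subseteq> breaking_vertices E H" for S
  proof -
    have "IHS H S \<subseteq> A" using idealD(1)[OF IHS_ideal[OF her S]] .
    then show ?thesis
      using ideal_HS_R[OF her S] pull_image[of "IHS H S"] image_pull[OF P(1)] by auto
  qed
  have "P = ideal_HS E H (breaking_vertices E H - {u}) \<longleftrightarrow> pull P = IHS H (breaking_vertices E H - {u})" for u
    by (rule form) blast
  then show ?thesis
    unfolding primitive_conds_def Let_def Hv prime_ideal_R graded_ideal_R form[OF order_refl]
    using P by simp
qed

end

theorem theorem4p3:
  fixes E :: "('v, 'e) pre_digraph"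
    and P :: "('v, 'e, 'k::field) lpa_term set set"
    and H :: "'v set"
  assumes graph: "wf_digraph E"
    and proper: "proper_ideal (leavitt E) P"
    and H: "H = ideal_vertices E P"
  shows "(right_primitive (leavitt E) P \<longleftrightarrow> left_primitive (leavitt E) P) \<and>
    (right_primitive (leavitt E) P \<longleftrightarrow>
       (prime_ideal (leavitt E) P \<and> \<not> graded_ideal E P) \<or>
       (graded_ideal E P \<and> prime_ideal (leavitt E) P \<and>
          (\<exists>u\<in>breaking_vertices E H. P = ideal_HS E H (breaking_vertices E H - {u}))) \<or>
       (graded_ideal E P \<and> P = ideal_HS E H (breaking_vertices E H) \<and>
          MT3 E (verts E - H) \<and> condition_L E (verts E - H) \<and>
          countable_separation E (verts E - H)))"
proof -
  interpret leavitt_model E "lscl :: 'k \<Rightarrow> (('v, 'e, 'k) free_alg, 'k) endo" "\<lambda>v. lmul_term E (Vertex v)"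
    "\<lambda>e. lmul_term E (Edge e)" "\<lambda>e. lmul_term E (Ghost e)"
    by (rule leavitt_model_lmul[OF graph])
  show ?thesis
    using right_primitive_iff[OF proper] left_primitive_iff[OF proper] primitive_conds_R[OF proper H] by simp
qed

end
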